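(* With respect to the chiral topology on $\mathcal{K}$, there are homotopy equivalences of type-$DA$ bimodules \[{}_{\mathcal{K}}\mathcal{X}(\mathrm{Cyl}_{\mathbb{I}})^{\mathcal{K}}\simeq{}_{\mathcal{K}}[\mathbb{I}]^{\mathcal{K}}\qquad\text{and}\qquad {}_{\mathcal{K}}\mathcal{X}(\mathrm{Cyl}_{E})^{\mathcal{K}}\simeq{}_{\mathcal{K}}[E]^{\mathcal{K}}.\]
   Context: $\mathbb{F}=\mathbb{Z}/2$. Type-$DA$ bimodules and $\boxtimes$ are those of Lipshitz–Ozsváth–Thurston. Surgery algebra $\mathcal{K}$: the algebra over $\mathbf{I}=\mathbf{I}_0\oplus\mathbf{I}_1$, $\mathbf{I}_\varepsilon\cong\mathbb{F}$, with $\mathbf{I}_0\mathcal{K}\mathbf{I}_0=\mathbb{F}[W,Z]$, $\mathbf{I}_1\mathcal{K}\mathbf{I}_1=\mathbb{F}[U,T,T^{-1}]$, $\mathbf{I}_1\mathcal{K}\mathbf{I}_0=\mathbb{F}[U,T,T^{-1}]\otimes\langle\sigma,\tau\rangle$, $\mathbf{I}_0\mathcal{K}\mathbf{I}_1=0$, relations $\sigma W=UT^{-1}\sigma$, $\sigma Z=T\sigma$, $\tau W=T^{-1}\tau$, $\tau Z=UT\tau$. In idempotent 0, write $U=WZ$. Chiral topology on $\mathcal{K}$: the linear topology with basis at $0$ the right ideals $J_n$, $n\in\mathbb{N}$, with $\mathbf{I}_0J_n\mathbf{I}_0=(W^n,Z^n)$, $\mathbf{I}_1J_n\mathbf{I}_0=(\mathbf{I}_1\mathcal{K}\mathbf{I}_0)\cdot(W^n,Z^n)$,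 $\mathbf{I}_1J_n\mathbf{I}_1=(U^n)$. The chiral tensor product $X\vec\otimes Y$ of linear topological spaces is $X\otimes Y$ with $E$ open iff $X'\otimes Y\subset E$ for some open subspace $X'\subset X$ and for each $x\in X$ there is an open $Y_x\subset Y$ with $x\otimes Y_x\subset E$. All modules are completed, the infinitely generated modules below having the cofinite basis topology (completion: direct product of the spans of basis elements), and structure maps and morphisms of modules are continuous with respect to completed chiral tensor products $\vec\otimes$. For an algebra homomorphism $\phi\colon\mathcal{K}\to\mathcal{K}$ over $\mathbf{I}$, ${}_{\mathcal{K}}[\phi]^{\mathcal{K}}$ is the bimodule with underlying space $\mathbf{I}$ and only nonzero structure map $\delta_2^1(a,1)=1\otimes\phi(a)$. $\mathbb{I}$ is the identity and $E$ is the algebra map with $E(W)=Z$, $E(Z)=W$, $E(\sigma)=\tau$, $E(\tau)=\sigma$, $E(T^{\pm1})=T^{\mp1}$, $E(U)=U$. $\mathrm{Cyl}_{\mathbb{I}}$ and $\mathrm{Cyl}_E$ are the mapping cylinders ($\mathbb{T}^2\times[0,1]$ with parametrized boundary) of the identity map and of the elliptic involution $E(x,y)=(-x,-y)$ of $\mathbb{T}^2=\mathbb{R}^2/\mathbb{Z}^2$. $\mathcal{X}(\cdot)$ is Zemke's bordered link surgery invariant. Concretely, $\mathrm{Cyl}_{\mathbb{I}}$ (resp. $\mathrm{Cyl}_E$) is the complement of the two outer components of the connected sum of a negative and a positive Hopf link (resp. of two negative Hopf links), with $0$-surgery performed on the middle component, and by the pairing theorem ${}_{\mathcal{K}}\mathcal{X}(\mathrm{Cyl}_{\mathbb{I}})^{\mathcal{K}}={}_{\mathcal{K}}\mathcal{H}_-^{\mathcal{K}}\boxtimes{}_{\mathcal{K}}\mathcal{H}_+^{\mathcal{K}}$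 and ${}_{\mathcal{K}}\mathcal{X}(\mathrm{Cyl}_E)^{\mathcal{K}}={}_{\mathcal{K}}\mathcal{H}_-^{\mathcal{K}}\boxtimes{}_{\mathcal{K}}\mathcal{H}_-^{\mathcal{K}}$, where $\mathcal{H}_\pm$ are the $(0,0)$-framed $DA$-bimodules of the positive/negative Hopf links, ${}_{\mathcal{K}}\mathcal{H}_+^{\mathcal{K}}={}_{\mathcal{K}}\mathcal{H}_-^{\mathcal{K}}\boxtimes{}_{\mathcal{K}}[E]^{\mathcal{K}}$, and $\mathcal{H}_-$ is the following bimodule. Generators of $\mathcal{H}_-$ (subscript = (left, right) idempotent): $W^i_{00},Z^i_{00}$ ($i\ge0$, $W^0_{00}\ne Z^0_{00}$); $W^i_{01},Z^i_{01}$ ($i\ge0$, with $W^0_{01}=Z^0_{01}=1_{01}$); $T^i_{10}$, $T^i_{11}$ ($i\in\mathbb{Z}$). $\delta_1^1$: $W^i_{00}\mapsto W^i_{01}\otimes T\sigma+W^{i+1}_{01}\otimes T\tau$; $Z^i_{00}\mapsto Z^{i+1}_{01}\otimes\sigma+Z^i_{01}\otimes\tau$; $T^i_{10}\mapsto T^i_{11}\otimes\sigma+T^{i-1}_{11}\otimes\tau$. $\delta_2^1$: $(W,W^i_{00})\mapsto W^{i+1}_{00}\otimes1$; $(Z,W^i_{00})\mapsto W^{i-1}_{00}\otimes U$ if $i>0$ and $Z^0_{00}\otimes Z$ if $i=0$; $(Z,Z^i_{00})\mapsto Z^{i+1}_{00}\otimes1$; $(W,Z^i_{00})\mapsto Z^{i-1}_{00}\otimes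 U$ if $i>0$ and $W^0_{00}\otimes W$ if $i=0$; $(\sigma,W^i_{00})\mapsto T^{-i}_{10}\otimes U^iZ$; $(\tau,W^i_{00})\mapsto T^{-i}_{10}\otimes1$; $(\sigma,Z^i_{00})\mapsto T^{i+1}_{10}\otimes1$; $(\tau,Z^i_{00})\mapsto T^{i+1}_{10}\otimes U^iW$; $(W,W^i_{01})\mapsto W^{i+1}_{01}\otimes1$; $(Z,W^i_{01})\mapsto W^{i-1}_{01}\otimes U$ ($i>0$); $(Z,Z^i_{01})\mapsto Z^{i+1}_{01}\otimes1$; $(W,Z^i_{01})\mapsto Z^{i-1}_{01}\otimes U$ ($i>0$); $(\sigma,W^i_{01})\mapsto T^{-i}_{11}\otimes U^i$; $(\sigma,Z^i_{01})\mapsto T^i_{11}\otimes1$; $(\tau,W^i_{01})\mapsto T^{-i}_{11}\otimes T^{-1}$; $(\tau,Z^i_{01})\mapsto T^i_{11}\otimes U^iT^{-1}$; for $\varepsilon\in\{0,1\}$, $(T^{\pm1},T^i_{1\varepsilon})\mapsto T^{i\pm1}_{1\varepsilon}\otimes1$ and $(U,T^i_{1\varepsilon})\mapsto T^i_{1\varepsilon}\otimes U$. The map $\delta_2^1$ is extended multiplicatively to all of $\mathcal{K}$, and $\delta_j^1=0$ for $j\ge3$.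
   Formalization: I_1 J_n I_0 is taken as the span of the monomials σW^iZ^j, τW^iZ^j with i≥n or j≥n; the literal product (I_1 K I_0)(W^n,Z^n) is all of I_1 K I_0, as σ=T^{-n}σZ^n, and then the structure map δ_2^1 of H_- is not continuous. *)

theory Defs
  imports "HOL-Library.Poly_Mapping" "HOL-Library.Z2"
begin

section \<open>The surgery algebra\<close>

datatype idem = I0 | I1

text \<open>
  The monomial basis of the surgery algebra over \<open>\<F> = bit\<close>:
  \<open>WZ a b\<close> is $W^a Z^b$, \<open>UT a k\<close> is $U^a T^k$, \<open>UTsigma a k\<close> is $U^a T^k \sigma$ and
  \<open>UTtau a k\<close> is $U^a T^k \tau$. The partial product \<open>kmul\<close> is \<open>None\<close> where the product of the
  algebra vanishes; it is obtained from the relations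
  $\sigma W = U T^{-1} \sigma$, $\sigma Z = T \sigma$, $\tau W = T^{-1} \tau$, $\tau Z = U T \tau$.
\<close>

datatype kmon = WZ nat nat | UT nat int | UTsigma nat int | UTtau nat int

type_synonym kalg = "kmon \<Rightarrow>\<^sub>0 bit"

fun klid :: "kmon \<Rightarrow> idem" where
  "klid (WZ a b) = I0"
| "klid (UT a k) = I1"
| "klid (UTsigma a k) = I1"
| "klid (UTtau a k) = I1"

fun krid :: "kmon \<Rightarrow> idem" where
  "krid (WZ a b) = I0"
| "krid (UT a k) = I1"
| "krid (UTsigma a k) = I0"
| "krid (UTtau a k) = I0"

fun kmul :: "kmon \<Rightarrow> kmon \<Rightarrow> kmon option" where
  "kmul (WZ a b) (WZ c d) = Some (WZ (a + c) (b + d))"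
| "kmul (UT a k) (UT c l) = Some (UT (a + c) (k + l))"
| "kmul (UT a k) (UTsigma c l) = Some (UTsigma (a + c) (k + l))"
| "kmul (UT a k) (UTtau c l) = Some (UTtau (a + c) (k + l))"
| "kmul (UTsigma a k) (WZ c d) = Some (UTsigma (a + c) (k + int d - int c))"
| "kmul (UTtau a k) (WZ c d) = Some (UTtau (a + d) (k + int d - int c))"
| "kmul _ _ = None"

fun kone :: "idem \<Rightarrow> kmon" where
  "kone I0 = WZ 0 0"
| "kone I1 = UT 0 0"

lemma kmul_relations:
  "kmul (UTsigma 0 0) (WZ 1 0) = kmul (UT 1 (- 1)) (UTsigma 0 0)"
  "kmul (UTsigma 0 0) (WZ 0 1) = kmul (UT 0 1) (UTsigma 0 0)"
  "kmul (UTtau 0 0) (WZ 1 0) = kmul (UT 0 (- 1)) (UTtau 0 0)"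
  "kmul (UTtau 0 0) (WZ 0 1) = kmul (UT 1 1) (UTtau 0 0)"
  by simp_all

lemma kmul_eq_None_iff: "kmul a b = None \<longleftrightarrow> krid a \<noteq> klid b"
  by (cases a; cases b) simp_all

lemma kmul_assoc:
  "Option.bind (kmul a b) (\<lambda>x. kmul x c) = Option.bind (kmul b c) (kmul a)"
  by (cases a; cases b; cases c) simp_all

lemma kmul_kone: "kmul (kone (klid a)) a = Some a" "kmul a (kone (krid a)) = Some a"
  by (cases a; simp)+


section \<open>Linear topological spaces over \<open>\<F>\<close>, the chiral tensor product, completion\<close>

text \<open>
  All spaces come with a basis; \<open>'b \<Rightarrow>\<^sub>0 bit\<close> is the span of the basis elements. Over \<open>\<F>\<close> a
  linear subspace is a subgroup. A linear topology is given by its open linear subspaces. We require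
  the open subspaces spanned by basis elements to be a neighbourhood basis of \<open>0\<close>, and
  \<open>0\<close> to be closed; the completion below relies on this.
\<close>

definition lspan :: "'b set \<Rightarrow> ('b \<Rightarrow>\<^sub>0 bit) set" where
  "lspan B = {v. Poly_Mapping.keys v \<subseteq> B}"

definition lin_subspace :: "'b set \<Rightarrow> ('b \<Rightarrow>\<^sub>0 bit) set \<Rightarrow> bool" where
  "lin_subspace B E \<longleftrightarrow> E \<subseteq> lspan B \<and> 0 \<in> E \<and> (\<forall>u\<in>E. \<forall>v\<in>E. u + v \<in> E)"

record 'b lintop =
  Basis :: "'b set"
  Open :: "('b \<Rightarrow>\<^sub>0 bit) set set"

definition linear_topological :: "'b lintop \<Rightarrow> bool" where
  "linear_topological S \<longleftrightarrow>
     lspan (Basis S) \<in> Open S \<and>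
     (\<forall>E\<in>Open S. lin_subspace (Basis S) E) \<and>
     (\<forall>D\<in>Open S. \<forall>E\<in>Open S. D \<inter> E \<in> Open S) \<and>
     (\<forall>D\<in>Open S. \<forall>E. lin_subspace (Basis S) E \<and> D \<subseteq> E \<longrightarrow> E \<in> Open S) \<and>
     (\<forall>E\<in>Open S. \<exists>C. lspan C \<in> Open S \<and> lspan C \<subseteq> E) \<and>
     \<Inter> (Open S) = {0}"

definition linear_topology :: "'b set \<Rightarrow> ('b \<Rightarrow>\<^sub>0 bit) set set \<Rightarrow> 'b lintop" where
  "linear_topology B N =
     \<lparr>Basis = B, Open = {E. lin_subspace B E \<and> (\<exists>D\<in>N. D \<subseteq> E)}\<rparr>"

definition cofinite_space :: "'b set \<Rightarrow> 'b lintop" where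
  "cofinite_space B = linear_topology B {lspan (B - F) |F. finite F}"

definition push :: "('a \<Rightarrow> 'b) \<Rightarrow> ('a \<Rightarrow>\<^sub>0 bit) \<Rightarrow> ('b \<Rightarrow>\<^sub>0 bit)" where
  "push g v = (\<Sum>a\<in>Poly_Mapping.keys v. Poly_Mapping.single (g a) (Poly_Mapping.lookup v a))"

definition relabel :: "('a \<Rightarrow> 'b) \<Rightarrow> 'a lintop \<Rightarrow> 'b lintop" where
  "relabel g S = \<lparr>Basis = g ` Basis S, Open = (\<lambda>E. push g ` E) ` Open S\<rparr>"

text \<open>
  Tensor products are over the idempotent ring: \<open>r\<close> gives the right idempotents of the
  basis elements of the first factor and \<open>l\<close> the left idempotents of those of the second one.
\<close>

definition tensor ::
  "('a \<Rightarrow> idem) \<Rightarrow> ('b \<Rightarrow> idem) \<Rightarrow> ('a \<Rightarrow>\<^sub>0 bit) \<Rightarrow> ('b \<Rightarrow>\<^sub>0 bit) \<Rightarrow> ('a \<times> 'b \<Rightarrow>\<^sub>0 bit)" where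
  "tensor r l u v =
     (\<Sum>a\<in>Poly_Mapping.keys u. \<Sum>b\<in>Poly_Mapping.keys v.
        if r a = l b
        then Poly_Mapping.single (a, b) (Poly_Mapping.lookup u a * Poly_Mapping.lookup v b)
        else 0)"

definition chiral ::
  "('a \<Rightarrow> idem) \<Rightarrow> ('b \<Rightarrow> idem) \<Rightarrow> 'a lintop \<Rightarrow> 'b lintop \<Rightarrow> ('a \<times> 'b) lintop" where
  "chiral r l X Y =
     (let B = {(a, b). a \<in> Basis X \<and> b \<in> Basis Y \<and> r a = l b} in
      \<lparr>Basis = B,
       Open = {E. lin_subspace B E \<and>
         (\<exists>X'\<in>Open X. \<forall>u\<in>X'. \<forall>v\<in>lspan (Basis Y). tensor r l u v \<in> E) \<and>
         (\<forall>u\<in>lspan (Basis X). \<exists>Y'\<in>Open Y. \<forall>v\<in>Y'. tensor r l u v \<in> E)}\<rparr>)"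

text \<open>
  An element of the completion is a formal sum \<open>\<xi> :: 'b \<Rightarrow> bit\<close> of basis elements, which modulo
  every open subspace agrees with an element of the span. For the cofinite topology these are all
  functions supported on the basis, i.e. the completion is the direct product.
  \<open>closure_in S E\<close> is the closure of an open subspace \<open>E\<close> in the completion.
\<close>

definition agree_mod :: "('b \<Rightarrow>\<^sub>0 bit) set \<Rightarrow> ('b \<Rightarrow> bit) \<Rightarrow> ('b \<Rightarrow>\<^sub>0 bit) \<Rightarrow> bool" where
  "agree_mod E \<xi> v \<longleftrightarrow>
     (\<forall>b. \<xi> b \<noteq> Poly_Mapping.lookup v b \<longrightarrow> Poly_Mapping.single b 1 \<in> E)"

definition completion :: "'b lintop \<Rightarrow> ('b \<Rightarrow> bit) set" where
  "completion S = {\<xi>. \<forall>E\<in>Open S. \<exists>v\<in>lspan (Basis S). agree_mod E \<xi> v}"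

definition closure_in :: "'b lintop \<Rightarrow> ('b \<Rightarrow>\<^sub>0 bit) set \<Rightarrow> ('b \<Rightarrow> bit) set" where
  "closure_in S E = {\<xi> \<in> completion S. \<exists>v\<in>E. agree_mod E \<xi> v}"

text \<open>
  A continuous linear map between completions is determined by its values on basis elements.
  \<open>continuous_map S S' f\<close> says that the linear map with values \<open>f b\<close> in the completion of \<open>S'\<close> is
  continuous on the span of the basis of \<open>S\<close>, so extends to the completion of \<open>S\<close>.
\<close>

definition lin_ext :: "('a \<Rightarrow> 'b \<Rightarrow> bit) \<Rightarrow> ('a \<Rightarrow>\<^sub>0 bit) \<Rightarrow> 'b \<Rightarrow> bit" where
  "lin_ext f v = (\<lambda>c. \<Sum>a\<in>Poly_Mapping.keys v. Poly_Mapping.lookup v a * f a c)"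

definition continuous_map :: "'a lintop \<Rightarrow> 'b lintop \<Rightarrow> ('a \<Rightarrow> 'b \<Rightarrow> bit) \<Rightarrow> bool" where
  "continuous_map S S' f \<longleftrightarrow>
     (\<forall>a\<in>Basis S. f a \<in> completion S') \<and>
     (\<forall>E\<in>Open S'. \<exists>D\<in>Open S. \<forall>v\<in>D. lin_ext f v \<in> closure_in S' E)"


section \<open>The chiral topology on the surgery algebra\<close>

text \<open>
  Right multiplication gives \<open>\<sigma> W\<^sup>i Z\<^sup>j = U\<^sup>i T\<^sup>j\<^sup>-\<^sup>i \<sigma>\<close> and \<open>\<tau> W\<^sup>i Z\<^sup>j = U\<^sup>j T\<^sup>j\<^sup>-\<^sup>i \<tau>\<close>. Since
  $Z$ acts invertibly on the $\sigma$ part and $W$ on the $\tau$ part, every monomial of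
  $\mathbf{I}_1 \mathcal{K} \mathbf{I}_0$ is uniquely \<open>\<sigma> W\<^sup>i Z\<^sup>j\<close> with \<open>i \<ge> 0\<close> and \<open>j \<in> \<int>\<close>, or
  \<open>\<tau> W\<^sup>i Z\<^sup>j\<close> with \<open>i \<in> \<int>\<close> and \<open>j \<ge> 0\<close>. The pair \<open>(i, j)\<close> is \<open>wz_exponents\<close>, and
  $\mathbf{I}_1 J_n \mathbf{I}_0 = (\mathbf{I}_1 \mathcal{K} \mathbf{I}_0) \cdot (W^n, Z^n)$ is read as
  the span of the monomials with \<open>i \<ge> n\<close> or \<open>j \<ge> n\<close>. Equivalently, \<open>chiral_ideal n\<close> is the right ideal generated by $W^n$, $Z^n$,
  $\sigma W^n$, $\sigma Z^n$, $\tau W^n$, $\tau Z^n$ and all $U^n T^k$. (Multiplying $W^n$ and $Z^n$ by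
  all of $\mathbf{I}_1 \mathcal{K} \mathbf{I}_0$ would instead give the whole of
  $\mathbf{I}_1 \mathcal{K} \mathbf{I}_0$, because $\sigma = T^{-n} \sigma Z^n$; the completion would then
  lose $\sigma$ and $\tau$, and $\delta^1_2$ of the Hopf link bimodule would not be continuous.)
\<close>

fun wz_exponents :: "kmon \<Rightarrow> int \<times> int" where
  "wz_exponents (WZ a b) = (int a, int b)"
| "wz_exponents (UTsigma a k) = (int a, int a + k)"
| "wz_exponents (UTtau a k) = (int a - k, int a)"
| "wz_exponents (UT a k) = (int a, int a)"

definition chiral_ideal :: "nat \<Rightarrow> kalg set" where
  "chiral_ideal n =
     lspan {m. fst (wz_exponents m) \<ge> int n \<or> snd (wz_exponents m) \<ge> int n}"

definition K_space :: "kmon lintop" where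
  "K_space = linear_topology UNIV (range chiral_ideal)"


section \<open>Type-\<open>DA\<close> bimodules over the surgery algebra\<close>

text \<open>
  \<open>('x, 'y) multimap\<close>: \<open>f [a\<^sub>j, \<dots>, a\<^sub>1] x (y, b)\<close> is the coefficient of \<open>y \<otimes> b\<close> in
  \<open>f\<^sub>j\<^sub>+\<^sub>1(a\<^sub>j, \<dots>, a\<^sub>1, x)\<close>, for algebra monomials \<open>a\<^sub>i\<close> and \<open>b\<close> and basis elements \<open>x\<close> and \<open>y\<close>;
  the last entry of the list is adjacent to \<open>x\<close>.
\<close>

type_synonym ('x, 'y) multimap = "kmon list \<Rightarrow> 'x \<Rightarrow> 'y \<times> kmon \<Rightarrow> bit"

record 'x DA =
  da_space :: "'x lintop"
  lid :: "'x \<Rightarrow> idem"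
  rid :: "'x \<Rightarrow> idem"
  delta :: "('x, 'x) multimap"

fun word_lid :: "('x \<Rightarrow> idem) \<Rightarrow> kmon list \<times> 'x \<Rightarrow> idem" where
  "word_lid l ([], x) = l x"
| "word_lid l (a # as, x) = klid a"

text \<open>\<open>in_space X n\<close> is the chiral tensor product of \<open>n\<close> copies of the surgery algebra with \<open>X\<close>.\<close>

primrec in_space :: "'x DA \<Rightarrow> nat \<Rightarrow> (kmon list \<times> 'x) lintop" where
  "in_space X 0 = relabel (Pair []) (da_space X)"
| "in_space X (Suc n) =
     relabel (\<lambda>(a, as, x). (a # as, x)) (chiral krid (word_lid (lid X)) K_space (in_space X n))"

definition out_space :: "'x DA \<Rightarrow> ('x \<times> kmon) lintop" where
  "out_space X = chiral (rid X) klid (da_space X) K_space"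

definition DA_multimap :: "'x DA \<Rightarrow> 'y DA \<Rightarrow> ('x, 'y) multimap \<Rightarrow> bool" where
  "DA_multimap X Y f \<longleftrightarrow>
     (\<forall>n. continuous_map (in_space X n) (out_space Y) (\<lambda>(as, x). f as x)) \<and>
     (\<forall>as x y b. f as x (y, b) \<noteq> 0 \<longrightarrow>
        (as, x) \<in> Basis (in_space X (length as)) \<and> (y, b) \<in> Basis (out_space Y) \<and>
        lid Y y = word_lid (lid X) (as, x) \<and> krid b = rid X x)"

text \<open>
  \<open>da_comp g f\<close> applies \<open>f\<close> to the inputs next to \<open>x\<close> and \<open>g\<close> to the remaining ones, and multiplies
  the outputs. The sum \<open>Sum_any\<close> is over the nonzero summands, which are finitely many for
  continuous \<open>f\<close> and \<open>g\<close>.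
\<close>

definition da_comp :: "('y, 'z) multimap \<Rightarrow> ('x, 'y) multimap \<Rightarrow> ('x, 'z) multimap" where
  "da_comp g f as x = (\<lambda>(z, c). \<Sum>i\<le>length as.
     Sum_any (\<lambda>(y, b, d).
       f (drop i as) x (y, b) * g (take i as) y (z, d) * of_bool (kmul d b = Some c)))"

definition mult_inputs :: "('x, 'y) multimap \<Rightarrow> ('x, 'y) multimap" where
  "mult_inputs f as x = (\<lambda>t. \<Sum>i<length as - 1.
     case kmul (as ! i) (as ! Suc i) of
       None \<Rightarrow> 0
     | Some c \<Rightarrow> f (take i as @ c # drop (i + 2) as) x t)"

text \<open>As usual for type-\<open>DA\<close> bimodules, everything is strictly unital.\<close>

definition type_DA :: "'x DA \<Rightarrow> bool" where
  "type_DA X \<longleftrightarrow>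
     linear_topological (da_space X) \<and>
     DA_multimap X X (delta X) \<and>
     (\<forall>as x t. da_comp (delta X) (delta X) as x t + mult_inputs (delta X) as x t = 0) \<and>
     (\<forall>x\<in>Basis (da_space X). \<forall>t.
        delta X [kone (lid X x)] x t = of_bool (t = (x, kone (rid X x)))) \<and>
     (\<forall>as x t. length as \<ge> 2 \<and> (\<exists>e. kone e \<in> set as) \<longrightarrow> delta X as x t = 0)"

definition DA_morphism :: "'x DA \<Rightarrow> 'y DA \<Rightarrow> ('x, 'y) multimap \<Rightarrow> bool" where
  "DA_morphism X Y f \<longleftrightarrow>
     DA_multimap X Y f \<and>
     (\<forall>as x t. (\<exists>e. kone e \<in> set as) \<longrightarrow> f as x t = 0)"

definition DA_diff :: "'x DA \<Rightarrow> 'y DA \<Rightarrow> ('x, 'y) multimap \<Rightarrow> ('x, 'y) multimap" where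
  "DA_diff X Y f as x =
     (\<lambda>t. da_comp (delta Y) f as x t + da_comp f (delta X) as x t + mult_inputs f as x t)"

definition DA_id :: "'x DA \<Rightarrow> ('x, 'x) multimap" where
  "DA_id X as x = (\<lambda>t. of_bool (as = [] \<and> x \<in> Basis (da_space X) \<and> t = (x, kone (rid X x))))"

definition DA_homomorphism :: "'x DA \<Rightarrow> 'y DA \<Rightarrow> ('x, 'y) multimap \<Rightarrow> bool" where
  "DA_homomorphism X Y f \<longleftrightarrow>
     DA_morphism X Y f \<and> (\<forall>as x t. DA_diff X Y f as x t = 0)"

definition DA_homotopic ::
  "'x DA \<Rightarrow> 'y DA \<Rightarrow> ('x, 'y) multimap \<Rightarrow> ('x, 'y) multimap \<Rightarrow> bool" where
  "DA_homotopic X Y f g \<longleftrightarrow>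
     (\<exists>h. DA_morphism X Y h \<and> (\<forall>as x t. f as x t + g as x t = DA_diff X Y h as x t))"

definition DA_homotopy_equivalent :: "'x DA \<Rightarrow> 'y DA \<Rightarrow> bool" where
  "DA_homotopy_equivalent X Y \<longleftrightarrow>
     type_DA X \<and> type_DA Y \<and>
     (\<exists>f g. DA_homomorphism X Y f \<and> DA_homomorphism Y X g \<and>
        DA_homotopic X X (da_comp g f) (DA_id X) \<and>
        DA_homotopic Y Y (da_comp f g) (DA_id Y))"


section \<open>Box tensor products and bimodules of algebra maps\<close>

text \<open>
  \<open>delta_iter X [b\<^sub>k, \<dots>, b\<^sub>1] as x x'\<close> is the coefficient of \<open>x' \<otimes> b\<^sub>k \<otimes> \<dots> \<otimes> b\<^sub>1\<close> in the \<open>k\<close>-fold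
  iterate of the structure map of \<open>X\<close>, summed over all distributions of the inputs \<open>as\<close>.
\<close>

primrec delta_iter :: "'x DA \<Rightarrow> kmon list \<Rightarrow> kmon list \<Rightarrow> 'x \<Rightarrow> 'x \<Rightarrow> bit" where
  "delta_iter X [] as x x' = of_bool (as = [] \<and> x' = x)"
| "delta_iter X (b # bs) as x x' = (\<Sum>i\<le>length as.
     Sum_any (\<lambda>y. delta_iter X bs (drop i as) x y * delta X (take i as) y (x', b)))"

text \<open>
  The sum over \<open>bs\<close> below runs over words of all lengths; it is finite if the
  \<open>\<delta>\<close> maps of \<open>Y\<close> vanish for long inputs, as for all bimodules considered here.
\<close>

definition box :: "'x DA \<Rightarrow> 'y DA \<Rightarrow> ('x \<times> 'y) DA" (infixr "\<boxtimes>" 70) where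
  "X \<boxtimes> Y =
     (let S = chiral (rid X) (lid Y) (da_space X) (da_space Y) in
      \<lparr>da_space = S,
       lid = (\<lambda>(x, y). lid X x),
       rid = (\<lambda>(x, y). rid Y y),
       delta = (\<lambda>as (x, y) ((x', y'), c).
         if (x, y) \<in> Basis S
         then Sum_any (\<lambda>bs. delta_iter X bs as x x' * delta Y bs y (y', c))
         else 0)\<rparr>)"

text \<open>The bimodule \<open>[\<phi>]\<close>; the basis of the underlying space is \<open>{1\<^sub>0, 1\<^sub>1}\<close>, represented by \<open>idem\<close>.\<close>

definition alg_bimodule :: "(kalg \<Rightarrow> kalg) \<Rightarrow> idem DA" where
  "alg_bimodule \<phi> =
     \<lparr>da_space = cofinite_space UNIV,
      lid = (\<lambda>e. e),
      rid = (\<lambda>e. e),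
      delta = (\<lambda>as e (e', c).
        case as of
          [a] \<Rightarrow> if krid a = e \<and> klid a = e'
                 then Poly_Mapping.lookup (\<phi> (Poly_Mapping.single a 1)) c else 0
        | _ \<Rightarrow> 0)\<rparr>"

fun E_mon :: "kmon \<Rightarrow> kmon" where
  "E_mon (WZ a b) = WZ b a"
| "E_mon (UT a k) = UT a (- k)"
| "E_mon (UTsigma a k) = UTtau a (- k)"
| "E_mon (UTtau a k) = UTsigma a (- k)"

definition E_alg :: "kalg \<Rightarrow> kalg" where
  "E_alg = push E_mon"

lemma E_mon_kmul: "kmul (E_mon a) (E_mon b) = map_option E_mon (kmul a b)"
  by (cases a; cases b) simp_all


section \<open>The Hopf link bimodules\<close>

text \<open>
  \<open>W00 i\<close> is $W^i_{00}$, etc. As $Z^0_{01} = W^0_{01}$, the constructor value \<open>Z01 0\<close> is not a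
  generator; \<open>z01 i\<close> is $Z^i_{01}$ for all \<open>i\<close>.
\<close>

datatype hgen = W00 nat | Z00 nat | W01 nat | Z01 nat | T10 int | T11 int

definition hgens :: "hgen set" where
  "hgens = UNIV - {Z01 0}"

definition z01 :: "nat \<Rightarrow> hgen" where
  "z01 i = (if i = 0 then W01 0 else Z01 i)"

fun hlid :: "hgen \<Rightarrow> idem" where
  "hlid (W00 i) = I0"
| "hlid (Z00 i) = I0"
| "hlid (W01 i) = I0"
| "hlid (Z01 i) = I0"
| "hlid (T10 i) = I1"
| "hlid (T11 i) = I1"

fun hrid :: "hgen \<Rightarrow> idem" where
  "hrid (W00 i) = I0"
| "hrid (Z00 i) = I0"
| "hrid (W01 i) = I1"
| "hrid (Z01 i) = I1"
| "hrid (T10 i) = I0"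
| "hrid (T11 i) = I1"

text \<open>The set of terms of the sum $\delta^1_1(x)$.\<close>

fun h_delta1 :: "hgen \<Rightarrow> (hgen \<times> kmon) set" where
  "h_delta1 (W00 i) = {(W01 i, UTsigma 0 1), (W01 (i + 1), UTtau 0 1)}"
| "h_delta1 (Z00 i) = {(z01 (i + 1), UTsigma 0 0), (z01 i, UTtau 0 0)}"
| "h_delta1 (T10 i) = {(T11 i, UTsigma 0 0), (T11 (i - 1), UTtau 0 0)}"
| "h_delta1 _ = {}"

datatype kgen = gW | gZ | gsigma | gtau | gU | gT | gTinv

text \<open>
  $\delta^1_2(g, x)$ for a generator \<open>g\<close> of the algebra, \<open>None\<close> if it vanishes. In idempotent \<open>0\<close>
  we have $U = W Z$. The generator $1_{01}$ is \<open>W01 0\<close>, so \<open>Z01 i\<close> stands for \<open>i > 0\<close>.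
\<close>

fun h_act :: "kgen \<Rightarrow> hgen \<Rightarrow> (hgen \<times> kmon) option" where
  "h_act gW (W00 i) = Some (W00 (i + 1), WZ 0 0)"
| "h_act gZ (W00 i) = (if i > 0 then Some (W00 (i - 1), WZ 1 1) else Some (Z00 0, WZ 0 1))"
| "h_act gZ (Z00 i) = Some (Z00 (i + 1), WZ 0 0)"
| "h_act gW (Z00 i) = (if i > 0 then Some (Z00 (i - 1), WZ 1 1) else Some (W00 0, WZ 1 0))"
| "h_act gsigma (W00 i) = Some (T10 (- int i), WZ i (i + 1))"
| "h_act gtau (W00 i) = Some (T10 (- int i), WZ 0 0)"
| "h_act gsigma (Z00 i) = Some (T10 (int i + 1), WZ 0 0)"
| "h_act gtau (Z00 i) = Some (T10 (int i + 1), WZ (i + 1) i)"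
| "h_act gW (W01 i) = Some (W01 (i + 1), UT 0 0)"
| "h_act gZ (W01 i) = (if i > 0 then Some (W01 (i - 1), UT 1 0) else Some (z01 1, UT 0 0))"
| "h_act gZ (Z01 i) = Some (z01 (i + 1), UT 0 0)"
| "h_act gW (Z01 i) = Some (z01 (i - 1), UT 1 0)"
| "h_act gsigma (W01 i) = Some (T11 (- int i), UT i 0)"
| "h_act gsigma (Z01 i) = Some (T11 (int i), UT 0 0)"
| "h_act gtau (W01 i) = Some (T11 (- int i), UT 0 (- 1))"
| "h_act gtau (Z01 i) = Some (T11 (int i), UT i (- 1))"
| "h_act gT (T10 i) = Some (T10 (i + 1), WZ 0 0)"
| "h_act gTinv (T10 i) = Some (T10 (i - 1), WZ 0 0)"
| "h_act gU (T10 i) = Some (T10 i, WZ 1 1)"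
| "h_act gT (T11 i) = Some (T11 (i + 1), UT 0 0)"
| "h_act gTinv (T11 i) = Some (T11 (i - 1), UT 0 0)"
| "h_act gU (T11 i) = Some (T11 i, UT 1 0)"
| "h_act _ _ = None"

definition ut_word :: "nat \<Rightarrow> int \<Rightarrow> kgen list" where
  "ut_word a k =
     replicate a gU @ (if k \<ge> 0 then replicate (nat k) gT else replicate (nat (- k)) gTinv)"

fun gen_word :: "kmon \<Rightarrow> kgen list" where
  "gen_word (WZ a b) = replicate a gW @ replicate b gZ"
| "gen_word (UT a k) = ut_word a k"
| "gen_word (UTsigma a k) = ut_word a k @ [gsigma]"
| "gen_word (UTtau a k) = ut_word a k @ [gtau]"

text \<open>
  The multiplicative extension
  $\delta^1_2(a b, x) = (\mathrm{id} \otimes \mu) (\delta^1_2(a, -) \otimes \mathrm{id}) \delta^1_2(b, x)$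
  of \<open>h_act\<close> to all monomials.
\<close>

definition h_step :: "kgen \<Rightarrow> hgen \<times> kmon \<Rightarrow> (hgen \<times> kmon) option" where
  "h_step g = (\<lambda>(y, b).
     Option.bind (h_act g y) (\<lambda>(z, d). map_option (Pair z) (kmul d b)))"

definition h_delta2 :: "kmon \<Rightarrow> hgen \<Rightarrow> (hgen \<times> kmon) option" where
  "h_delta2 a x =
     (if krid a = hlid x
      then foldr (\<lambda>g s. Option.bind s (h_step g)) (gen_word a) (Some (x, kone (hrid x)))
      else None)"

definition H_minus :: "hgen DA" where
  "H_minus =
     \<lparr>da_space = cofinite_space hgens,
      lid = hlid,
      rid = hrid,
      delta = (\<lambda>as x t.
        if x \<in> hgens then
          (case as of
             [] \<Rightarrow> of_bool (t \<in> h_delta1 x)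
           | [a] \<Rightarrow> of_bool (h_delta2 a x = Some t)
           | _ \<Rightarrow> 0)
        else 0)\<rparr>"

definition H_plus :: "(hgen \<times> idem) DA" where
  "H_plus = H_minus \<boxtimes> alg_bimodule E_alg"


section \<open>The bimodules of the mapping cylinders\<close>

text \<open>
  The link surgery bimodules of the mapping cylinders of the identity and of the elliptic
  involution of the torus, in the form provided by the pairing theorem.
\<close>

definition X_Cyl_id :: "(hgen \<times> hgen \<times> idem) DA" where
  "X_Cyl_id = H_minus \<boxtimes> H_plus"

definition X_Cyl_E :: "(hgen \<times> hgen) DA" where
  "X_Cyl_E = H_minus \<boxtimes> H_minus"

end

theory Submission
  imports Defs "HOL-Library.Function_Algebras"
begin

text \<open>
  Since $\<delta>^1_j = 0$ for $j \<ge> 3$, a bimodule here is a completed differential right module with a commuting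
  left action, and its structure maps are column-finite matrices in the chiral sense (\<open>cont_op\<close>).
  The differential of $\mathcal{H}_- \boxtimes \mathcal{H}_-$ is \<open>d1X + d2X\<close>, where \<open>d1X\<close> raises the middle
  idempotent. The complex of \<open>d1X\<close> is a sum of two-sided infinite zigzags in which every edge has a unit
  coefficient. Orienting each zigzag along units gives a matching with exactly two critical cells, the
  generators of the idempotent bimodule. Its gradient paths are infinite, but the sums over them converge
  because their coefficients tend to $0$ in the chiral topology or the generators do in the cofinite one;
  one critical cell includes as the infinite sum $\sum_s T^s_{10} \otimes 1_{01} \otimes T^s$.
  Homological perturbation accounts for \<open>d2X\<close> and transfers the left action, which becomes $E$. The
  contraction lowers the middle idempotent and the action preserves it, so $h\, a\, h = 0$ and all
  higher terms of the transfer vanish. The positive Hopf link differs by the twist by $E$ on the right.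
\<close>

section \<open>Continuous operators\<close>

text \<open>An entry of a composite is an infinite sum, and \<open>Sum_any\<close> returns 0 when
  infinitely many terms are nonzero, so even distributivity and associativity rest on continuity.
  The chiral asymmetry makes them hold: J_n is a right ideal, so in a product d b the later
  coefficient d confines the last step of a path to finitely many choices, and b has to be small
  only relative to each of them. The matching is dictated by exponents. With j the position in the
  second factor, an edge has a unit at its left end if j < 0 and at its right end if j >= 0. In the
  row l = r = 0, u = -1 the factor T in \<delta> of the W generators makes j pass from -1 to 0 at s
  = 0, and node 0 is left over. In the row l = r = 1, u = 0 all coefficients are units; it is the
  complex of a line, with a weighted sum of all edges as its cycle. E appears because W moves node 0
  to node 1, which projects with coefficient Z. The action preserves the middle and right
  idempotents, in which the critical cells differ, so \<sigma> and \<tau> pass between them only by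
  one contraction and one \<open>d2X\<close>; each order of the two accounts for one sign of the T
  exponent.\<close>

type_synonym ('x, 'y) op = "'x \<Rightarrow> 'y \<times> kmon \<Rightarrow> bit"

text \<open>The monomial basis of J_n. Continuity is tested below on single monomials, which is
  enough because J_n is spanned by monomials.\<close>

definition kideal :: "nat \<Rightarrow> kmon set" where
  "kideal n = {m. fst (wz_exponents m) \<ge> int n \<or> snd (wz_exponents m) \<ge> int n}"

lemma chiral_ideal_eq: "chiral_ideal n = lspan (kideal n)"
  by (simp add: chiral_ideal_def kideal_def)

lemma kideal_mult_right: "kmul d b = Some c \<Longrightarrow> d \<in> kideal n \<Longrightarrow> c \<in> kideal n"
  by (cases d; cases b) (auto simp: kideal_def)

text \<open>Left multiplication by T^k shifts one exponent of a \<sigma> or \<tau> monomial by |k|,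
  so J_n is no left ideal and \<open>m\<close> has to depend on \<open>d\<close>. What survives is
  the continuity of left multiplication by each single \<open>d\<close>.\<close>

lemma kideal_mult_left: "\<exists>m. \<forall>b\<in>kideal m. \<forall>c. kmul d b = Some c \<longrightarrow> c \<in> kideal n"
proof (cases d)
  case (WZ a b)
  then show ?thesis
    by (intro exI[of _ n] ballI allI, rename_tac b' c, case_tac b') (auto simp: kideal_def)
next
  case (UT a k)
  then show ?thesis
    by (intro exI[of _ "n + nat \<bar>k\<bar>"] ballI allI, rename_tac b' c, case_tac b')
       (auto simp: kideal_def)
next
  case (UTsigma a k)
  then show ?thesis
    by (intro exI[of _ "n + nat \<bar>k\<bar>"] ballI allI, rename_tac b' c, case_tac b')
       (auto simp: kideal_def)
next
  case (UTtau a k)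
  then show ?thesis
    by (intro exI[of _ "n + nat \<bar>k\<bar>"] ballI allI, rename_tac b' c, case_tac b')
       (auto simp: kideal_def)
qed

lemma kideal_antimono: "n \<le> m \<Longrightarrow> kideal m \<subseteq> kideal n"
  by (auto simp: kideal_def)

lemma ex_notin_kideal: "\<exists>n. c \<notin> kideal n"
  by (rule exI[of _ "nat (1 + \<bar>fst (wz_exponents c)\<bar> + \<bar>snd (wz_exponents c)\<bar>)"])
     (auto simp: kideal_def)

lemma kmul_Some_idem: "kmul a b = Some c \<Longrightarrow> klid c = klid a \<and> krid c = krid b \<and> krid a = klid b"
  by (cases a; cases b) auto

lemma klid_kone [simp]: "klid (kone e) = e" and krid_kone [simp]: "krid (kone e) = e"
  by (cases e; simp)+

lemma kmul_kone_left: "kmul (kone e) c = (if klid c = e then Some c else None)"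
  using kmul_kone(1)[of c] by (auto simp: kmul_eq_None_iff)

lemma kmul_kone_right: "kmul c (kone e) = (if krid c = e then Some c else None)"
  using kmul_kone(2)[of c] by (auto simp: kmul_eq_None_iff)

lemma kmul_assoc_Some:
  "kmul d b = Some c \<Longrightarrow> kmul h c = Some e \<Longrightarrow> \<exists>x. kmul h d = Some x \<and> kmul x b = Some e"
  "kmul h d = Some x \<Longrightarrow> kmul x b = Some e \<Longrightarrow> \<exists>c. kmul d b = Some c \<and> kmul h c = Some e"
  using kmul_assoc[of h d b] by (auto split: bind_splits)

lemma bit_add_self [simp]: "(a::bit) + a = 0"
  by (cases a) simp_all

lemma op_add_self [simp]: "(F :: ('x, 'y) op) + F = 0"
  by (simp add: fun_eq_iff)

lemma op_add_self_left [simp]: "(F :: ('x, 'y) op) + (F + G) = G"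
  by (simp add: fun_eq_iff flip: add.assoc)

lemma op_add_eq_0_iff: "(F :: ('x, 'y) op) + G = 0 \<longleftrightarrow> F = G"
  by (metis add.right_neutral op_add_self op_add_self_left)

lemma op_eqI: "(\<And>x y b. F x (y, b) \<noteq> 0 \<longleftrightarrow> G x (y, b) \<noteq> 0) \<Longrightarrow> F = (G :: ('x, 'y) op)"
proof (rule ext, rule ext, clarify)
  fix x y b assume "\<And>x y b. F x (y, b) \<noteq> 0 \<longleftrightarrow> G x (y, b) \<noteq> 0"
  from this[of x y b] show "F x (y, b) = G x (y, b)"
    by (cases "F x (y, b)"; cases "G x (y, b)") auto
qed

section \<open>Composition of continuous operators and its algebraic laws\<close>

definition cmp :: "('y, 'z) op \<Rightarrow> ('x, 'y) op \<Rightarrow> ('x, 'z) op" (infixr "\<odot>" 75) where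
  "(G \<odot> F) x = (\<lambda>(z, c). Sum_any (\<lambda>(y, b, d).
     F x (y, b) * G y (z, d) * of_bool (kmul d b = Some c)))"

text \<open>Continuity from a cofinite space into the completed chiral product with the algebra. A
  neighbourhood there is controlled by finitely many targets and one \<open>n\<close>, so at each
  target the coefficients must tend to 0 as the source leaves finite sets. One source may have
  infinitely many targets: infinite sums of generators are allowed.\<close>

definition cont_op :: "('x, 'y) op \<Rightarrow> bool" where
  "cont_op F \<longleftrightarrow> (\<forall>y n. finite {(x, b). F x (y, b) \<noteq> 0 \<and> b \<notin> kideal n})"

lemma cont_opD: "cont_op F \<Longrightarrow> finite {(x, b). F x (y, b) \<noteq> 0 \<and> b \<notin> kideal n}"
  by (simp add: cont_op_def)

text \<open>Read the path from its end. As J_n is a right ideal, \<open>d\<close> lies outside J_n,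
  which leaves finitely many \<open>(y, d)\<close>; each such \<open>d\<close> has its own
  \<open>m\<close>, and \<open>b\<close> lies outside J_m, which leaves finitely many
  \<open>(x, b)\<close>.\<close>

lemma finite_paths2:
  assumes F: "cont_op F" and G: "cont_op G"
  shows "finite {(x, y, b, d). F x (y, b) \<noteq> 0 \<and> G y (z, d) \<noteq> 0 \<and>
           (\<exists>c. kmul d b = Some c \<and> c \<notin> kideal n)}"
proof -
  define P where "P = {(y, d). G y (z, d) \<noteq> 0 \<and> d \<notin> kideal n}"
  have P: "finite P" using cont_opD[OF G] by (simp add: P_def)
  have "\<forall>d. \<exists>m. \<forall>b\<in>kideal m. \<forall>c. kmul d b = Some c \<longrightarrow> c \<in> kideal n"
    using kideal_mult_left by blast
  then obtain m where m: "\<And>d b c. b \<in> kideal (m d) \<Longrightarrow> kmul d b = Some c \<Longrightarrow> c \<in> kideal n"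
    by metis
  define Q where "Q = (\<lambda>(y, d). {(x, b). F x (y, b) \<noteq> 0 \<and> b \<notin> kideal (m d)})"
  have Q: "finite (Q p)" for p using cont_opD[OF F] by (cases p) (simp add: Q_def)
  have "finite ((\<lambda>((y, d), (x, b)). (x, y, b, d)) ` Sigma P Q)"
    using P Q by (intro finite_imageI finite_SigmaI)
  moreover have "{(x, y, b, d). F x (y, b) \<noteq> 0 \<and> G y (z, d) \<noteq> 0 \<and>
           (\<exists>c. kmul d b = Some c \<and> c \<notin> kideal n)} \<subseteq> (\<lambda>((y, d), (x, b)). (x, y, b, d)) ` Sigma P Q"
    using m kideal_mult_right by (fastforce simp: P_def Q_def image_iff)
  ultimately show ?thesis by (rule rev_finite_subset)
qed

lemma finite_paths2_fixed:
  assumes F: "cont_op F" and G: "cont_op G"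
  shows "finite {(y, b, d). F x (y, b) * G y (z, d) * of_bool (kmul d b = Some c) \<noteq> 0}"
proof -
  obtain n where n: "c \<notin> kideal n" using ex_notin_kideal by blast
  show ?thesis
    by (rule finite_subset[OF _ finite_imageI[OF finite_paths2[OF F G, of z n], of snd]])
       (use n in \<open>force simp: image_iff split: if_splits\<close>)
qed

text \<open>The backward argument once more, with the two earlier steps controlled by
  \<open>finite_paths2\<close>. The set is the common index set of the two bracketings of a triple
  composite.\<close>

lemma finite_paths3:
  assumes F: "cont_op F" and G: "cont_op G" and H: "cont_op H"
  shows "finite {(y, b, z, d, h). F x (y, b) \<noteq> 0 \<and> G y (z, d) \<noteq> 0 \<and> H z (w, h) \<noteq> 0 \<and>
           (\<exists>c. kmul d b = Some c \<and> kmul h c = Some e)}"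
proof -
  obtain n where n: "e \<notin> kideal n" using ex_notin_kideal by blast
  define P where "P = {(z, h). H z (w, h) \<noteq> 0 \<and> h \<notin> kideal n}"
  have P: "finite P" using cont_opD[OF H] by (simp add: P_def)
  have "\<forall>d. \<exists>m. \<forall>b\<in>kideal m. \<forall>c. kmul d b = Some c \<longrightarrow> c \<in> kideal n"
    using kideal_mult_left by blast
  then obtain m where m: "\<And>d b c. b \<in> kideal (m d) \<Longrightarrow> kmul d b = Some c \<Longrightarrow> c \<in> kideal n"
    by metis
  define Q where "Q = (\<lambda>(z, h). {(x, y, b, d). F x (y, b) \<noteq> 0 \<and> G y (z, d) \<noteq> 0 \<and>
           (\<exists>c. kmul d b = Some c \<and> c \<notin> kideal (m h))})"
  have Q: "finite (Q p)" for p using finite_paths2[OF F G] by (cases p) (simp add: Q_def)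
  have "finite ((\<lambda>((z, h), (x, y, b, d)). (y, b, z, d, h)) ` Sigma P Q)"
    using P Q by (intro finite_imageI finite_SigmaI)
  moreover have "{(y, b, z, d, h). F x (y, b) \<noteq> 0 \<and> G y (z, d) \<noteq> 0 \<and> H z (w, h) \<noteq> 0 \<and>
           (\<exists>c. kmul d b = Some c \<and> kmul h c = Some e)}
     \<subseteq> (\<lambda>((z, h), (x, y, b, d)). (y, b, z, d, h)) ` Sigma P Q"
  proof (clarify, goal_cases)
    case (1 y b z d h c)
    have "((z, h), (x, y, b, d)) \<in> Sigma P Q"
      using 1 n m[of c h e] kideal_mult_right[of h c e n] unfolding P_def Q_def by auto
    then show ?case by (rule image_eqI[rotated]) simp
  qed
  ultimately show ?thesis by (rule rev_finite_subset)
qed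

lemma Sum_any_pairs:
  assumes "finite {(a, b). g a b \<noteq> (0 :: 'c :: comm_monoid_add)}"
  shows "Sum_any (\<lambda>a. Sum_any (g a)) = Sum_any (\<lambda>(a, b). g a b)"
proof -
  have "{a. \<exists>b. g a b \<noteq> 0} = Domain {(a, b). g a b \<noteq> 0}"
       "{b. \<exists>a. g a b \<noteq> 0} = Range {(a, b). g a b \<noteq> 0}"
    by blast+
  then have "finite ({a. \<exists>b. g a b \<noteq> 0} \<times> {b. \<exists>a. g a b \<noteq> 0})"
    using assms by (intro finite_cartesian_product) (simp_all only: finite_Domain finite_Range)
  then show ?thesis
    by (rule Sum_any.cartesian_product) (rule subset_refl)
qed

lemma Sum_any_bij_witness:
  assumes "\<And>a. g a \<noteq> 0 \<Longrightarrow> j (i a) = a \<and> h (i a) = g a"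
    and "\<And>b. h b \<noteq> 0 \<Longrightarrow> i (j b) = b \<and> g (j b) = h b"
  shows "Sum_any g = Sum_any h"
  unfolding Sum_any.expand_set
proof (rule sum.reindex_bij_witness[of _ j i], goal_cases)
  case (1 a)
  then show ?case using assms(1) by simp
next
  case (2 a)
  then show ?case using assms(1)[of a] by simp
next
  case (3 b)
  then show ?case using assms(2) by simp
next
  case (4 b)
  then show ?case using assms(2)[of b] by simp
next
  case (5 a)
  then show ?case using assms(1) by simp
qed

lemma cmp_apply: "(G \<odot> F) x (z, c) = Sum_any (\<lambda>(y, b, d).
     F x (y, b) * G y (z, d) * of_bool (kmul d b = Some c))"
  by (simp add: cmp_def)

lemma cmp_nonzeroE:
  assumes "(G \<odot> F) x (z, c) \<noteq> 0"
  obtains y b d where "F x (y, b) \<noteq> 0" "G y (z, d) \<noteq> 0" "kmul d b = Some c"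
proof -
  from Sum_any.not_neutral_obtains_not_neutral[OF assms[unfolded cmp_apply]]
  obtain t where "(case t of (y, b, d) \<Rightarrow> F x (y, b) * G y (z, d) * of_bool (kmul d b = Some c)) \<noteq> 0" .
  with that show ?thesis by (cases t) (auto split: if_splits)
qed

lemma cont_op_cmp:
  assumes F: "cont_op F" and G: "cont_op G"
  shows "cont_op (G \<odot> F)"
  unfolding cont_op_def
proof (intro allI)
  fix z n
  let ?S = "{(x, y, b, d). F x (y, b) \<noteq> 0 \<and> G y (z, d) \<noteq> 0 \<and>
           (\<exists>c. kmul d b = Some c \<and> c \<notin> kideal n)}"
  have "{(x, c). (G \<odot> F) x (z, c) \<noteq> 0 \<and> c \<notin> kideal n}
      \<subseteq> (\<lambda>(x, y, b, d). (x, the (kmul d b))) ` ?S"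
  proof (clarify, goal_cases)
    case (1 x c)
    then obtain y b d where "F x (y, b) \<noteq> 0" "G y (z, d) \<noteq> 0" "kmul d b = Some c"
      by (auto elim!: cmp_nonzeroE simp del: bit_not_zero_iff)
    with 1 show ?case by (intro image_eqI[of _ _ "(x, y, b, d)"]) auto
  qed
  then show "finite {(x, c). (G \<odot> F) x (z, c) \<noteq> 0 \<and> c \<notin> kideal n}"
    by (rule finite_subset) (rule finite_imageI[OF finite_paths2[OF F G]])
qed

lemma cont_op_add: "cont_op F \<Longrightarrow> cont_op G \<Longrightarrow> cont_op (F + G)"
  unfolding cont_op_def
proof (intro allI, goal_cases)
  case (1 y n)
  have "{(x, b). (F + G) x (y, b) \<noteq> 0 \<and> b \<notin> kideal n} \<subseteq>
     {(x, b). F x (y, b) \<noteq> 0 \<and> b \<notin> kideal n} \<union> {(x, b). G x (y, b) \<noteq> 0 \<and> b \<notin> kideal n}"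
    by auto
  then show ?case by (rule finite_subset) (use 1 in blast)
qed

lemma cont_op_zero [simp]: "cont_op 0"
  by (simp add: cont_op_def)

lemma cmp_zero [simp]: "0 \<odot> F = 0" "G \<odot> 0 = 0"
  by (auto simp: fun_eq_iff cmp_apply)

lemma cmp_eq_zeroI:
  assumes "\<And>x y z b d. F x (y, b) \<noteq> 0 \<Longrightarrow> G y (z, d) \<noteq> 0 \<Longrightarrow> False"
  shows "G \<odot> F = 0"
proof (rule ext, rule ext, rule ccontr)
  fix x t
  assume "(G \<odot> F) x t \<noteq> 0 x t"
  then have "(G \<odot> F) x (fst t, snd t) \<noteq> 0" by simp
  then show False by (rule cmp_nonzeroE) (use assms in blast)
qed

lemma cmp_add_left:
  assumes "cont_op F" "cont_op G" "cont_op G'"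
  shows "(G + G') \<odot> F = G \<odot> F + G' \<odot> F"
proof (rule ext, rule ext, clarify)
  fix x z c
  have "((G + G') \<odot> F) x (z, c) = Sum_any (\<lambda>t.
      (case t of (y, b, d) \<Rightarrow> F x (y, b) * G y (z, d) * of_bool (kmul d b = Some c)) +
      (case t of (y, b, d) \<Rightarrow> F x (y, b) * G' y (z, d) * of_bool (kmul d b = Some c)))"
    unfolding cmp_apply by (rule Sum_any.cong) (auto simp: algebra_simps split: prod.splits)
  also have "\<dots> = (G \<odot> F + G' \<odot> F) x (z, c)"
    using finite_paths2_fixed[OF assms(1,2)] finite_paths2_fixed[OF assms(1,3)]
    by (subst Sum_any.distrib) (simp_all add: cmp_apply case_prod_unfold)
  finally show "((G + G') \<odot> F) x (z, c) = (G \<odot> F + G' \<odot> F) x (z, c)" .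
qed

lemma cmp_add_right:
  assumes "cont_op F" "cont_op F'" "cont_op G"
  shows "G \<odot> (F + F') = G \<odot> F + G \<odot> F'"
proof (rule ext, rule ext, clarify)
  fix x z c
  have "(G \<odot> (F + F')) x (z, c) = Sum_any (\<lambda>t.
      (case t of (y, b, d) \<Rightarrow> F x (y, b) * G y (z, d) * of_bool (kmul d b = Some c)) +
      (case t of (y, b, d) \<Rightarrow> F' x (y, b) * G y (z, d) * of_bool (kmul d b = Some c)))"
    unfolding cmp_apply by (rule Sum_any.cong) (auto simp: algebra_simps split: prod.splits)
  also have "\<dots> = (G \<odot> F + G \<odot> F') x (z, c)"
    using finite_paths2_fixed[OF assms(1,3)] finite_paths2_fixed[OF assms(2,3)]
    by (subst Sum_any.distrib) (simp_all add: cmp_apply case_prod_unfold)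
  finally show "(G \<odot> (F + F')) x (z, c) = (G \<odot> F + G \<odot> F') x (z, c)" .
qed

lemma Sum_any_mult_right:
  fixes g :: "'a \<Rightarrow> bit"
  assumes "finite {a. g a \<noteq> 0}"
  shows "Sum_any g * r = Sum_any (\<lambda>a. g a * r)"
  using Sum_any_left_distrib[OF assms] .

text \<open>Both sides are sums over the triples of steps in \<open>finite_paths3\<close>; they
  differ only in the intermediate product that is recorded.\<close>

lemma cmp_assoc:
  fixes F :: "('x, 'y) op" and G :: "('y, 'z) op" and H :: "('z, 'w) op"
  assumes F: "cont_op F" and G: "cont_op G" and H: "cont_op H"
  shows "(H \<odot> G) \<odot> F = H \<odot> (G \<odot> F)"
proof (rule ext, rule ext, clarify)
  fix x w e
  define L where "L = (\<lambda>(y, b, k) (z, d, h).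
     F x (y, b) * (G y (z, d) * H z (w, h) * of_bool (kmul h d = Some k)) * of_bool (kmul k b = Some e))"
  define R where "R = (\<lambda>(z, c, h) (y, b, d).
     F x (y, b) * G y (z, d) * of_bool (kmul d b = Some c) * H z (w, h) * of_bool (kmul h c = Some e))"
  let ?S = "{(y, b, z, d, h). F x (y, b) \<noteq> 0 \<and> G y (z, d) \<noteq> 0 \<and> H z (w, h) \<noteq> 0 \<and>
           (\<exists>c. kmul d b = Some c \<and> kmul h c = Some e)}"
  have S: "finite ?S" using finite_paths3[OF F G H] .
  have "finite {(p, q). L p q \<noteq> 0}"
    by (rule finite_subset[OF _ finite_imageI[OF S, of "\<lambda>(y, b, z, d, h). ((y, b, the (kmul h d)), (z, d, h))"]])
       (force simp: L_def image_iff split: if_splits dest: kmul_assoc_Some(2))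
  then have finL: "finite {(p, q). L p q \<noteq> 0}" .
  have finR: "finite {(p, q). R p q \<noteq> 0}"
    by (rule finite_subset[OF _ finite_imageI[OF S, of "\<lambda>(y, b, z, d, h). ((z, the (kmul d b), h), (y, b, d))"]])
       (force simp: R_def image_iff split: if_splits)
  have L: "\<exists>c. kmul d b = Some c \<and> kmul h c = Some e \<and> kmul h d = Some k \<and> kmul k b = Some e"
    if "(case ((y, b, k), (z, d, h)) of (p, q) \<Rightarrow> L p q) \<noteq> 0" for y b k z d h
    using that kmul_assoc_Some(2)[of h d k b e] by (auto simp: L_def split: if_splits)
  have R: "\<exists>k. kmul h d = Some k \<and> kmul k b = Some e \<and> kmul d b = Some c \<and> kmul h c = Some e"
    if "(case ((z, c, h), (y, b, d)) of (p, q) \<Rightarrow> R p q) \<noteq> 0" for y b c z d h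
    using that kmul_assoc_Some(1)[of d b c h e] by (auto simp: R_def split: if_splits)
  have "((H \<odot> G) \<odot> F) x (w, e) = Sum_any (\<lambda>p. Sum_any (L p))"
    unfolding cmp_apply
  proof (rule Sum_any.cong, clarify)
    fix y b k
    have fin: "finite {a. (case a of (z, d, h) \<Rightarrow> G y (z, d) * H z (w, h) * of_bool (kmul h d = Some k)) \<noteq> 0}"
      using finite_paths2_fixed[OF G H] by (simp add: case_prod_unfold)
    show "F x (y, b) * Sum_any (\<lambda>(z, d, h). G y (z, d) * H z (w, h) * of_bool (kmul h d = Some k)) *
        of_bool (kmul k b = Some e) = Sum_any (L (y, b, k))"
      using Sum_any_mult_right[OF fin, of "F x (y, b) * of_bool (kmul k b = Some e)"]
      unfolding L_def case_prod_unfold prod.sel by (simp only: mult_ac)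
  qed
  also have "\<dots> = Sum_any (\<lambda>(p, q). L p q)"
    by (rule Sum_any_pairs[OF finL])
  also have "\<dots> = Sum_any (\<lambda>(p, q). R p q)"
  \<comment> \<open>The recorded product k = h d is exchanged for c = d b and conversely. For
    nonzero terms both products exist by associativity, so \<open>the\<close> never meets
    \<open>None\<close>.\<close>
  proof (rule Sum_any_bij_witness[
          where i = "\<lambda>((y, b, k), (z, d, h)). ((z, the (kmul d b), h), (y, b, d))"
            and j = "\<lambda>((z, c, h), (y, b, d)). ((y, b, the (kmul h d)), (z, d, h))"], goal_cases)
    case (1 a)
    obtain y b k z d h where a: "a = ((y, b, k), (z, d, h))"
      by (metis prod.exhaust)
    show ?case using L 1 unfolding a by (fastforce simp: L_def R_def)
  next
    case (2 a)
    obtain y b c z d h where a: "a = ((z, c, h), (y, b, d))"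
      by (metis prod.exhaust)
    show ?case using R 2 unfolding a by (fastforce simp: L_def R_def)
  qed
  also have "\<dots> = Sum_any (\<lambda>p. Sum_any (R p))"
    by (rule Sum_any_pairs[OF finR, symmetric])
  also have "\<dots> = (H \<odot> (G \<odot> F)) x (w, e)"
    unfolding cmp_apply
  proof (rule Sum_any.cong, clarify)
    fix z c h
    have fin: "finite {a. (case a of (y, b, d) \<Rightarrow> F x (y, b) * G y (z, d) * of_bool (kmul d b = Some c)) \<noteq> 0}"
      using finite_paths2_fixed[OF F G] by (simp add: case_prod_unfold)
    show "Sum_any (R (z, c, h)) = Sum_any (\<lambda>(y, b, d). F x (y, b) * G y (z, d) * of_bool (kmul d b = Some c)) *
        H z (w, h) * of_bool (kmul h c = Some e)"
      using Sum_any_mult_right[OF fin, of "H z (w, h) * of_bool (kmul h c = Some e)"]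
      unfolding R_def case_prod_unfold prod.sel by (simp only: mult_ac)
  qed
  finally show "((H \<odot> G) \<odot> F) x (w, e) = (H \<odot> (G \<odot> F)) x (w, e)" .
qed

text \<open>Right idempotents govern which output coefficients can be multiplied, so they are built
  in. Left idempotents are kept apart in \<open>lpres\<close>, because the action of an algebra
  element changes them.\<close>

definition khom :: "'x set \<Rightarrow> ('x \<Rightarrow> idem) \<Rightarrow> 'y set \<Rightarrow> ('y \<Rightarrow> idem) \<Rightarrow> ('x, 'y) op \<Rightarrow> bool" where
  "khom B r B' r' F \<longleftrightarrow> cont_op F \<and>
     (\<forall>x y b. F x (y, b) \<noteq> 0 \<longrightarrow> x \<in> B \<and> y \<in> B' \<and> krid b = r x \<and> klid b = r' y)"

definition id_op :: "'x set \<Rightarrow> ('x \<Rightarrow> idem) \<Rightarrow> ('x, 'x) op" where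
  "id_op B r x t = of_bool (x \<in> B \<and> t = (x, kone (r x)))"

lemma khom_cont [simp]: "khom B r B' r' F \<Longrightarrow> cont_op F"
  by (simp add: khom_def)

lemma khomD:
  "khom B r B' r' F \<Longrightarrow> F x (y, b) \<noteq> 0 \<Longrightarrow> x \<in> B \<and> y \<in> B' \<and> krid b = r x \<and> klid b = r' y"
  unfolding khom_def by blast

lemma khomI:
  "cont_op F \<Longrightarrow> (\<And>x y b. F x (y, b) \<noteq> 0 \<Longrightarrow> x \<in> B \<and> y \<in> B' \<and> krid b = r x \<and> klid b = r' y) \<Longrightarrow>
   khom B r B' r' F"
  unfolding khom_def by blast

lemma khom_cmp: "khom B r B' r' F \<Longrightarrow> khom B' r' B'' r'' G \<Longrightarrow> khom B r B'' r'' (G \<odot> F)"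
  unfolding khom_def by (fastforce elim!: cmp_nonzeroE simp: cont_op_cmp dest: kmul_Some_idem)

lemma khom_add: "khom B r B' r' F \<Longrightarrow> khom B r B' r' G \<Longrightarrow> khom B r B' r' (F + G)"
  unfolding khom_def by (auto simp: cont_op_add)

lemma khom_zero [simp]: "khom B r B' r' 0"
  by (simp add: khom_def)

lemma khom_id [simp]: "khom B r B r (id_op B r)"
proof -
  have "{(x, b). id_op B r x (y, b) \<noteq> 0 \<and> b \<notin> kideal n} \<subseteq> {(y, kone (r y))}" for y n
    by (auto simp: id_op_def)
  then have "cont_op (id_op B r)"
    unfolding cont_op_def by (intro allI finite_subset[OF _ finite.insertI[OF finite.emptyI]])
  then show ?thesis by (auto simp: khom_def id_op_def)
qed

lemma id_cmp:
  assumes "khom B r B' r' F"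
  shows "id_op B' r' \<odot> F = F"
proof (rule ext, rule ext, clarify)
  fix x z c
  have "(id_op B' r' \<odot> F) x (z, c) = Sum_any (\<lambda>t. if t = (z, c, kone (r' z)) then F x (z, c) else 0)"
    unfolding cmp_apply
    by (rule Sum_any.cong)
       (use khomD[OF assms, of x z] in
         \<open>cases "F x (z, c)"; auto simp: id_op_def kmul_kone_left kmul_kone_right split: if_splits\<close>)
  then show "(id_op B' r' \<odot> F) x (z, c) = F x (z, c)" by simp
qed

lemma cmp_id:
  assumes "khom B r B' r' F"
  shows "F \<odot> id_op B r = F"
proof (rule ext, rule ext, clarify)
  fix x z c
  have "(F \<odot> id_op B r) x (z, c) = Sum_any (\<lambda>t. if t = (x, kone (r x), c) then F x (z, c) else 0)"
    unfolding cmp_apply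
    by (rule Sum_any.cong)
       (use khomD[OF assms, of x z] in
         \<open>cases "F x (z, c)"; auto simp: id_op_def kmul_kone_left kmul_kone_right split: if_splits\<close>)
  then show "(F \<odot> id_op B r) x (z, c) = F x (z, c)" by simp
qed

section \<open>Continuity of multimaps with at most one input\<close>

lemma lin_subspace_memI:
  assumes E: "lin_subspace B E" and v: "\<And>b. b \<in> Poly_Mapping.keys v \<Longrightarrow> Poly_Mapping.single b 1 \<in> E"
  shows "v \<in> E"
proof -
  have "(\<Sum>b\<in>S. Poly_Mapping.single b (1::bit)) \<in> E"
    if "finite S" "\<And>b. b \<in> S \<Longrightarrow> Poly_Mapping.single b 1 \<in> E" for S
    using that E by (induction S rule: finite_induct) (auto simp: lin_subspace_def)
  with v have "(\<Sum>b\<in>Poly_Mapping.keys v. Poly_Mapping.single b (1::bit)) \<in> E" by simp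
  moreover have "(\<Sum>b\<in>Poly_Mapping.keys v. Poly_Mapping.single b (1::bit)) = v"
    by (rule poly_mapping_eqI) (simp add: lookup_sum lookup_single when_def in_keys_iff)
  ultimately show ?thesis by simp
qed

lemma lin_subspace_lspan [simp]: "lin_subspace B (lspan C) \<longleftrightarrow> C \<subseteq> B"
proof
  assume *: "lin_subspace B (lspan C)"
  show "C \<subseteq> B"
  proof
    fix c assume "c \<in> C"
    then have "Poly_Mapping.single c 1 \<in> lspan C" by (simp add: lspan_def)
    with * have "Poly_Mapping.single c (1::bit) \<in> lspan B" by (auto simp: lin_subspace_def)
    then show "c \<in> B" by (simp add: lspan_def)
  qed
next
  assume "C \<subseteq> B"
  then show "lin_subspace B (lspan C)"
    unfolding lin_subspace_def lspan_def
    by (auto dest!: subsetD[OF Poly_Mapping.keys_add])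
qed

lemma lspan_subsetI:
  assumes "lin_subspace B E" "\<And>b. b \<in> C \<Longrightarrow> Poly_Mapping.single b 1 \<in> E"
  shows "lspan C \<subseteq> E"
  using assms by (auto simp: lspan_def intro: lin_subspace_memI)

lemma single_in_lspan [simp]: "Poly_Mapping.single b (1::bit) \<in> lspan C \<longleftrightarrow> b \<in> C"
  by (simp add: lspan_def)

lemma lspan_mono: "C \<subseteq> D \<Longrightarrow> lspan C \<subseteq> lspan D"
  by (auto simp: lspan_def)

lemma Basis_cofinite [simp]: "Basis (cofinite_space B) = B"
  by (simp add: cofinite_space_def linear_topology_def)

lemma open_cofinite_iff:
  "E \<in> Open (cofinite_space B) \<longleftrightarrow> lin_subspace B E \<and> (\<exists>F. finite F \<and> lspan (B - F) \<subseteq> E)"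
  by (auto simp: cofinite_space_def linear_topology_def)

lemma linear_topological_cofinite: "linear_topological (cofinite_space B)"
  unfolding linear_topological_def Basis_cofinite
proof (intro conjI ballI allI impI)
  show "lspan B \<in> Open (cofinite_space B)"
    by (auto simp: open_cofinite_iff intro!: exI[of _ "{}"])
next
  fix E assume "E \<in> Open (cofinite_space B)"
  then show "lin_subspace B E" by (simp add: open_cofinite_iff)
next
  fix D E assume "D \<in> Open (cofinite_space B)" "E \<in> Open (cofinite_space B)"
  then obtain F G where F: "lin_subspace B D" "finite F" "lspan (B - F) \<subseteq> D"
      "lin_subspace B E" "finite G" "lspan (B - G) \<subseteq> E"
    by (auto simp: open_cofinite_iff)
  have "lspan (B - (F \<union> G)) \<subseteq> D \<inter> E"
    using F lspan_mono[of "B - (F \<union> G)" "B - F"] lspan_mono[of "B - (F \<union> G)" "B - G"] by blast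
  moreover have "lin_subspace B (D \<inter> E)" using F by (auto simp: lin_subspace_def)
  ultimately show "D \<inter> E \<in> Open (cofinite_space B)"
    unfolding open_cofinite_iff using F by (intro conjI exI[of _ "F \<union> G"]) auto
next
  fix D E :: "('a \<Rightarrow>\<^sub>0 bit) set"
  assume "D \<in> Open (cofinite_space B)" "lin_subspace B E \<and> D \<subseteq> E"
  then show "E \<in> Open (cofinite_space B)" by (auto simp: open_cofinite_iff)
next
  fix E assume "E \<in> Open (cofinite_space B)"
  then obtain F where "finite F" "lspan (B - F) \<subseteq> E" by (auto simp: open_cofinite_iff)
  then show "\<exists>C. lspan C \<in> Open (cofinite_space B) \<and> lspan C \<subseteq> E"
    by (intro exI[of _ "B - F"]) (auto simp: open_cofinite_iff)
next
  have "v = 0" if v: "v \<in> \<Inter> (Open (cofinite_space B))" for v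
  proof (rule ccontr)
    assume "v \<noteq> 0"
    then obtain b where b: "b \<in> Poly_Mapping.keys v" by (metis keys_eq_empty ex_in_conv)
    have "lspan (B - {b}) \<in> Open (cofinite_space B)"
      by (auto simp: open_cofinite_iff intro!: exI[of _ "{b}"])
    with v have "v \<in> lspan (B - {b})" by blast
    with b show False by (auto simp: lspan_def)
  qed
  moreover have "0 \<in> \<Inter> (Open (cofinite_space B))"
    by (auto simp: open_cofinite_iff lin_subspace_def)
  ultimately show "\<Inter> (Open (cofinite_space B)) = {0}" by blast
qed

lemma keys_tensor:
  "Poly_Mapping.keys (tensor r l u v) \<subseteq>
     {(a, b). a \<in> Poly_Mapping.keys u \<and> b \<in> Poly_Mapping.keys v \<and> r a = l b}"
proof -
  have "Poly_Mapping.keys (tensor r l u v) \<subseteq> (\<Union>a\<in>Poly_Mapping.keys u. \<Union>b\<in>Poly_Mapping.keys v.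
     Poly_Mapping.keys (if r a = l b
        then Poly_Mapping.single (a, b) (Poly_Mapping.lookup u a * Poly_Mapping.lookup v b)
        else 0))"
    unfolding tensor_def by (rule order_trans[OF Poly_Mapping.keys_sum] UN_mono order_refl Poly_Mapping.keys_sum)+
  also have "\<dots> \<subseteq> {(a, b). a \<in> Poly_Mapping.keys u \<and> b \<in> Poly_Mapping.keys v \<and> r a = l b}"
    by (auto split: if_splits)
  finally show ?thesis .
qed

lemma tensor_single:
  "tensor r l (Poly_Mapping.single a 1) (Poly_Mapping.single b 1) =
     (if r a = l b then Poly_Mapping.single (a, b) 1 else 0)"
  by (simp add: tensor_def)

lemma keys_push: "Poly_Mapping.keys (push g v) \<subseteq> g ` Poly_Mapping.keys v"
  unfolding push_def by (rule order_trans[OF Poly_Mapping.keys_sum]) (auto split: if_splits)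

lemma push_in_lspan: "v \<in> lspan S \<Longrightarrow> push g v \<in> lspan (g ` S)"
  using keys_push[of g v] unfolding lspan_def by blast

text \<open>An open subspace contains all pairs (a, b) with \<open>a\<close> outside a finite set
  and, for each remaining \<open>a\<close>, those with \<open>b\<close> outside a finite set
  depending on \<open>a\<close>. So it omits finitely many basis pairs. Conversely, the two
  projections of a finite set of omitted pairs give the subspaces that the chiral condition asks
  for.\<close>

lemma chiral_cofinite:
  "chiral r l (cofinite_space A) (cofinite_space B) =
     cofinite_space {(a, b). a \<in> A \<and> b \<in> B \<and> r a = l b}" (is "?L = cofinite_space ?P")
proof -
  have "E \<in> Open ?L \<longleftrightarrow> E \<in> Open (cofinite_space ?P)" for E
  proof
    assume "E \<in> Open ?L"
    then have E: "lin_subspace ?P E"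
      and left: "\<exists>X'\<in>Open (cofinite_space A). \<forall>u\<in>X'. \<forall>v\<in>lspan B. tensor r l u v \<in> E"
      and right: "\<forall>u\<in>lspan A. \<exists>Y'\<in>Open (cofinite_space B). \<forall>v\<in>Y'. tensor r l u v \<in> E"
      by (auto simp: chiral_def Let_def)
    from left obtain F where F: "finite F" "\<And>u v. u \<in> lspan (A - F) \<Longrightarrow> v \<in> lspan B \<Longrightarrow> tensor r l u v \<in> E"
      by (auto simp: open_cofinite_iff subset_iff)
    have "\<exists>G. finite G \<and> (\<forall>v\<in>lspan (B - G). tensor r l (Poly_Mapping.single a 1) v \<in> E)" if "a \<in> A" for a
    proof -
      from right that obtain Y' where "Y' \<in> Open (cofinite_space B)"
        "\<forall>v\<in>Y'. tensor r l (Poly_Mapping.single a 1) v \<in> E" by fastforce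
      then show ?thesis by (fastforce simp: open_cofinite_iff)
    qed
    then obtain G where G: "\<And>a. a \<in> A \<Longrightarrow> finite (G a)"
        "\<And>a v. a \<in> A \<Longrightarrow> v \<in> lspan (B - G a) \<Longrightarrow> tensor r l (Poly_Mapping.single a 1) v \<in> E"
      by metis
    have "lspan (?P - Sigma (F \<inter> A) G) \<subseteq> E"
    proof (rule lspan_subsetI[OF E])
      fix t assume "t \<in> ?P - Sigma (F \<inter> A) G"
      then obtain a b where t: "t = (a, b)"
        and ab: "a \<in> A" "b \<in> B" "r a = l b" "(a, b) \<notin> Sigma (F \<inter> A) G" by blast
      then have "tensor r l (Poly_Mapping.single a 1) (Poly_Mapping.single b 1) \<in> E"
        using F(2)[of "Poly_Mapping.single a 1" "Poly_Mapping.single b 1"]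
          G(2)[of a "Poly_Mapping.single b 1"] by auto
      then show "Poly_Mapping.single t 1 \<in> E" using ab t by (simp add: tensor_single)
    qed
    then show "E \<in> Open (cofinite_space ?P)"
      using E F G by (auto simp: open_cofinite_iff intro!: exI[of _ "Sigma (F \<inter> A) G"])
  next
    assume "E \<in> Open (cofinite_space ?P)"
    then obtain H where E: "lin_subspace ?P E" and H: "finite H" "lspan (?P - H) \<subseteq> E"
      by (auto simp: open_cofinite_iff)
    have "tensor r l u v \<in> E" if "u \<in> lspan (A - fst ` H)" "v \<in> lspan B" for u v
      by (rule subsetD[OF H(2)]) (use that keys_tensor[of r l u v] in \<open>force simp: lspan_def\<close>)
    then have left: "\<forall>u\<in>lspan (A - fst ` H). \<forall>v\<in>lspan B. tensor r l u v \<in> E" by blast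
    have "tensor r l u v \<in> E" if "u \<in> lspan A" "v \<in> lspan (B - snd ` H)" for u v
      by (rule subsetD[OF H(2)]) (use that keys_tensor[of r l u v] in \<open>force simp: lspan_def\<close>)
    then have right: "\<forall>u\<in>lspan A. \<forall>v\<in>lspan (B - snd ` H). tensor r l u v \<in> E" by blast
    have A: "lspan (A - fst ` H) \<in> Open (cofinite_space A)"
      using H by (auto simp: open_cofinite_iff intro!: exI[of _ "fst ` H"])
    have B: "lspan (B - snd ` H) \<in> Open (cofinite_space B)"
      using H by (auto simp: open_cofinite_iff intro!: exI[of _ "snd ` H"])
    have "\<exists>X'\<in>Open (cofinite_space A). \<forall>u\<in>X'. \<forall>v\<in>lspan B. tensor r l u v \<in> E"
      by (rule bexI[where x = "lspan (A - fst ` H)"]) (rule left, rule A)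
    moreover have "\<forall>u\<in>lspan A. \<exists>Y'\<in>Open (cofinite_space B). \<forall>v\<in>Y'. tensor r l u v \<in> E"
      by (rule ballI, rule bexI[where x = "lspan (B - snd ` H)"]) (erule bspec[OF right], rule B)
    ultimately show "E \<in> Open ?L"
      using E by (simp add: chiral_def Let_def)
  qed
  then have "Open ?L = Open (cofinite_space ?P)" by blast
  then show ?thesis by (simp add: chiral_def Let_def cofinite_space_def linear_topology_def)
qed

section \<open>Continuous maps into the completed product with the algebra\<close>

lemma open_K_iff: "E \<in> Open K_space \<longleftrightarrow> lin_subspace UNIV E \<and> (\<exists>n. lspan (kideal n) \<subseteq> E)"
  by (auto simp: K_space_def linear_topology_def chiral_ideal_eq)

lemma Basis_K [simp]: "Basis K_space = UNIV"
  by (simp add: K_space_def linear_topology_def)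

text \<open>Targets outside a finite set are unconstrained. Each of the remaining ones has its own
  ideal, and the maximum of finitely many indices gives a single \<open>n\<close>.\<close>

lemma open_out_spaceE:
  assumes Y: "da_space Y = cofinite_space B" and E: "E \<in> Open (out_space Y)"
  obtains F n where "finite F"
    "\<And>y b. y \<in> B \<Longrightarrow> rid Y y = klid b \<Longrightarrow> y \<notin> F \<or> b \<in> kideal n \<Longrightarrow> Poly_Mapping.single (y, b) 1 \<in> E"
proof -
  from E have left: "\<exists>X'\<in>Open (cofinite_space B). \<forall>u\<in>X'. \<forall>v\<in>lspan UNIV. tensor (rid Y) klid u v \<in> E"
      and right: "\<forall>u\<in>lspan B. \<exists>Y'\<in>Open K_space. \<forall>v\<in>Y'. tensor (rid Y) klid u v \<in> E"
    by (auto simp: out_space_def chiral_def Let_def Y)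
  from left obtain F where F: "finite F"
      "\<And>u v. u \<in> lspan (B - F) \<Longrightarrow> v \<in> lspan UNIV \<Longrightarrow> tensor (rid Y) klid u v \<in> E"
    by (auto simp: open_cofinite_iff subset_iff)
  have "\<exists>n. \<forall>v\<in>lspan (kideal n). tensor (rid Y) klid (Poly_Mapping.single y 1) v \<in> E" if "y \<in> B" for y
  proof -
    from right that obtain Y' where "Y' \<in> Open K_space"
      "\<forall>v\<in>Y'. tensor (rid Y) klid (Poly_Mapping.single y 1) v \<in> E" by fastforce
    then show ?thesis by (auto simp: open_K_iff)
  qed
  then obtain n where n: "\<And>y v. y \<in> B \<Longrightarrow> v \<in> lspan (kideal (n y)) \<Longrightarrow>
      tensor (rid Y) klid (Poly_Mapping.single y 1) v \<in> E"
    by metis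
  define N where "N = Max (insert 0 (n ` F))"
  have N: "kideal N \<subseteq> kideal (n y)" if "y \<in> F" for y
    using that F by (intro kideal_antimono) (auto simp: N_def)
  show thesis
  proof (rule that[of F N])
    fix y b assume yb: "y \<in> B" "rid Y y = klid b" "y \<notin> F \<or> b \<in> kideal N"
    then have "tensor (rid Y) klid (Poly_Mapping.single y 1) (Poly_Mapping.single b 1) \<in> E"
      using F(2)[of "Poly_Mapping.single y 1" "Poly_Mapping.single b 1"]
        n[of y "Poly_Mapping.single b 1"] N by auto
    then show "Poly_Mapping.single (y, b) 1 \<in> E" using yb by (simp add: tensor_single)
  qed (rule F)
qed

text \<open>Modulo an open subspace only finitely many terms of \<xi> matter: those at targets in
  \<open>F\<close> with coefficient outside J_n. Their sum is the approximating
  \<open>v\<close>.\<close>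

lemma completion_outI:
  assumes Y: "da_space Y = cofinite_space B"
    and supp: "\<And>y b. \<xi> (y, b) \<noteq> 0 \<Longrightarrow> y \<in> B \<and> rid Y y = klid b"
    and fin: "\<And>y n. finite {b. \<xi> (y, b) \<noteq> 0 \<and> b \<notin> kideal n}"
  shows "\<xi> \<in> completion (out_space Y)"
  unfolding completion_def
proof (clarify)
  fix E assume E: "E \<in> Open (out_space Y)"
  from open_out_spaceE[OF Y E] obtain F n where F: "finite F"
    and single: "\<And>y b. y \<in> B \<Longrightarrow> rid Y y = klid b \<Longrightarrow> y \<notin> F \<or> b \<in> kideal n \<Longrightarrow> Poly_Mapping.single (y, b) 1 \<in> E"
    by blast
  define A where "A = Sigma F (\<lambda>y. {b. \<xi> (y, b) \<noteq> 0 \<and> b \<notin> kideal n})"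
  have A: "finite A" unfolding A_def using F fin by (intro finite_SigmaI)
  define v where "v = (\<Sum>t\<in>A. Poly_Mapping.single t (1::bit))"
  have v: "Poly_Mapping.lookup v t = of_bool (t \<in> A)" for t
    using A by (simp add: v_def lookup_sum lookup_single when_def)
  have "Poly_Mapping.keys v = A" using v by (auto simp: in_keys_iff)
  moreover have "A \<subseteq> Basis (out_space Y)"
    using supp by (auto simp: A_def out_space_def chiral_def Let_def Y)
  ultimately have "v \<in> lspan (Basis (out_space Y))" by (simp add: lspan_def)
  moreover have "agree_mod E \<xi> v"
    unfolding agree_mod_def
  proof (clarify)
    fix y b assume *: "\<xi> (y, b) \<noteq> Poly_Mapping.lookup v (y, b)"
    then have "\<xi> (y, b) \<noteq> 0" "(y, b) \<notin> A" by (cases "\<xi> (y, b)"; auto simp: v A_def)+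
    with supp[of y b] show "Poly_Mapping.single (y, b) 1 \<in> E"
      by (intro single) (auto simp: A_def)
  qed
  ultimately show "\<exists>v\<in>lspan (Basis (out_space Y)). agree_mod E \<xi> v" by blast
qed

text \<open>Neighbourhoods of 0 in the target are detected by a finite \<open>F\<close> and one
  \<open>n\<close>; the images of vectors in \<open>D\<close> are then congruent to 0 modulo
  \<open>E\<close>.\<close>

lemma continuous_map_outI:
  assumes Y: "da_space Y = cofinite_space B"
    and supp: "\<And>a y b. a \<in> Basis S \<Longrightarrow> f a (y, b) \<noteq> 0 \<Longrightarrow> y \<in> B \<and> rid Y y = klid b"
    and fin: "\<And>a y n. a \<in> Basis S \<Longrightarrow> finite {b. f a (y, b) \<noteq> 0 \<and> b \<notin> kideal n}"
    and cont: "\<And>F n. finite F \<Longrightarrow> \<exists>D\<in>Open S. \<forall>v\<in>D. \<forall>a\<in>Poly_Mapping.keys v. a \<in> Basis S \<and>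
        (\<forall>y\<in>F. \<forall>b. f a (y, b) \<noteq> 0 \<longrightarrow> b \<in> kideal n)"
  shows "continuous_map S (out_space Y) f"
  unfolding continuous_map_def
proof (intro conjI ballI)
  fix a assume "a \<in> Basis S"
  with Y supp fin show "f a \<in> completion (out_space Y)" by (intro completion_outI) auto
next
  fix E assume E: "E \<in> Open (out_space Y)"
  from open_out_spaceE[OF Y E] obtain F n where F: "finite F"
    and single: "\<And>y b. y \<in> B \<Longrightarrow> rid Y y = klid b \<Longrightarrow> y \<notin> F \<or> b \<in> kideal n \<Longrightarrow> Poly_Mapping.single (y, b) 1 \<in> E"
    by blast
  from cont[OF F, of n] obtain D where D: "D \<in> Open S"
    and DB: "\<And>v a. v \<in> D \<Longrightarrow> a \<in> Poly_Mapping.keys v \<Longrightarrow> a \<in> Basis S"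
    and Df: "\<And>v a y b. v \<in> D \<Longrightarrow> a \<in> Poly_Mapping.keys v \<Longrightarrow> y \<in> F \<Longrightarrow> f a (y, b) \<noteq> 0 \<Longrightarrow> b \<in> kideal n"
    by blast
  have "lin_ext f v \<in> closure_in (out_space Y) E" if v: "v \<in> D" for v
  proof -
    have nz: "\<exists>a\<in>Poly_Mapping.keys v. f a t \<noteq> 0" if "lin_ext f v t \<noteq> 0" for t
      using that unfolding lin_ext_def by (metis (no_types, lifting) mult_zero_right sum.neutral)
    have "finite {b. lin_ext f v (y, b) \<noteq> 0 \<and> b \<notin> kideal n}" for y n
      by (rule finite_subset[of _ "\<Union>a\<in>Poly_Mapping.keys v. {b. f a (y, b) \<noteq> 0 \<and> b \<notin> kideal n}"])
         (use nz fin DB[OF v] in auto)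
    then have "lin_ext f v \<in> completion (out_space Y)"
      using nz supp DB[OF v] by (intro completion_outI[OF Y]) blast+
    moreover have "agree_mod E (lin_ext f v) 0"
      unfolding agree_mod_def
    proof (clarify)
      fix y b assume "lin_ext f v (y, b) \<noteq> Poly_Mapping.lookup 0 (y, b)"
      then obtain a where "a \<in> Poly_Mapping.keys v" "f a (y, b) \<noteq> 0" using nz[of "(y, b)"] by auto
      then show "Poly_Mapping.single (y, b) 1 \<in> E"
        using supp[OF DB[OF v], of a y b] Df[OF v, of a y b] by (intro single) blast+
    qed
    moreover have "0 \<in> E" using E by (auto simp: out_space_def chiral_def Let_def lin_subspace_def)
    ultimately show ?thesis by (auto simp: closure_in_def)
  qed
  with D show "\<exists>D\<in>Open S. \<forall>v\<in>D. lin_ext f v \<in> closure_in (out_space Y) E" by blast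
qed

section \<open>Input spaces and multimaps with at most one algebra input\<close>

declare in_space.simps [simp del]

lemma Basis_in_space_0: "Basis (in_space X 0) = Pair [] ` Basis (da_space X)"
  by (simp add: in_space.simps relabel_def)

lemma Basis_in_space_1:
  "Basis (in_space X (Suc 0)) = {([a], x) |a x. x \<in> Basis (da_space X) \<and> krid a = lid X x}"
  by (force simp: in_space.simps relabel_def chiral_def Let_def image_iff)

text \<open>In the arities where a multimap vanishes, continuity still asks for a neighbourhood of 0
  as witness, and its vectors must be supported on basis elements.\<close>

lemma in_space_open:
  assumes "linear_topological (da_space X)"
  shows "Open (in_space X n) \<noteq> {} \<and> (\<forall>E\<in>Open (in_space X n). E \<subseteq> lspan (Basis (in_space X n)))"
proof (induction n)
  case 0
  have "lspan (Basis (da_space X)) \<in> Open (da_space X)"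
    and "\<And>E. E \<in> Open (da_space X) \<Longrightarrow> E \<subseteq> lspan (Basis (da_space X))"
    using assms by (auto simp: linear_topological_def lin_subspace_def)
  moreover have "push (Pair []) v \<in> lspan (Pair [] ` Basis (da_space X))"
    if "v \<in> lspan (Basis (da_space X))" for v :: "'a \<Rightarrow>\<^sub>0 bit"
    using that by (rule push_in_lspan)
  ultimately show ?case by (auto simp: in_space.simps relabel_def)
next
  case (Suc n)
  let ?S = "chiral krid (word_lid (lid X)) K_space (in_space X n)"
  let ?g = "\<lambda>(a, as, x). (a # as, x)"
  from Suc obtain Y' where Y': "Y' \<in> Open (in_space X n)" by blast
  have sub: "E \<subseteq> lspan (Basis (in_space X n))" if "E \<in> Open (in_space X n)" for E
    using Suc that by blast
  have tens: "tensor krid (word_lid (lid X)) u v \<in> lspan (Basis ?S)"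
    if "v \<in> lspan (Basis (in_space X n))"
    for u and v :: "kmon list \<times> 'a \<Rightarrow>\<^sub>0 bit"
    using that keys_tensor[of krid "word_lid (lid X)" u v] by (force simp: lspan_def chiral_def Let_def)
  have "lspan UNIV \<in> Open K_space" by (simp add: open_K_iff lspan_mono)
  moreover have "lin_subspace (Basis ?S) (lspan (Basis ?S))" by simp
  ultimately have "lspan (Basis ?S) \<in> Open ?S"
    using Y' sub[OF Y'] tens by (auto simp: chiral_def Let_def)
  moreover have "push ?g v \<in> lspan (?g ` Basis ?S)" if "v \<in> lspan (Basis ?S)" for v
    using that by (rule push_in_lspan)
  moreover have "E \<subseteq> lspan (Basis ?S)" if "E \<in> Open ?S" for E
    using that by (auto simp: chiral_def Let_def lin_subspace_def)
  ultimately show ?case by (fastforce simp: in_space.simps relabel_def)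
qed

text \<open>Chiral continuity in the algebra input: an open subspace of the product of the algebra
  with X contains J_N tensored with all of X for some \<open>N\<close>, so small inputs have to give
  small outputs uniformly in \<open>x\<close>. For a fixed input the condition is
  \<open>cont_op\<close>.\<close>

definition unif_op :: "(kmon \<Rightarrow> ('x, 'y) op) \<Rightarrow> bool" where
  "unif_op F \<longleftrightarrow> (\<forall>y n. \<exists>N. \<forall>a\<in>kideal N. \<forall>x b. F a x (y, b) \<noteq> 0 \<longrightarrow> b \<in> kideal n)"

definition maps :: "('x, 'y) op \<Rightarrow> (kmon \<Rightarrow> ('x, 'y) op) \<Rightarrow> ('x, 'y) multimap" where
  "maps F0 F1 as = (case as of [] \<Rightarrow> F0 | [a] \<Rightarrow> F1 a | _ \<Rightarrow> 0)"

lemma maps_simps [simp]: "maps F0 F1 [] = F0" "maps F0 F1 [a] = F1 a" "maps F0 F1 (a # b # cs) = 0"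
  by (simp_all add: maps_def)

lemma maps_long: "length as \<ge> 2 \<Longrightarrow> maps F0 F1 as = 0"
  by (cases as; cases "tl as") auto

definition op_map :: "'x set \<Rightarrow> ('x \<Rightarrow> idem) \<Rightarrow> ('x \<Rightarrow> idem) \<Rightarrow> 'y set \<Rightarrow> ('y \<Rightarrow> idem) \<Rightarrow> ('y \<Rightarrow> idem) \<Rightarrow>
    ('x, 'y) op \<Rightarrow> (kmon \<Rightarrow> ('x, 'y) op) \<Rightarrow> bool" where
  "op_map B l r B' l' r' F0 F1 \<longleftrightarrow> khom B r B' r' F0 \<and> (\<forall>a. khom B r B' r' (F1 a)) \<and> unif_op F1 \<and>
     (\<forall>x y b. F0 x (y, b) \<noteq> 0 \<longrightarrow> l' y = l x) \<and>
     (\<forall>a x y b. F1 a x (y, b) \<noteq> 0 \<longrightarrow> krid a = l x \<and> klid a = l' y)"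

lemma cont_op_fibre: "cont_op F \<Longrightarrow> finite {b. F x (y, b) \<noteq> 0 \<and> b \<notin> kideal n}"
  by (rule finite_subset[OF _ finite_imageI[OF cont_opD[of F y n], of snd]]) force

text \<open>\<open>G a\<close> collects the generators excluded for the input \<open>a\<close>. It
  may vary with \<open>a\<close> as a finite set, but has to be empty for \<open>a\<close> in J_N:
  these are the two clauses of the chiral topology.\<close>

lemma open_in_space_1:
  assumes X: "da_space X = cofinite_space B"
    and C: "\<And>a. a \<in> kideal N \<Longrightarrow> G a = {}" "\<And>a. finite (G a)"
  shows "push (\<lambda>(a, as, x). (a # as, x)) ` lspan {(a, as, x). as = [] \<and> krid a = lid X x \<and> x \<in> B - G a}
     \<in> Open (in_space X (Suc 0))"
proof -
  let ?C = "{(a, as, x). as = [] \<and> krid a = lid X x \<and> x \<in> B - G a}"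
  let ?S0 = "in_space X 0"
  have "lspan ?C \<in> Open (chiral krid (word_lid (lid X)) K_space ?S0)"
  proof -
    have "lin_subspace (Basis (chiral krid (word_lid (lid X)) K_space ?S0)) (lspan ?C)"
      by (auto simp: chiral_def Let_def in_space.simps relabel_def X)
    moreover have "tensor krid (word_lid (lid X)) u v \<in> lspan ?C"
      if "u \<in> lspan (kideal N)" "v \<in> lspan (Basis ?S0)"
      for u and v :: "kmon list \<times> 'a \<Rightarrow>\<^sub>0 bit"
      using that keys_tensor[of krid "word_lid (lid X)" u v] C(1) by (fastforce simp: lspan_def in_space.simps relabel_def X)
    moreover have "lspan (kideal N) \<in> Open K_space" by (auto simp: open_K_iff)
    moreover have "\<exists>Y'\<in>Open ?S0. \<forall>v\<in>Y'. tensor krid (word_lid (lid X)) u v \<in> lspan ?C"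
      for u :: kalg
    proof (intro bexI ballI)
      let ?G = "\<Union>a\<in>Poly_Mapping.keys u. G a"
      have "lspan (B - ?G) \<in> Open (cofinite_space B)"
        using C(2) by (auto simp: open_cofinite_iff intro!: exI[of _ ?G])
      then show "push (Pair []) ` lspan (B - ?G) \<in> Open ?S0" by (simp add: in_space.simps relabel_def X)
      fix v :: "kmon list \<times> 'a \<Rightarrow>\<^sub>0 bit"
      assume "v \<in> push (Pair []) ` lspan (B - ?G)"
      then have "v \<in> lspan (Pair [] ` (B - ?G))"
        by (auto intro: push_in_lspan)
      then show "tensor krid (word_lid (lid X)) u v \<in> lspan ?C"
        using keys_tensor[of krid "word_lid (lid X)" u v] by (fastforce simp: lspan_def)
    qed
    ultimately show ?thesis unfolding chiral_def Let_def by auto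
  qed
  then show ?thesis by (simp add: in_space.simps relabel_def)
qed

lemma DA_multimap_maps:
  assumes X: "da_space X = cofinite_space B" and Y: "da_space Y = cofinite_space B'"
    and op: "op_map B (lid X) (rid X) B' (lid Y) (rid Y) F0 F1"
  shows "DA_multimap X Y (maps F0 F1)"
  unfolding DA_multimap_def
proof (intro conjI allI impI)
  have F0: "khom B (rid X) B' (rid Y) F0" and F1: "\<And>a. khom B (rid X) B' (rid Y) (F1 a)"
    using op by (auto simp: op_map_def)
  fix n
  consider "n = 0" | "n = Suc 0" | "n \<ge> 2" by linarith
  then show "continuous_map (in_space X n) (out_space Y) (\<lambda>(as, x). maps F0 F1 as x)"
  proof cases
    case 1
    show ?thesis unfolding 1
    proof (rule continuous_map_outI[OF Y])
      fix a y b n assume a: "a \<in> Basis (in_space X 0)"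
      then obtain x where [simp]: "a = ([], x)" by (auto simp: Basis_in_space_0)
      show "finite {b. (case a of (as, x) \<Rightarrow> maps F0 F1 as x) (y, b) \<noteq> 0 \<and> b \<notin> kideal n}"
        using cont_op_fibre[OF khom_cont[OF F0]] by simp
      assume "(case a of (as, x) \<Rightarrow> maps F0 F1 as x) (y, b) \<noteq> 0"
      then show "y \<in> B' \<and> rid Y y = klid b" using khomD[OF F0, of x y b] by simp
    next
      fix F :: "'b set" and n assume "finite F"
      let ?G = "\<Union>y\<in>F. fst ` {(x, b). F0 x (y, b) \<noteq> 0 \<and> b \<notin> kideal n}"
      have "finite ?G" using \<open>finite F\<close> cont_opD[OF khom_cont[OF F0]] by blast
      then have "lspan (B - ?G) \<in> Open (cofinite_space B)"
        by (auto simp: open_cofinite_iff intro!: exI[of _ ?G])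
      then have "push (Pair []) ` lspan (B - ?G) \<in> Open (in_space X 0)" by (simp add: in_space.simps relabel_def X)
      moreover have "a \<in> Pair [] ` (B - ?G)"
        if "v \<in> push (Pair []) ` lspan (B - ?G)" "a \<in> Poly_Mapping.keys v" for v a
      proof -
        have "v \<in> lspan (Pair [] ` (B - ?G))" using that(1) push_in_lspan by blast
        with that(2) show ?thesis by (auto simp: lspan_def)
      qed
      moreover have "a \<in> Basis (in_space X 0) \<and>
          (\<forall>y\<in>F. \<forall>b. (case a of (as, x) \<Rightarrow> maps F0 F1 as x) (y, b) \<noteq> 0 \<longrightarrow> b \<in> kideal n)"
        if "a \<in> Pair [] ` (B - ?G)" for a
        using that by (clarsimp simp: Basis_in_space_0 X image_iff) (metis zero_neq_one)
      ultimately show "\<exists>D\<in>Open (in_space X 0). \<forall>v\<in>D. \<forall>a\<in>Poly_Mapping.keys v. a \<in> Basis (in_space X 0) \<and>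
          (\<forall>y\<in>F. \<forall>b. (case a of (as, x) \<Rightarrow> maps F0 F1 as x) (y, b) \<noteq> 0 \<longrightarrow> b \<in> kideal n)"
        by - (rule bexI[rotated], assumption, intro ballI, blast)
    qed
  next
    case 2
    show ?thesis unfolding 2
    proof (rule continuous_map_outI[OF Y])
      fix t y b n assume t: "t \<in> Basis (in_space X (Suc 0))"
      then obtain a x where [simp]: "t = ([a], x)" by (auto simp: Basis_in_space_1)
      show "finite {b. (case t of (as, x) \<Rightarrow> maps F0 F1 as x) (y, b) \<noteq> 0 \<and> b \<notin> kideal n}"
        using cont_op_fibre[OF khom_cont[OF F1]] by simp
      assume "(case t of (as, x) \<Rightarrow> maps F0 F1 as x) (y, b) \<noteq> 0"
      then show "y \<in> B' \<and> rid Y y = klid b" using khomD[OF F1, of a x y b] by simp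
    next
      fix F :: "'b set" and n assume F: "finite F"
      have "\<forall>y. \<exists>N. \<forall>a\<in>kideal N. \<forall>x b. F1 a x (y, b) \<noteq> 0 \<longrightarrow> b \<in> kideal n"
        using op by (simp add: op_map_def unif_op_def)
      then obtain N where N: "\<And>y a x b. a \<in> kideal (N y) \<Longrightarrow> F1 a x (y, b) \<noteq> 0 \<Longrightarrow> b \<in> kideal n"
        by metis
      define M where "M = Max (insert 0 (N ` F))"
      have M: "kideal M \<subseteq> kideal (N y)" if "y \<in> F" for y
        using that F by (intro kideal_antimono) (auto simp: M_def)
      \<comment> \<open>The sources with a coefficient outside J_n at some target in
        \<open>F\<close>; by uniformity there are none for \<open>a\<close> in J_M.\<close>
      let ?G = "\<lambda>a. \<Union>y\<in>F. fst ` {(x, b). F1 a x (y, b) \<noteq> 0 \<and> b \<notin> kideal n}"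
      let ?D = "push (\<lambda>(a, as, x). (a # as, x)) `
        lspan {(a, as, x). as = [] \<and> krid a = lid X x \<and> x \<in> B - ?G a}"
      have "finite (?G a)" for a
        using F cont_opD[OF khom_cont[OF F1]] by (intro finite_UN_I finite_imageI)
      moreover have "?G a = {}" if "a \<in> kideal M" for a
        using that N M by blast
      ultimately have "?D \<in> Open (in_space X (Suc 0))"
        by (intro open_in_space_1[OF X, of M]) auto
      moreover have "t \<in> {([a], x) |a x. krid a = lid X x \<and> x \<in> B - ?G a}"
        if v: "v \<in> ?D" and t: "t \<in> Poly_Mapping.keys v" for v t
      proof -
        have "v \<in> lspan ((\<lambda>(a, as, x). (a # as, x)) `
            {(a, as, x). as = [] \<and> krid a = lid X x \<and> x \<in> B - ?G a})"
          using v push_in_lspan by blast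
        with t show ?thesis unfolding lspan_def by force
      qed
      moreover have "t \<in> Basis (in_space X (Suc 0)) \<and>
          (\<forall>y\<in>F. \<forall>b. (case t of (as, x) \<Rightarrow> maps F0 F1 as x) (y, b) \<noteq> 0 \<longrightarrow> b \<in> kideal n)"
        if "t \<in> {([a], x) |a x. krid a = lid X x \<and> x \<in> B - ?G a}" for t
        using that by (clarsimp simp: Basis_in_space_1 X image_iff) (metis zero_neq_one)
      ultimately show "\<exists>D\<in>Open (in_space X (Suc 0)). \<forall>v\<in>D. \<forall>a\<in>Poly_Mapping.keys v.
          a \<in> Basis (in_space X (Suc 0)) \<and>
          (\<forall>y\<in>F. \<forall>b. (case a of (as, x) \<Rightarrow> maps F0 F1 as x) (y, b) \<noteq> 0 \<longrightarrow> b \<in> kideal n)"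
        by - (rule bexI[rotated], assumption, intro ballI, blast)
    qed
  next
    case 3
    \<comment> \<open>All values are 0 in these arities, so any open subspace serves as
      witness.\<close>
    have open_in: "Open (in_space X n) \<noteq> {}" "\<And>E. E \<in> Open (in_space X n) \<Longrightarrow> E \<subseteq> lspan (Basis (in_space X n))"
      using in_space_open[of X n] linear_topological_cofinite[of B] by (auto simp: X)
    have len: "length (fst t) = n" if "t \<in> Basis (in_space X n)" for t n
      using that by (induction n arbitrary: t) (auto simp: in_space.simps relabel_def chiral_def Let_def)
    have zero: "(case t of (as, x) \<Rightarrow> maps F0 F1 as x) = 0" if "t \<in> Basis (in_space X n)" for t
      using len[OF that] 3 by (auto simp: maps_long split: prod.splits)
    show ?thesis
    proof (rule continuous_map_outI[OF Y])
      fix F :: "'b set" and k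
      from open_in obtain D where "D \<in> Open (in_space X n)" "D \<subseteq> lspan (Basis (in_space X n))" by blast
      then show "\<exists>D\<in>Open (in_space X n). \<forall>v\<in>D. \<forall>a\<in>Poly_Mapping.keys v. a \<in> Basis (in_space X n) \<and>
          (\<forall>y\<in>F. \<forall>b. (case a of (as, x) \<Rightarrow> maps F0 F1 as x) (y, b) \<noteq> 0 \<longrightarrow> b \<in> kideal k)"
        using zero by (intro bexI[of _ D] ballI conjI) (force simp: lspan_def)+
    qed (use zero in force)+
  qed
next
  have F0: "khom B (rid X) B' (rid Y) F0" using op by (simp add: op_map_def)
  fix as x y b assume nz: "maps F0 F1 as x (y, b) \<noteq> 0"
  then have "length as < 2" by (metis linorder_not_less maps_long zero_fun_apply)
  then consider "as = []" | a where "as = [a]" by (cases as; cases "tl as") auto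
  then have "(as, x) \<in> Basis (in_space X (length as)) \<and> y \<in> B' \<and> klid b = rid Y y \<and>
      lid Y y = word_lid (lid X) (as, x) \<and> krid b = rid X x"
  proof cases
    case 1
    have "F0 x (y, b) \<noteq> 0" using nz 1 by simp
    with op F0 have "x \<in> B" "y \<in> B'" "krid b = rid X x" "klid b = rid Y y" "lid Y y = lid X x"
      using khomD[OF F0, of x y b] unfolding op_map_def by blast+
    then show ?thesis unfolding 1 by (simp add: Basis_in_space_0 X)
  next
    case (2 a)
    have "F1 a x (y, b) \<noteq> 0" using nz 2 by simp
    with op khomD[of B "rid X" B' "rid Y" "F1 a" x y b] have "x \<in> B" "y \<in> B'" "krid b = rid X x" "klid b = rid Y y"
        "krid a = lid X x" "klid a = lid Y y"
      unfolding op_map_def by blast+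
    then show ?thesis unfolding 2 by (simp add: Basis_in_space_1 X)
  qed
  then show "(as, x) \<in> Basis (in_space X (length as))" "(y, b) \<in> Basis (out_space Y)"
      "lid Y y = word_lid (lid X) (as, x)" "krid b = rid X x"
    by (simp_all add: out_space_def chiral_def Let_def Y)
qed

section \<open>Homological perturbation\<close>

lemma da_comp_eq_sum:
  "da_comp g f as x t = (\<Sum>i\<le>length as. (g (take i as) \<odot> f (drop i as)) x t)"
  by (cases t) (simp add: da_comp_def cmp_apply)

lemma da_comp_maps:
  "da_comp (maps G0 G1) (maps F0 F1) [] x t = (G0 \<odot> F0) x t"
  "da_comp (maps G0 G1) (maps F0 F1) [a] x t = (G0 \<odot> F1 a) x t + (G1 a \<odot> F0) x t"
  "da_comp (maps G0 G1) (maps F0 F1) [a, b] x t = (G1 a \<odot> F1 b) x t"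
  "da_comp (maps G0 G1) (maps F0 F1) (a # b # c # cs) x t = 0"
proof -
  show "da_comp (maps G0 G1) (maps F0 F1) (a # b # c # cs) x t = 0"
    unfolding da_comp_eq_sum
  proof (rule sum.neutral, rule ballI)
    fix i assume "i \<in> {..length (a # b # c # cs)}"
    then have "length (take i (a # b # c # cs)) \<ge> 2 \<or> length (drop i (a # b # c # cs)) \<ge> 2"
      by auto
    then show "(maps G0 G1 (take i (a # b # c # cs)) \<odot> maps F0 F1 (drop i (a # b # c # cs))) x t = 0"
      by (elim disjE) (simp_all only: maps_long cmp_zero zero_fun_apply)
  qed
qed (simp_all add: da_comp_eq_sum)

lemma mult_inputs_maps:
  "mult_inputs (maps F0 F1) [] x t = 0"
  "mult_inputs (maps F0 F1) [a] x t = 0"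
  "mult_inputs (maps F0 F1) [a, b] x t = (case kmul a b of None \<Rightarrow> 0 | Some c \<Rightarrow> F1 c) x t"
  "mult_inputs (maps F0 F1) (a # b # c # cs) x t = 0"
proof -
  show "mult_inputs (maps F0 F1) (a # b # c # cs) x t = 0"
    unfolding mult_inputs_def
    by (rule sum.neutral) (auto simp: maps_long split: option.split)
qed (simp_all add: mult_inputs_def split: option.split)

lemma input_cases:
  obtains "as = []" | a where "as = [a]" | a b where "as = [a, b]" | a b c cs where "as = a # b # c # cs"
  by (cases as; cases "tl as"; cases "tl (tl as)") auto

text \<open>One format for two purposes: with zero right-hand side it expresses that a multimap is a
  homomorphism, and with a composite plus the identity that it is a homotopy. From three inputs on,
  both sides vanish.\<close>

lemma DA_diff_maps:
  assumes "delta X = maps d m" "delta Y = maps d' m'"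
  shows "(\<forall>as x t. DA_diff X Y (maps F0 F1) as x t = da_comp (maps K0 K1) (maps G0 G1) as x t + maps L0 (\<lambda>_. 0) as x t) \<longleftrightarrow>
     d' \<odot> F0 + F0 \<odot> d = K0 \<odot> G0 + L0 \<and>
     (\<forall>a. d' \<odot> F1 a + m' a \<odot> F0 + F0 \<odot> m a + F1 a \<odot> d = K0 \<odot> G1 a + K1 a \<odot> G0) \<and>
     (\<forall>a b. m' a \<odot> F1 b + F1 a \<odot> m b + (case kmul a b of None \<Rightarrow> 0 | Some c \<Rightarrow> F1 c) = K1 a \<odot> G1 b)"
    (is "?L \<longleftrightarrow> ?R")
proof -
  have "(\<forall>as. P as) \<longleftrightarrow> P [] \<and> (\<forall>a. P [a]) \<and> (\<forall>a b. P [a, b]) \<and> (\<forall>a b c cs. P (a # b # c # cs))"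
    for P :: "kmon list \<Rightarrow> bool" by (metis input_cases)
  note this[of "\<lambda>as. \<forall>x t. DA_diff X Y (maps F0 F1) as x t =
      da_comp (maps K0 K1) (maps G0 G1) as x t + maps L0 (\<lambda>_. 0) as x t"]
  then show ?thesis
    by (simp only: DA_diff_def assms da_comp_maps mult_inputs_maps maps_simps fun_eq_iff plus_fun_apply
        zero_fun_apply add_0_left add_0_right simp_thms add_ac)
qed

text \<open>What a type-DA structure amounts to when it vanishes beyond one input: a differential
  and a strictly multiplicative, unital action commuting with it.\<close>

definition strict_bimodule :: "'x set \<Rightarrow> ('x \<Rightarrow> idem) \<Rightarrow> ('x \<Rightarrow> idem) \<Rightarrow> ('x, 'x) op \<Rightarrow>
    (kmon \<Rightarrow> ('x, 'x) op) \<Rightarrow> bool" where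
  "strict_bimodule B l r d m \<longleftrightarrow> op_map B l r B l r d m \<and> d \<odot> d = 0 \<and>
     (\<forall>a. m a \<odot> d = d \<odot> m a) \<and>
     (\<forall>a b. m a \<odot> m b = (case kmul a b of None \<Rightarrow> 0 | Some c \<Rightarrow> m c)) \<and>
     (\<forall>e x t. m (kone e) x t = of_bool (x \<in> B \<and> l x = e \<and> t = (x, kone (r x))))"

lemma type_DA_maps:
  assumes X: "da_space X = cofinite_space B" "delta X = maps d m"
    and sb: "strict_bimodule B (lid X) (rid X) d m"
  shows "type_DA X"
proof -
  have op: "op_map B (lid X) (rid X) B (lid X) (rid X) d m" and dd: "d \<odot> d = 0"
    and md: "\<And>a. m a \<odot> d = d \<odot> m a"
    and mult: "\<And>a b. m a \<odot> m b = (case kmul a b of None \<Rightarrow> 0 | Some c \<Rightarrow> m c)"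
    and one: "\<And>e x t. m (kone e) x t = of_bool (x \<in> B \<and> lid X x = e \<and> t = (x, kone (rid X x)))"
    using sb unfolding strict_bimodule_def by blast+
  have "da_comp (delta X) (delta X) as x t + mult_inputs (delta X) as x t = 0" for as x t
    unfolding X(2)
    by (cases as rule: input_cases)
       (simp_all only: da_comp_maps mult_inputs_maps dd md mult bit_add_self zero_fun_apply add_0_right)
  then show ?thesis
    unfolding type_DA_def
    using DA_multimap_maps[OF X(1) X(1) op] linear_topological_cofinite[of B]
    by (auto simp: X one maps_long)
qed

text \<open>Only finitely many entries of \<open>G\<close> at the target lie outside J_n. Each of
  them asks for its own bound on the input of \<open>F\<close>, and the maximum works for
  all.\<close>

lemma unif_op_cmp_left:
  assumes "cont_op G" "unif_op F"
  shows "unif_op (\<lambda>a. G \<odot> F a)"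
  unfolding unif_op_def
proof (intro allI)
  fix z n
  define P where "P = {(y, d). G y (z, d) \<noteq> 0 \<and> d \<notin> kideal n}"
  have P: "finite P" using cont_opD[OF assms(1)] by (simp add: P_def)
  have "\<forall>d. \<exists>k. \<forall>b\<in>kideal k. \<forall>c. kmul d b = Some c \<longrightarrow> c \<in> kideal n"
    using kideal_mult_left by blast
  then obtain k where k: "\<And>d b c. b \<in> kideal (k d) \<Longrightarrow> kmul d b = Some c \<Longrightarrow> c \<in> kideal n"
    by metis
  have "\<forall>y n. \<exists>N. \<forall>a\<in>kideal N. \<forall>x b. F a x (y, b) \<noteq> 0 \<longrightarrow> b \<in> kideal n"
    using assms(2) by (simp add: unif_op_def)
  then obtain N where N: "\<And>y n a x b. a \<in> kideal (N y n) \<Longrightarrow> F a x (y, b) \<noteq> 0 \<Longrightarrow> b \<in> kideal n"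
    by metis
  define M where "M = Max (insert 0 ((\<lambda>(y, d). N y (k d)) ` P))"
  have M: "kideal M \<subseteq> kideal (N y (k d))" if "(y, d) \<in> P" for y d
    using that P by (intro kideal_antimono) (auto simp: M_def intro!: Max_ge)
  have "c \<in> kideal n" if a: "a \<in> kideal M" and nz: "(G \<odot> F a) x (z, c) \<noteq> 0" for a x c
  proof -
    from nz obtain y b d where *: "F a x (y, b) \<noteq> 0" "G y (z, d) \<noteq> 0" "kmul d b = Some c"
      by (rule cmp_nonzeroE)
    show ?thesis
    proof (cases "d \<in> kideal n")
      case True
      with * show ?thesis using kideal_mult_right by blast
    next
      case False
      with * have "(y, d) \<in> P" by (simp add: P_def)
      with M a have "a \<in> kideal (N y (k d))" by blast
      with N * k show ?thesis by blast
    qed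
  qed
  then show "\<exists>N. \<forall>a\<in>kideal N. \<forall>x b. (G \<odot> F a) x (z, b) \<noteq> 0 \<longrightarrow> b \<in> kideal n" by blast
qed

lemma unif_op_cmp_right:
  assumes "unif_op F"
  shows "unif_op (\<lambda>a. F a \<odot> G)"
  unfolding unif_op_def
proof (intro allI)
  fix z n
  from assms obtain N where N: "\<And>a y d. a \<in> kideal N \<Longrightarrow> F a y (z, d) \<noteq> 0 \<Longrightarrow> d \<in> kideal n"
    unfolding unif_op_def by metis
  show "\<exists>N. \<forall>a\<in>kideal N. \<forall>x b. (F a \<odot> G) x (z, b) \<noteq> 0 \<longrightarrow> b \<in> kideal n"
    by (intro exI[of _ N] ballI allI impI) (metis N cmp_nonzeroE kideal_mult_right)
qed

definition lpres :: "('x \<Rightarrow> idem) \<Rightarrow> ('y \<Rightarrow> idem) \<Rightarrow> ('x, 'y) op \<Rightarrow> bool" where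
  "lpres l l' F \<longleftrightarrow> (\<forall>x y b. F x (y, b) \<noteq> 0 \<longrightarrow> l' y = l x)"

lemma lpres_cmp: "lpres l l' F \<Longrightarrow> lpres l' l'' G \<Longrightarrow> lpres l l'' (G \<odot> F)"
  unfolding lpres_def by (metis cmp_nonzeroE)

lemma lpres_add: "lpres l l' F \<Longrightarrow> lpres l l' G \<Longrightarrow> lpres l l' (F + G)"
  unfolding lpres_def by (metis add_0 plus_fun_apply)

text \<open>Supplies continuity and typing of the one-input terms p m h and h m i of the transferred
  morphisms.\<close>

lemma op_map_sandwich:
  assumes m: "op_map B l r B l r d m"
    and F: "khom C s B r F" "lpres k l F" and G: "khom B r C' s' G" "lpres l k' G"
    and H: "khom C s C' s' H" "lpres k k' H"
  shows "op_map C k s C' k' s' H (\<lambda>a. G \<odot> (m a \<odot> F))"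
  unfolding op_map_def
proof (intro conjI allI impI)
  have ma: "khom B r B r (m a)" for a using m by (simp add: op_map_def)
  show "khom C s C' s' (G \<odot> (m a \<odot> F))" for a
    by (intro khom_cmp[of C s B r] khom_cmp[OF F(1) ma] G(1))
  have "unif_op m" using m by (simp add: op_map_def)
  then show "unif_op (\<lambda>a. G \<odot> (m a \<odot> F))"
    using G by (intro unif_op_cmp_left unif_op_cmp_right) auto
  have "krid a = k x \<and> klid a = k' y" if "(G \<odot> (m a \<odot> F)) x (y, b) \<noteq> 0" for a x y b
  proof -
    from that obtain v b1 b2 where v: "(m a \<odot> F) x (v, b1) \<noteq> 0" "G v (y, b2) \<noteq> 0" by (rule cmp_nonzeroE)
    from v(1) obtain u c1 c2 where u: "F x (u, c1) \<noteq> 0" "m a u (v, c2) \<noteq> 0" by (rule cmp_nonzeroE)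
    have "krid a = l u \<and> klid a = l v" using m u(2) unfolding op_map_def by blast
    moreover have "l u = k x" "k' y = l v" using F(2) G(2) u v unfolding lpres_def by blast+
    ultimately show ?thesis by simp
  qed
  then show "krid a = k x" "klid a = k' y" if "(G \<odot> (m a \<odot> F)) x (y, b) \<noteq> 0" for a x y b
    using that by blast+
qed (use H in \<open>auto simp: lpres_def\<close>)

lemma op_map_no_input:
  assumes "khom B r B' r' F" "lpres l l' F"
  shows "op_map B l r B' l' r' F (\<lambda>_. 0)"
  using assms by (auto simp: op_map_def lpres_def unif_op_def)

lemma cmp_restrict:
  "(G \<odot> (\<lambda>x t. if P x then F x t else 0)) = (\<lambda>x t. if P x then (G \<odot> F) x t else 0)"
  by (auto simp: fun_eq_iff cmp_apply)

text \<open>The unit acts as the projection to left idempotent \<open>e\<close>, so p m(1) h and h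
  m(1) i reduce to restrictions of p h and h i. This is how the side conditions give strict
  unitality.\<close>

lemma one_cmp:
  assumes sb: "strict_bimodule B l r d m" and F: "khom C s B r F" "lpres k l F"
  shows "m (kone e) \<odot> F = (\<lambda>x t. if k x = e then F x t else 0)"
proof (rule ext, rule ext, clarify)
  fix x z c
  have one: "m (kone e) y t = of_bool (y \<in> B \<and> l y = e \<and> t = (y, kone (r y)))" for y t
    using sb unfolding strict_bimodule_def by blast
  have k: "l z = k x" if "F x (z, b) \<noteq> 0" for b using F(2) that by (auto simp: lpres_def)
  have "(m (kone e) \<odot> F) x (z, c) =
      Sum_any (\<lambda>t. if t = (z, c, kone (r z)) then if k x = e then F x (z, c) else 0 else 0)"
    unfolding cmp_apply
    by (rule Sum_any.cong)
       (use khomD[OF F(1), of x z] k in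
         \<open>cases "F x (z, c)"; auto simp: one kmul_kone_left split: if_splits\<close>)
  then show "(m (kone e) \<odot> F) x (z, c) = (if k x = e then F x (z, c) else 0)" by simp
qed

lemma DA_morphism_maps:
  assumes X: "da_space X = cofinite_space B" and Y: "da_space Y = cofinite_space B'"
    and F: "op_map B (lid X) (rid X) B' (lid Y) (rid Y) F0 F1"
    and one: "\<And>e. F1 (kone e) = 0"
  shows "DA_morphism X Y (maps F0 F1)"
  unfolding DA_morphism_def
proof (intro conjI allI impI DA_multimap_maps[OF X Y F])
  fix as x t assume "\<exists>e. kone e \<in> set as"
  then show "maps F0 F1 as x t = 0"
    by (cases as rule: input_cases) (auto simp: one)
qed

section \<open>Transfer of a strict action to a deformation retract\<close>

lemma homotopy_cmp_left:
  assumes hom: "khom B r B r d" "khom B r B r h" "khom B' r' B r i" "khom B r B' r' p"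
    and homotopy: "h \<odot> d + d \<odot> h = id_op B r + i \<odot> p" and F: "khom C s B r F"
  shows "d \<odot> h \<odot> F = F + i \<odot> p \<odot> F + h \<odot> d \<odot> F"
proof -
  note [simp] = khom_cont[OF hom(1)] khom_cont[OF hom(2)] khom_cont[OF hom(3)] khom_cont[OF hom(4)]
    khom_cont[OF F] khom_cont[OF khom_id] cont_op_cmp
  have "(h \<odot> d + d \<odot> h) \<odot> F = (id_op B r + i \<odot> p) \<odot> F" by (simp only: homotopy)
  then have "h \<odot> d \<odot> F + d \<odot> h \<odot> F = F + i \<odot> p \<odot> F"
    by (simp add: cmp_add_left cmp_assoc id_cmp[OF F])
  then have "h \<odot> d \<odot> F + (h \<odot> d \<odot> F + d \<odot> h \<odot> F) = h \<odot> d \<odot> F + (F + i \<odot> p \<odot> F)"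
    by simp
  then show ?thesis by (simp add: add_ac)
qed

lemma homotopy_cmp_right:
  assumes hom: "khom B r B r d" "khom B r B r h" "khom B' r' B r i" "khom B r B' r' p"
    and homotopy: "h \<odot> d + d \<odot> h = id_op B r + i \<odot> p" and G: "khom B r C s G"
  shows "G \<odot> h \<odot> d = G + G \<odot> i \<odot> p + G \<odot> d \<odot> h"
proof -
  note [simp] = khom_cont[OF hom(1)] khom_cont[OF hom(2)] khom_cont[OF hom(3)] khom_cont[OF hom(4)]
    khom_cont[OF G] khom_cont[OF khom_id] cont_op_cmp
  have "G \<odot> (h \<odot> d + d \<odot> h) = G \<odot> (id_op B r + i \<odot> p)" by (simp only: homotopy)
  then have "G \<odot> h \<odot> d + G \<odot> d \<odot> h = G + G \<odot> i \<odot> p"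
    by (simp add: cmp_add_right cmp_assoc cmp_id[OF G])
  then have "G \<odot> d \<odot> h + (G \<odot> h \<odot> d + G \<odot> d \<odot> h) = G \<odot> d \<odot> h + (G + G \<odot> i \<odot> p)"
    by simp
  then show ?thesis by (simp add: add_ac)
qed

text \<open>A deformation retract with the usual side conditions. The transferred operations are p m
  h m ... h m i: those with two or more \<open>h\<close> contain h m h, the one with a single
  \<open>h\<close> vanishes by \<open>pmhmi\<close>, and p m i is the strict action
  \<open>\<mu>\<close>.\<close>

locale retraction =
  fixes B :: "'x set" and l r :: "'x \<Rightarrow> idem" and d m
    and B' :: "'y set" and l' r' :: "'y \<Rightarrow> idem" and \<mu> and i p h
  assumes X: "strict_bimodule B l r d m" and Y: "strict_bimodule B' l' r' 0 \<mu>"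
    and i: "khom B' r' B r i" "lpres l' l i"
    and p: "khom B r B' r' p" "lpres l l' p"
    and h: "khom B r B r h" "lpres l l h"
    and di: "d \<odot> i = 0" and pd: "p \<odot> d = 0" and pi: "p \<odot> i = id_op B' r'"
    and homotopy: "h \<odot> d + d \<odot> h = id_op B r + i \<odot> p"
    and hh: "h \<odot> h = 0" and hi: "h \<odot> i = 0" and ph: "p \<odot> h = 0"
    and hmh: "\<And>a. h \<odot> m a \<odot> h = 0"
    and pmi: "\<And>a. p \<odot> m a \<odot> i = \<mu> a"
    and pmhmi: "\<And>a b. p \<odot> m a \<odot> h \<odot> m b \<odot> i = 0"
begin

lemma d: "khom B r B r d" and m: "khom B r B r (m a)" and dm: "m a \<odot> d = d \<odot> m a"
  and mult: "m a \<odot> m b = (case kmul a b of None \<Rightarrow> 0 | Some c \<Rightarrow> m c)"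
  and X_op: "op_map B l r B l r d m"
  using X by (auto simp: strict_bimodule_def op_map_def)

lemma \<mu>: "khom B' r' B' r' (\<mu> a)" and Y_op: "op_map B' l' r' B' l' r' 0 \<mu>"
  using Y by (auto simp: strict_bimodule_def op_map_def)

lemmas cont [simp] = khom_cont[OF d] khom_cont[OF m] khom_cont[OF \<mu>] khom_cont[OF i(1)]
  khom_cont[OF p(1)] khom_cont[OF h(1)] cont_op_cmp cont_op_add

lemmas dh = homotopy_cmp_left[OF d h(1) i(1) p(1) homotopy]
lemmas hd = homotopy_cmp_right[OF d h(1) i(1) p(1) homotopy]

text \<open>Evaluate h d m(a) h in two ways. Moving \<open>d\<close> right past m(a) and using the
  homotopy gives h m(a) + h m(a) i p; moving \<open>d\<close> left past \<open>h\<close> gives m(a)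
  h + i p m(a) h. The leftover terms contain h m h.\<close>

lemma hm: "h \<odot> m a = m a \<odot> h + i \<odot> p \<odot> m a \<odot> h + h \<odot> m a \<odot> i \<odot> p"
proof -
  have "h \<odot> d \<odot> m a \<odot> h = h \<odot> (m a \<odot> d) \<odot> h"
    unfolding dm by (simp add: cmp_assoc)
  moreover have "m a \<odot> d \<odot> h = m a + m a \<odot> i \<odot> p + m a \<odot> h \<odot> d"
    using hd[OF m[of a]] by (simp add: add_ac)
  moreover have "h \<odot> m a \<odot> h \<odot> d = (h \<odot> m a \<odot> h) \<odot> d"
    by (simp add: cmp_assoc)
  ultimately have "h \<odot> d \<odot> m a \<odot> h = h \<odot> m a + h \<odot> m a \<odot> i \<odot> p"
    by (simp add: cmp_add_right cmp_assoc hmh)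
  with dh[OF khom_cmp[OF h(1) m[of a]]]
  have "0 = m a \<odot> h + i \<odot> p \<odot> m a \<odot> h + (h \<odot> m a + h \<odot> m a \<odot> i \<odot> p)"
    by (simp add: hmh)
  then have "h \<odot> m a + 0 = h \<odot> m a + (m a \<odot> h + i \<odot> p \<odot> m a \<odot> h + (h \<odot> m a + h \<odot> m a \<odot> i \<odot> p))"
    by simp
  then show ?thesis by (simp add: add_ac)
qed

text \<open>\<open>f2\<close> and \<open>g2\<close> are the one-input terms of the transferred
  morphisms. The next ones, p m h m h and h m h m i, contain h m h and vanish.\<close>

definition f2 :: "kmon \<Rightarrow> ('x, 'y) op" where "f2 a = p \<odot> m a \<odot> h"
definition g2 :: "kmon \<Rightarrow> ('y, 'x) op" where "g2 a = h \<odot> m a \<odot> i"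

lemma f_eq1: "\<mu> a \<odot> p + p \<odot> m a + f2 a \<odot> d = 0"
proof -
  have "f2 a \<odot> d = (p \<odot> m a) \<odot> h \<odot> d" by (simp add: f2_def cmp_assoc)
  moreover have "(p \<odot> m a) \<odot> h \<odot> d = p \<odot> m a + (p \<odot> m a) \<odot> i \<odot> p + (p \<odot> m a) \<odot> d \<odot> h"
    by (rule hd[OF khom_cmp[OF m p(1)]])
  moreover have "(p \<odot> m a) \<odot> i \<odot> p = \<mu> a \<odot> p"
    by (simp add: cmp_assoc flip: pmi)
  moreover have "(p \<odot> m a) \<odot> d \<odot> h = p \<odot> (m a \<odot> d) \<odot> h"
    by (simp add: cmp_assoc)
  moreover have "p \<odot> (d \<odot> m a) \<odot> h = (p \<odot> d) \<odot> m a \<odot> h"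
    by (simp add: cmp_assoc)
  ultimately show ?thesis by (simp add: pd dm add_ac)
qed

text \<open>Push \<open>h\<close> past m(b) with \<open>hm\<close>. Of the three resulting terms,
  one is \<open>f2\<close> of the product, one is \<open>\<mu>\<close> after \<open>f2\<close>, and
  the last dies by \<open>pmhmi\<close>.\<close>

lemma f_eq2: "\<mu> a \<odot> f2 b + f2 a \<odot> m b + (case kmul a b of None \<Rightarrow> 0 | Some c \<Rightarrow> f2 c) = 0"
proof -
  have "f2 a \<odot> m b = p \<odot> m a \<odot> (h \<odot> m b)" by (simp add: f2_def cmp_assoc)
  moreover have "\<dots> = p \<odot> m a \<odot> m b \<odot> h + p \<odot> m a \<odot> i \<odot> p \<odot> m b \<odot> h +
      p \<odot> m a \<odot> h \<odot> m b \<odot> i \<odot> p"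
    by (subst hm) (simp add: cmp_add_right)
  moreover have "p \<odot> m a \<odot> h \<odot> m b \<odot> i \<odot> p = (p \<odot> m a \<odot> h \<odot> m b \<odot> i) \<odot> p"
    by (simp add: cmp_assoc)
  moreover have "p \<odot> m a \<odot> i \<odot> p \<odot> m b \<odot> h = \<mu> a \<odot> f2 b"
    by (simp add: f2_def cmp_assoc flip: pmi)
  moreover have "p \<odot> m a \<odot> m b \<odot> h = p \<odot> (m a \<odot> m b) \<odot> h"
    by (simp add: cmp_assoc)
  moreover have "\<dots> = (case kmul a b of None \<Rightarrow> 0 | Some c \<Rightarrow> f2 c)"
    unfolding mult f2_def by (simp split: option.split)
  ultimately show ?thesis by (simp only: pmhmi cmp_zero) (simp add: add_ac)
qed

lemma g_eq1: "d \<odot> g2 a + m a \<odot> i + i \<odot> \<mu> a = 0"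
proof -
  have "d \<odot> g2 a = m a \<odot> i + i \<odot> p \<odot> m a \<odot> i + h \<odot> d \<odot> m a \<odot> i"
    unfolding g2_def by (rule dh[OF khom_cmp[OF i(1) m]])
  moreover have "h \<odot> d \<odot> m a \<odot> i = h \<odot> (d \<odot> m a) \<odot> i"
    by (simp add: cmp_assoc)
  moreover have "h \<odot> (m a \<odot> d) \<odot> i = h \<odot> m a \<odot> (d \<odot> i)"
    by (simp add: cmp_assoc)
  ultimately show ?thesis by (simp only: di pmi cmp_zero flip: dm) (simp add: add_ac)
qed

lemma g_eq2: "m a \<odot> g2 b + g2 a \<odot> \<mu> b + (case kmul a b of None \<Rightarrow> 0 | Some c \<Rightarrow> g2 c) = 0"
proof -
  have "(case kmul a b of None \<Rightarrow> 0 | Some c \<Rightarrow> g2 c) = h \<odot> (m a \<odot> m b) \<odot> i"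
    unfolding mult g2_def by (simp split: option.split)
  moreover have "\<dots> = (h \<odot> m a) \<odot> m b \<odot> i" by (simp add: cmp_assoc)
  moreover have "\<dots> = m a \<odot> h \<odot> m b \<odot> i + i \<odot> p \<odot> m a \<odot> h \<odot> m b \<odot> i + h \<odot> m a \<odot> i \<odot> p \<odot> m b \<odot> i"
    by (subst hm) (simp add: cmp_add_left cmp_assoc)
  ultimately show ?thesis by (simp add: pmhmi pmi g2_def cmp_assoc add_ac)
qed

text \<open>The homotopy \<open>h\<close> takes no algebra input, so the two-input part of the
  composite has to vanish by itself. Trading i p m h for m h + h d m h turns h m i p m h into a term
  h m(ab) h and a term beginning with h m h.\<close>

lemma gf_eq2: "g2 a \<odot> f2 b = 0"
proof -
  have ip: "i \<odot> p \<odot> m b \<odot> h = m b \<odot> h + h \<odot> d \<odot> m b \<odot> h"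
  proof -
    have "0 = m b \<odot> h + i \<odot> p \<odot> m b \<odot> h + h \<odot> d \<odot> m b \<odot> h"
      using dh[OF khom_cmp[OF h(1) m[of b]]] by (simp add: hmh)
    then have "i \<odot> p \<odot> m b \<odot> h + 0 =
        i \<odot> p \<odot> m b \<odot> h + (m b \<odot> h + i \<odot> p \<odot> m b \<odot> h + h \<odot> d \<odot> m b \<odot> h)" by simp
    then show ?thesis by (simp add: add_ac)
  qed
  have "g2 a \<odot> f2 b = h \<odot> m a \<odot> (i \<odot> p \<odot> m b \<odot> h)"
    by (simp add: g2_def f2_def cmp_assoc)
  also have "\<dots> = h \<odot> (m a \<odot> m b) \<odot> h + (h \<odot> m a \<odot> h) \<odot> d \<odot> m b \<odot> h"
    unfolding ip by (simp add: cmp_add_right cmp_assoc)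
  also have "\<dots> = 0"
    unfolding mult hmh by (simp add: hmh split: option.split)
  finally show ?thesis .
qed

lemma fg_eq: "p \<odot> g2 a + f2 a \<odot> i = 0" "f2 a \<odot> g2 b = 0"
proof -
  have "p \<odot> g2 a = (p \<odot> h) \<odot> m a \<odot> i" "f2 a \<odot> i = p \<odot> m a \<odot> (h \<odot> i)"
    "f2 a \<odot> g2 b = p \<odot> m a \<odot> (h \<odot> h) \<odot> m b \<odot> i"
    by (simp_all add: f2_def g2_def cmp_assoc)
  then show "p \<odot> g2 a + f2 a \<odot> i = 0" "f2 a \<odot> g2 b = 0" by (simp_all add: ph hi hh)
qed

lemma unital: "f2 (kone e) = 0" "g2 (kone e) = 0"
  unfolding f2_def g2_def one_cmp[OF X h] one_cmp[OF X i] cmp_restrict ph hi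
  by (simp_all add: fun_eq_iff)

text \<open>\<open>h\<close> alone is the homotopy on the large side. On the small side the
  composite equals the identity, so the zero homotopy serves.\<close>

theorem equivalent:
  assumes XX: "da_space XX = cofinite_space B" "lid XX = l" "rid XX = r" "delta XX = maps d m"
    and YY: "da_space YY = cofinite_space B'" "lid YY = l'" "rid YY = r'" "delta YY = maps 0 \<mu>"
  shows "DA_homotopy_equivalent XX YY"
proof -
  have X1: "type_DA XX" and Y1: "type_DA YY"
    using type_DA_maps[OF XX(1,4)] type_DA_maps[OF YY(1,4)] X Y by (simp_all add: XX YY)
  have f: "DA_morphism XX YY (maps p f2)"
    using op_map_sandwich[OF X_op h p p] unital
    by (intro DA_morphism_maps[OF XX(1) YY(1)]) (simp_all add: XX YY flip: f2_def)
  have g: "DA_morphism YY XX (maps i g2)"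
    using op_map_sandwich[OF X_op i h i] unital
    by (intro DA_morphism_maps[OF YY(1) XX(1)]) (simp_all add: XX YY flip: g2_def)
  have h': "DA_morphism XX XX (maps h (\<lambda>_. 0))"
    using op_map_no_input[OF h] by (intro DA_morphism_maps[OF XX(1) XX(1)]) (simp_all add: XX)
  have 0: "DA_morphism YY YY (maps 0 (\<lambda>_. 0))"
    using op_map_no_input[of B' r' B' r' 0 l' l']
    by (intro DA_morphism_maps[OF YY(1) YY(1)]) (simp_all add: YY lpres_def)
  have zero: "da_comp (maps 0 (\<lambda>_. 0)) (maps 0 (\<lambda>_. 0)) as x t + maps 0 (\<lambda>_. 0) as x t = 0"
    for as :: "kmon list" and x :: 'u and t :: "'v \<times> kmon"
    by (cases as rule: input_cases) (simp_all add: da_comp_maps)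
  have id: "DA_id Z = maps (id_op C s) (\<lambda>_. 0)" if "da_space Z = cofinite_space C" "rid Z = s" for Z C s
    using that by (auto simp: DA_id_def id_op_def maps_def fun_eq_iff split: list.split)
  have "\<forall>as x t. DA_diff XX YY (maps p f2) as x t = 0"
    using DA_diff_maps[OF XX(4) YY(4), of p f2 0 "\<lambda>_. 0" 0 "\<lambda>_. 0" 0]
    unfolding zero by (simp add: pd f_eq1 f_eq2)
  moreover have "\<forall>as x t. DA_diff YY XX (maps i g2) as x t = 0"
    using DA_diff_maps[OF YY(4) XX(4), of i g2 0 "\<lambda>_. 0" 0 "\<lambda>_. 0" 0]
    unfolding zero by (simp add: di g_eq1 g_eq2)
  moreover have "\<forall>as x t. DA_diff XX XX (maps h (\<lambda>_. 0)) as x t =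
      da_comp (maps i g2) (maps p f2) as x t + maps (id_op B r) (\<lambda>_. 0) as x t"
  proof (subst DA_diff_maps[OF XX(4) XX(4)], intro conjI allI)
    show "d \<odot> h + h \<odot> d = i \<odot> p + id_op B r" using homotopy by (simp add: add_ac)
    show "d \<odot> 0 + m a \<odot> h + h \<odot> m a + 0 \<odot> d = i \<odot> f2 a + g2 a \<odot> p" for a
      by (subst hm) (simp add: f2_def g2_def cmp_assoc add_ac)
  qed (simp add: gf_eq2 split: option.split)
  moreover have "\<forall>as x t. DA_diff YY YY (maps 0 (\<lambda>_. 0)) as x t =
      da_comp (maps p f2) (maps i g2) as x t + maps (id_op B' r') (\<lambda>_. 0) as x t"
    by (subst DA_diff_maps[OF YY(4) YY(4)]) (simp add: fg_eq pi split: option.split)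
  ultimately show ?thesis
    unfolding DA_homotopy_equivalent_def DA_homomorphism_def DA_homotopic_def
    using X1 Y1 f g h' 0 id[OF XX(1,3)] id[OF YY(1,3)] by metis
qed

end

text \<open>The perturbation lemma for d1 + d2 with its series cut off: by \<open>hd2h\<close> the
  contraction stays \<open>h\<close>, and by \<open>pd2i\<close> and \<open>d2hd2\<close> the
  transferred differential is 0. The remaining candidate in \<open>pmi\<close>, p d2 h m h d2 i, is
  absent because it contains h m h.\<close>

locale perturbation =
  fixes B :: "'x set" and l r :: "'x \<Rightarrow> idem" and d1 d2 m
    and B' :: "'y set" and l' r' :: "'y \<Rightarrow> idem" and \<mu> and i p h
  assumes X: "strict_bimodule B l r (d1 + d2) m" and Y: "strict_bimodule B' l' r' 0 \<mu>"
    and d1: "khom B r B r d1"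
    and d2: "khom B r B r d2" "lpres l l d2"
    and i: "khom B' r' B r i" "lpres l' l i"
    and p: "khom B r B' r' p" "lpres l l' p"
    and h: "khom B r B r h" "lpres l l h"
    and d12: "d1 \<odot> d2 = d2 \<odot> d1" and d22: "d2 \<odot> d2 = 0"
    and di: "d1 \<odot> i = 0" and pd: "p \<odot> d1 = 0" and pi: "p \<odot> i = id_op B' r'"
    and homotopy: "h \<odot> d1 + d1 \<odot> h = id_op B r + i \<odot> p"
    and hh: "h \<odot> h = 0" and hi: "h \<odot> i = 0" and ph: "p \<odot> h = 0"
    and hd2h: "h \<odot> d2 \<odot> h = 0" and d2hd2: "d2 \<odot> h \<odot> d2 = 0" and pd2i: "p \<odot> d2 \<odot> i = 0"
    and hmh: "\<And>a. h \<odot> m a \<odot> h = 0"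
    and pmi: "\<And>a. p \<odot> m a \<odot> i + p \<odot> m a \<odot> h \<odot> d2 \<odot> i + (p \<odot> d2 \<odot> h) \<odot> m a \<odot> i = \<mu> a"
    and pmhmi: "\<And>a b. p \<odot> m a \<odot> h \<odot> m b \<odot> i = 0"
begin

lemma m: "khom B r B r (m a)"
  using X by (auto simp: strict_bimodule_def op_map_def)

lemmas cont [simp] = khom_cont[OF d1] khom_cont[OF d2(1)] khom_cont[OF m] khom_cont[OF i(1)]
  khom_cont[OF p(1)] khom_cont[OF h(1)] khom_cont[OF khom_id] cont_op_cmp cont_op_add

lemma zero_left:
  assumes "G \<odot> F = 0" "cont_op G" "cont_op F" "cont_op H"
  shows "G \<odot> F \<odot> H = 0"
  using assms by (metis cmp_assoc cmp_zero(1))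

lemma zero_left3:
  assumes "G \<odot> F \<odot> E = 0" "cont_op G" "cont_op F" "cont_op E" "cont_op H"
  shows "G \<odot> F \<odot> E \<odot> H = 0"
  using assms by (metis cmp_assoc cmp_zero(1) cont_op_cmp)

lemmas zeros = di pd hh hi ph hd2h d2hd2 pd2i d22 hmh zero_left[OF di] zero_left[OF pd]
  zero_left[OF hh] zero_left[OF hi] zero_left[OF ph] zero_left[OF d22]
  zero_left3[OF hd2h] zero_left3[OF d2hd2] zero_left3[OF pd2i] zero_left3[OF hmh]

lemmas d1h = homotopy_cmp_left[OF d1 h(1) i(1) p(1) homotopy]
lemmas hd1 = homotopy_cmp_right[OF d1 h(1) i(1) p(1) homotopy]

definition i' where "i' = i + h \<odot> d2 \<odot> i"
definition p' where "p' = p + p \<odot> d2 \<odot> h"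

text \<open>The computation behind a commutator of \<open>h\<close> with the action, with
  \<open>d2\<close> in place of the action and \<open>d1\<close> as the differential.\<close>

lemma hd2: "h \<odot> d2 + d2 \<odot> h = i \<odot> p \<odot> d2 \<odot> h + h \<odot> d2 \<odot> i \<odot> p"
proof -
  have "(h \<odot> d2) \<odot> h \<odot> d1 = h \<odot> d2 + (h \<odot> d2) \<odot> i \<odot> p + (h \<odot> d2) \<odot> d1 \<odot> h"
    by (rule hd1[OF khom_cmp[OF d2(1) h(1)]])
  moreover have "(h \<odot> d2) \<odot> d1 \<odot> h = h \<odot> (d1 \<odot> d2) \<odot> h"
    unfolding d12 by (simp add: cmp_assoc)
  moreover have "d1 \<odot> h \<odot> d2 \<odot> h = d2 \<odot> h + i \<odot> p \<odot> d2 \<odot> h + h \<odot> d1 \<odot> d2 \<odot> h"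
    by (rule d1h[OF khom_cmp[OF h(1) d2(1)]])
  ultimately have "h \<odot> d1 \<odot> d2 \<odot> h + (h \<odot> d2 + h \<odot> d2 \<odot> i \<odot> p) = 0"
      "h \<odot> d1 \<odot> d2 \<odot> h + (d2 \<odot> h + i \<odot> p \<odot> d2 \<odot> h) = 0"
    by (simp_all add: cmp_assoc zeros add_ac)
  then have "h \<odot> d2 + h \<odot> d2 \<odot> i \<odot> p = d2 \<odot> h + i \<odot> p \<odot> d2 \<odot> h"
    by (simp add: op_add_eq_0_iff)
  then have "(h \<odot> d2 + h \<odot> d2 \<odot> i \<odot> p) + (d2 \<odot> h + h \<odot> d2 \<odot> i \<odot> p) =
      (d2 \<odot> h + i \<odot> p \<odot> d2 \<odot> h) + (d2 \<odot> h + h \<odot> d2 \<odot> i \<odot> p)"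
    by simp
  then show ?thesis by (simp add: add_ac)
qed

lemma retraction: "retraction B l r (d1 + d2) m B' l' r' \<mu> i' p' h"
proof
  show "khom B' r' B r i'" "lpres l' l i'" "khom B r B' r' p'" "lpres l l' p'"
    unfolding i'_def p'_def
    by (intro khom_add khom_cmp[of _ _ B r] lpres_add lpres_cmp[of _ l] i p h d2)+
  show "(d1 + d2) \<odot> i' = 0"
  proof -
    have "d1 \<odot> h \<odot> d2 \<odot> i = d2 \<odot> i + i \<odot> p \<odot> d2 \<odot> i + h \<odot> d1 \<odot> d2 \<odot> i"
      by (rule d1h[OF khom_cmp[OF i(1) d2(1)]])
    moreover have "h \<odot> d1 \<odot> d2 \<odot> i = h \<odot> (d2 \<odot> d1) \<odot> i"
      unfolding d12[symmetric] by (simp add: cmp_assoc)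
    ultimately show ?thesis
      by (simp add: i'_def cmp_add_left cmp_add_right cmp_assoc zeros)
  qed
  show "p' \<odot> (d1 + d2) = 0"
  proof -
    have "(p \<odot> d2) \<odot> h \<odot> d1 = p \<odot> d2 + (p \<odot> d2) \<odot> i \<odot> p + (p \<odot> d2) \<odot> d1 \<odot> h"
      by (rule hd1[OF khom_cmp[OF d2(1) p(1)]])
    moreover have "(p \<odot> d2) \<odot> d1 \<odot> h = p \<odot> (d1 \<odot> d2) \<odot> h"
      unfolding d12 by (simp add: cmp_assoc)
    ultimately show ?thesis
      by (simp add: p'_def cmp_add_left cmp_add_right cmp_assoc zeros)
  qed
  show "p' \<odot> i' = id_op B' r'"
    by (simp add: p'_def i'_def cmp_add_left cmp_add_right cmp_assoc zeros pi)
  \<comment> \<open>The only term of i' p' quadratic in \<open>d2\<close>. The homotopy identity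
    rewrites i p d2 h as d2 h + h d1 d2 h, and composing with h d2 kills the two summands by d2 d2 =
    0 and h d2 h = 0.\<close>
  have vanish: "h \<odot> d2 \<odot> i \<odot> p \<odot> d2 \<odot> h = 0"
  proof -
    have "d1 \<odot> h \<odot> d2 \<odot> h = d2 \<odot> h + i \<odot> p \<odot> d2 \<odot> h + h \<odot> d1 \<odot> d2 \<odot> h"
      by (rule d1h[OF khom_cmp[OF h(1) d2(1)]])
    then have "i \<odot> p \<odot> d2 \<odot> h + 0 = i \<odot> p \<odot> d2 \<odot> h +
        (d2 \<odot> h + i \<odot> p \<odot> d2 \<odot> h + h \<odot> d1 \<odot> d2 \<odot> h)" by (simp add: zeros)
    then have "i \<odot> p \<odot> d2 \<odot> h = d2 \<odot> h + h \<odot> d1 \<odot> d2 \<odot> h" by (simp add: add_ac)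
    then show ?thesis by (simp add: cmp_add_right zeros)
  qed
  show "h \<odot> (d1 + d2) + (d1 + d2) \<odot> h = id_op B r + i' \<odot> p'"
  proof -
    have "h \<odot> (d1 + d2) + (d1 + d2) \<odot> h = (h \<odot> d1 + d1 \<odot> h) + (h \<odot> d2 + d2 \<odot> h)"
      by (simp only: cmp_add_left cmp_add_right cont add_ac)
    also have "\<dots> = id_op B r + i' \<odot> p'"
      unfolding homotopy hd2
      by (simp add: p'_def i'_def cmp_add_left cmp_add_right cmp_assoc vanish add_ac)
    finally show ?thesis .
  qed
  show "h \<odot> i' = 0" "p' \<odot> h = 0"
    by (simp_all add: p'_def i'_def cmp_add_left cmp_add_right cmp_assoc zeros)
  show "p' \<odot> m a \<odot> i' = \<mu> a" for a
    using pmi[of a] by (simp add: p'_def i'_def cmp_add_left cmp_add_right cmp_assoc zeros add_ac)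
  show "p' \<odot> m a \<odot> h \<odot> m b \<odot> i' = 0" for a b
    by (simp add: p'_def i'_def cmp_add_left cmp_add_right cmp_assoc zeros pmhmi)
qed (rule X Y h hh hmh)+

end

section \<open>Single-valued operators\<close>

definition op_of :: "('x \<Rightarrow> ('y \<times> kmon) option) \<Rightarrow> ('x, 'y) op" where
  "op_of f x t = of_bool (f x = Some t)"

lemma op_of_nz [simp]: "op_of f x t = 1 \<longleftrightarrow> f x = Some t" "op_of f x t = 0 \<longleftrightarrow> f x \<noteq> Some t"
  by (simp_all add: op_of_def)

definition pcomp :: "('y \<Rightarrow> ('z \<times> kmon) option) \<Rightarrow> ('x \<Rightarrow> ('y \<times> kmon) option) \<Rightarrow> 'x \<Rightarrow> ('z \<times> kmon) option" where
  "pcomp g f x = Option.bind (f x) (\<lambda>(y, b). Option.bind (g y) (\<lambda>(z, d). map_option (Pair z) (kmul d b)))"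

lemma cmp_single:
  assumes "\<And>y b d. F x (y, b) \<noteq> 0 \<Longrightarrow> G y (z, d) \<noteq> 0 \<Longrightarrow> y = y0 \<and> b = b0 \<and> d = d0"
  shows "(G \<odot> F) x (z, c) = F x (y0, b0) * G y0 (z, d0) * of_bool (kmul d0 b0 = Some c)"
proof -
  have "(G \<odot> F) x (z, c) = Sum_any (\<lambda>t. if t = (y0, b0, d0)
      then F x (y0, b0) * G y0 (z, d0) * of_bool (kmul d0 b0 = Some c) else 0)"
    unfolding cmp_apply
  proof (rule Sum_any.cong, clarify)
    fix y b d
    show "F x (y, b) * G y (z, d) * of_bool (kmul d b = Some c) = (if (y, b, d) = (y0, b0, d0)
      then F x (y0, b0) * G y0 (z, d0) * of_bool (kmul d0 b0 = Some c) else 0)"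
      using assms[of y b d] by (cases "F x (y, b)"; cases "G y (z, d)") auto
  qed
  then show ?thesis by simp
qed

lemma cmp_op_of: "op_of g \<odot> op_of f = op_of (pcomp g f)"
proof (rule ext, rule ext, clarify)
  fix x z c
  show "(op_of g \<odot> op_of f) x (z, c) = op_of (pcomp g f) x (z, c)"
  proof (cases "\<exists>y b d. f x = Some (y, b) \<and> g y = Some (z, d)")
    case True
    then obtain y b d where *: "f x = Some (y, b)" "g y = Some (z, d)" by blast
    have "(op_of g \<odot> op_of f) x (z, c) = op_of f x (y, b) * op_of g y (z, d) * of_bool (kmul d b = Some c)"
      by (rule cmp_single) (use * in auto)
    then show ?thesis using * by (auto simp: pcomp_def op_of_def)
  next
    case False
    have "(op_of g \<odot> op_of f) x (z, c) = 0"
    proof (rule ccontr)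
      assume "(op_of g \<odot> op_of f) x (z, c) \<noteq> 0"
      then show False by (rule cmp_nonzeroE) (use False in auto)
    qed
    then show ?thesis using False by (auto simp: pcomp_def op_of_def split: bind_splits)
  qed
qed

definition pinj :: "('x \<Rightarrow> ('y \<times> kmon) option) \<Rightarrow> bool" where
  "pinj f \<longleftrightarrow> (\<forall>x x' y b b'. f x = Some (y, b) \<longrightarrow> f x' = Some (y, b') \<longrightarrow> x = x')"

lemma finite_if_unique: "(\<And>p q. p \<in> S \<Longrightarrow> q \<in> S \<Longrightarrow> p = q) \<Longrightarrow> finite S"
proof (cases "S = {}")
  case False
  then obtain p where "p \<in> S" by blast
  moreover assume "\<And>p q. p \<in> S \<Longrightarrow> q \<in> S \<Longrightarrow> p = q"
  ultimately have "S \<subseteq> {p}" by blast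
  then show ?thesis by (rule finite_subset) simp
qed simp

text \<open>Each target has at most one source, hence at most one entry, whatever its coefficient
  is.\<close>

lemma cont_op_of: "pinj f \<Longrightarrow> cont_op (op_of f)"
  unfolding cont_op_def by (intro allI finite_if_unique) (force simp: pinj_def)

section \<open>The Hopf link bimodule in integer coordinates\<close>

text \<open>
  \<open>(l, r, s)\<close> stands for the generator with idempotents \<open>l\<close>, \<open>r\<close> and position \<open>s\<close>: $W^s_{0r}$ for
  \<open>s \<ge> 0\<close>, $Z^{-1-s}_{00}$ or $Z^{-s}_{01}$ for \<open>s < 0\<close>, and $T^{-s}_{1r}$.
\<close>

type_synonym hgen' = "idem \<times> idem \<times> int"

fun wmon :: "idem \<Rightarrow> int \<Rightarrow> int \<Rightarrow> kmon" where
  "wmon I0 a b = WZ (nat a) (nat b)"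
| "wmon I1 a k = UT (nat a) k"

fun okexp :: "idem \<Rightarrow> int \<Rightarrow> int \<Rightarrow> bool" where
  "okexp I0 a b \<longleftrightarrow> a \<ge> 0 \<and> b \<ge> 0"
| "okexp I1 a k \<longleftrightarrow> a \<ge> 0"

lemma kmul_wmon:
  "okexp r a b \<Longrightarrow> okexp r a' b' \<Longrightarrow> kmul (wmon r a b) (wmon r a' b') = Some (wmon r (a + a') (b + b'))"
  by (cases r) (auto simp: nat_add_distrib)

lemma wmon_idem [simp]: "klid (wmon r a b) = r" "krid (wmon r a b) = r"
  by (cases r; simp)+

lemma wmon_0 [simp]: "wmon r 0 0 = kone r"
  by (cases r) auto

definition wA :: "int \<Rightarrow> int" where "wA s = max 0 (- s)"
definition wB :: "int \<Rightarrow> int" where "wB s = max 0 (- s - 1)"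

text \<open>Together with \<open>w_shift\<close> this makes the W, Z and U exponents in
  \<open>act\<close> nonnegative, so that \<open>nat\<close> in \<open>wmon\<close> truncates
  nothing and exponents add under multiplication.\<close>

lemma w_nonneg: "0 \<le> wA s" "0 \<le> wB s" "0 \<le> s + wA s" "0 \<le> s + 1 + wB s"
  by (simp_all add: wA_def wB_def)

lemma w_shift: "wA (s + int a - int b) \<le> int b + wA s" "wB (s + int a - int b) \<le> int b + wB s"
  by (simp_all add: wA_def wB_def)

text \<open>
  With $e_s$ the generators $W^s_{00}$ and $Z^{-1-s}_{00}$, the weights arise from
  $e_s = q^s W^{w_A(s)} Z^{w_B(s)}$, where $W$ acts as $q$ and $Z$ as $U q^{-1}$.
\<close>

fun act :: "kmon \<Rightarrow> hgen' \<Rightarrow> (hgen' \<times> kmon) option" where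
  "act (WZ a b) (I0, r, s) = Some ((I0, r, s + int a - int b),
     wmon r (int b + wA s - wA (s + int a - int b)) (if r = I0 then int b + wB s - wB (s + int a - int b) else 0))"
| "act (UT a k) (I1, r, s) = Some ((I1, r, s - k), wmon r (int a) (if r = I0 then int a else 0))"
| "act (UTsigma a k) (I0, r, s) = Some ((I1, r, s - k),
     wmon r (int a + s + wA s) (if r = I0 then int a + s + 1 + wB s else 0))"
| "act (UTtau a k) (I0, r, s) = Some ((I1, r, s - k),
     wmon r (int a + wA s) (if r = I0 then int a + wB s else - 1))"
| "act _ _ = None"

lemma act_typed:
  assumes "act a x = Some (y, b)"
  shows "krid a = fst x" "klid a = fst y" "krid b = fst (snd x)" "klid b = fst (snd y)"
    "fst (snd y) = fst (snd x)"
  using assms by (cases "(a, x)" rule: act.cases; auto simp: Let_def)+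

lemma act_None: "act a x = None \<longleftrightarrow> krid a \<noteq> fst x"
  by (cases "(a, x)" rule: act.cases) (auto simp: Let_def)

text \<open>The weights enter as differences between source and target, so they telescope along a
  composite, and what remains is addition of exponents.\<close>

lemma act_mult: "pcomp (act a) (act b) x = Option.bind (kmul a b) (\<lambda>c. act c x)"
proof -
  obtain l r s where x: "x = (l, r, s)" by (metis prod_cases3)
  have *: "kmul (wmon e p q) (wmon e p' q') = Some (wmon e u v)"
    if "okexp e p q" "okexp e p' q'" "u = p + p'" "v = q + q'" for e p q p' q' u v
    using kmul_wmon that by simp
  have shift: "s + (int n + int q) - (int p + int q') = s + int q - int q' + int n - int p" for n p q q'
    by simp
  show ?thesis
  proof (cases "(a, b)" rule: kmul.cases)
    case (1 n p q q')
    then show ?thesis unfolding x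
      using w_shift[of s q q'] w_shift[of "s + int q - int q'" n p] by (cases l; cases r; simp del: wmon.simps add: pcomp_def shift; intro *; simp)
  next
    case (2 n k q k')
    then show ?thesis unfolding x
      using w_nonneg[of s] by (cases l; cases r) (simp_all del: wmon.simps add: pcomp_def * add_ac)
  next
    case (3 n k q k')
    then show ?thesis unfolding x
      using w_nonneg[of s] by (cases l; cases r) (simp_all del: wmon.simps add: pcomp_def * add_ac)
  next
    case (4 n k q k')
    then show ?thesis unfolding x
      using w_nonneg[of s] by (cases l; cases r) (simp_all del: wmon.simps add: pcomp_def * add_ac)
  next
    case (5 n k q q')
    then show ?thesis unfolding x
      using w_shift[of s q q'] w_nonneg[of "s + int q - int q'"] by (cases l; cases r) (simp_all del: wmon.simps add: pcomp_def * add_ac)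
  next
    case (6 n k q q')
    then show ?thesis unfolding x
      using w_shift[of s q q'] w_nonneg[of "s + int q - int q'"] by (cases l; cases r) (simp_all del: wmon.simps add: pcomp_def * add_ac)
  qed (cases l; cases r; simp add: x pcomp_def)+
qed

lemma act_kone: "act (kone e) x = (if fst x = e then Some (x, kone (fst (snd x))) else None)"
proof -
  obtain l r s where x: "x = (l, r, s)" by (metis prod_cases3)
  show ?thesis unfolding x by (cases e; cases l; cases r) (auto simp: Let_def)
qed

lemma pinj_act: "pinj (act a)"
  unfolding pinj_def
proof (intro allI impI)
  fix x x' y b b'
  assume "act a x = Some (y, b)" "act a x' = Some (y, b')"
  then show "x = x'"
    by (cases "(a, x)" rule: act.cases; cases "(a, x')" rule: act.cases) (auto simp: Let_def)
qed

lemma wmon_in_kideal: "int n \<le> p \<Longrightarrow> wmon r p q \<in> kideal n"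
  by (cases r) (auto simp: kideal_def)

text \<open>The weights compensate for the shift of position. For W^p Z^q the first output exponent
  is at least q - |t| and, since wA(s) >= -s, also at least p - |t|; the same estimates cover the
  two exponents of \<sigma> and \<tau> monomials. A large first exponent is enough by
  \<open>wmon_in_kideal\<close>.\<close>

lemma unif_act: "\<exists>N. \<forall>a\<in>kideal N. \<forall>x b. act a x = Some (y, b) \<longrightarrow> b \<in> kideal n"
proof -
  obtain l r t where y: "y = (l, r, t)" by (metis prod_cases3)
  have "b \<in> kideal n" if a: "a \<in> kideal (n + nat \<bar>t\<bar> + 1)" and b: "act a x = Some (y, b)" for a x b
  proof (cases "(a, x)" rule: act.cases)
    case (1 p q r s)
    then have "b = wmon r (int q + wA s - wA t) (if r = I0 then int q + wB s - wB t else 0)"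
        "t = s + int p - int q"
      using b by (auto simp: y)
    moreover have "int n \<le> int q + wA s - wA (s + int p - int q)"
      using 1 a \<open>t = _\<close> by (auto simp: kideal_def wA_def)
    ultimately show ?thesis by (simp add: wmon_in_kideal)
  next
    case (3 p k r s)
    then have "b = wmon r (int p + s + wA s) (if r = I0 then int p + s + 1 + wB s else 0)" "t = s - k"
      using b by (auto simp: y)
    moreover have "int n \<le> int p + s + wA s"
      using 3 a \<open>t = _\<close> by (auto simp: kideal_def wA_def)
    ultimately show ?thesis by (simp add: wmon_in_kideal)
  next
    case (4 p k r s)
    then have "b = wmon r (int p + wA s) (if r = I0 then int p + wB s else - 1)" "t = s - k"
      using b by (auto simp: y)
    moreover have "int n \<le> int p + wA s"
      using 4 a \<open>t = _\<close> by (auto simp: kideal_def wA_def)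
    ultimately show ?thesis by (simp add: wmon_in_kideal)
  next
    case (2 p k r s)
    then have "b = wmon r (int p) (if r = I0 then int p else 0)" using b by (auto simp: y)
    moreover have "int n \<le> int p" using 2 a by (auto simp: kideal_def)
    ultimately show ?thesis by (simp add: wmon_in_kideal)
  qed (use b in simp_all)
  then show ?thesis by blast
qed

text \<open>The differential is split into its \<sigma> and \<tau> terms so that each is
  single-valued and injective. In these coordinates all generators follow one rule, except for the
  factor T on the W generators, recorded by \<open>of_bool\<close>.\<close>

fun dsigma :: "hgen' \<Rightarrow> (hgen' \<times> kmon) option" where
  "dsigma (l, I0, s) = Some ((l, I1, s), UTsigma 0 (of_bool (l = I0 \<and> s \<ge> 0)))"
| "dsigma (l, I1, s) = None"

fun dtau :: "hgen' \<Rightarrow> (hgen' \<times> kmon) option" where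
  "dtau (l, I0, s) = Some ((l, I1, s + 1), UTtau 0 (of_bool (l = I0 \<and> s \<ge> 0)))"
| "dtau (l, I1, s) = None"

lemma dsigma_act: "pcomp dsigma (act a) x = pcomp (act a) dsigma x"
  and dtau_act: "pcomp dtau (act a) x = pcomp (act a) dtau x"
proof -
  obtain l r s where x: "x = (l, r, s)" by (metis prod_cases3)
  show "pcomp dsigma (act a) x = pcomp (act a) dsigma x"
    unfolding x by (cases a; cases l; cases r) (auto simp: pcomp_def wA_def wB_def)
  show "pcomp dtau (act a) x = pcomp (act a) dtau x"
    unfolding x by (cases a; cases l; cases r) (auto simp: pcomp_def wA_def wB_def)
qed

section \<open>The box product of two Hopf link bimodules\<close>

text \<open>\<open>(l, m, r, s, j)\<close> stands for the generator \<open>(l, m, s) \<otimes> (m, r, j)\<close>.\<close>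

type_synonym xgen = "idem \<times> idem \<times> idem \<times> int \<times> int"

fun lidx :: "xgen \<Rightarrow> idem" where "lidx (l, m, r, s, j) = l"
fun midx :: "xgen \<Rightarrow> idem" where "midx (l, m, r, s, j) = m"
fun ridx :: "xgen \<Rightarrow> idem" where "ridx (l, m, r, s, j) = r"

text \<open>A map of the first factor tensored with the identity of the second: the coefficient
  emitted by \<open>f\<close> is consumed by the second factor.\<close>

fun left :: "(hgen' \<Rightarrow> (hgen' \<times> kmon) option) \<Rightarrow> xgen \<Rightarrow> (xgen \<times> kmon) option" where
  "left f (l, m, r, s, j) = Option.bind (f (l, m, s)) (\<lambda>((l', m', s'), b).
     map_option (\<lambda>((m'', r', j'), c). ((l', m', r', s', j'), c)) (act b (m, r, j)))"

fun right :: "(hgen' \<Rightarrow> (hgen' \<times> kmon) option) \<Rightarrow> xgen \<Rightarrow> (xgen \<times> kmon) option" where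
  "right f (l, m, r, s, j) =
     map_option (\<lambda>((m', r', j'), c). ((l, m, r', s, j'), c)) (f (m, r, j))"

definition typed :: "(hgen' \<Rightarrow> (hgen' \<times> kmon) option) \<Rightarrow> bool" where
  "typed f \<longleftrightarrow> (\<forall>x y b. f x = Some (y, b) \<longrightarrow> krid b = fst (snd x) \<and> klid b = fst (snd y))"

lemma typed_act: "typed (act a)" and typed_dsigma: "typed dsigma" and typed_dtau: "typed dtau"
  using act_typed[of a] unfolding typed_def
  by (simp, auto elim: dsigma.elims dtau.elims)

text \<open>By \<open>act_mult\<close>, emitting b and afterwards d affects the second factor in the
  same way as emitting d b; typing ensures that this product exists.\<close>

lemma left_left:
  assumes "typed f" "typed g"
  shows "pcomp (left g) (left f) x = left (pcomp g f) x"
proof -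
  obtain l m r s j where x: "x = (l, m, r, s, j)" by (metis prod_cases5)
  show ?thesis
  proof (cases "f (l, m, s)")
    case None
    then show ?thesis by (simp add: x pcomp_def)
  next
    case (Some yb)
    then obtain l' m' s' b where f: "f (l, m, s) = Some ((l', m', s'), b)" by (cases yb) auto
    have b: "krid b = m" "klid b = m'" using f assms(1) unfolding typed_def by fastforce+
    obtain v c where bv: "act b (m, r, j) = Some (v, c)"
      using act_None[of b "(m, r, j)"] b by fastforce
    obtain j' where v: "v = (m', r, j')"
      using act_typed[OF bv] b by (cases v) auto
    show ?thesis
    proof (cases "g (l', m', s')")
      case None
      then show ?thesis using f bv v by (simp add: x pcomp_def)
    next
      case (Some zd)
      then obtain l2 m2 s2 d where g: "g (l', m', s') = Some ((l2, m2, s2), d)" by (cases zd) auto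
      have d: "krid d = m'" "klid d = m2" using g assms(2) unfolding typed_def by fastforce+
      then obtain k where k: "kmul d b = Some k"
        using kmul_eq_None_iff[of d b] b by fastforce
      have "act k (m, r, j) = pcomp (act d) (act b) (m, r, j)" by (simp add: act_mult k)
      then show ?thesis using f bv v g k
        by (auto simp: x pcomp_def map_option_case split: bind_splits option.splits prod.splits)
    qed
  qed
qed

text \<open>The maps touch different factors, linked only by the coefficient that \<open>f\<close>
  emits; \<open>g\<close> commutes with its action.\<close>

lemma right_left:
  assumes f: "typed f" and g: "\<And>a x. pcomp g (act a) x = pcomp (act a) g x"
    and g': "\<And>x y b. g x = Some (y, b) \<Longrightarrow> fst y = fst x"
  shows "pcomp (right g) (left f) x = pcomp (left f) (right g) x"
proof -
  obtain l m r s j where x: "x = (l, m, r, s, j)" by (metis prod_cases5)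
  show ?thesis
  proof (cases "f (l, m, s)")
    case None
    then show ?thesis by (auto simp: x pcomp_def split: bind_splits)
  next
    case (Some yb)
    then obtain l' m' s' b where f': "f (l, m, s) = Some ((l', m', s'), b)" by (cases yb) auto
    have b: "krid b = m" "klid b = m'" using f f' unfolding typed_def by fastforce+
    obtain v c where bv: "act b (m, r, j) = Some (v, c)"
      using act_None[of b "(m, r, j)"] b by fastforce
    obtain j' where v: "v = (m', r, j')"
      using act_typed[OF bv] b by (cases v) auto
    show ?thesis
      using g[of b "(m, r, j)"] g'[of "(m, r, j)"] f' bv v
      by (cases "g (m, r, j)"; cases "g (m', r, j')") (auto simp: x pcomp_def map_option_case split: bind_splits option.splits prod.splits)
  qed
qed

lemma left_target:
  assumes "left f x = Some (y, c)"
  obtains b where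
    "f (fst x, fst (snd x), fst (snd (snd (snd x)))) = Some ((fst y, fst (snd y), fst (snd (snd (snd y)))), b)"
    "act b (fst (snd x), fst (snd (snd x)), snd (snd (snd (snd x)))) =
       Some ((klid b, fst (snd (snd y)), snd (snd (snd (snd y)))), c)"
proof -
  obtain l m r s j where x: "x = (l, m, r, s, j)" by (metis prod_cases5)
  from assms obtain l' m' s' b m'' r' j' where *: "f (l, m, s) = Some ((l', m', s'), b)"
      "act b (m, r, j) = Some ((m'', r', j'), c)" "y = (l', m', r', s', j')"
    by (auto simp: x split: bind_splits)
  have "m'' = klid b" using act_typed[OF *(2)] by simp
  with * that show ?thesis by (auto simp: x)
qed

lemma left_typed:
  assumes "typed f" "left f x = Some (y, c)"
  shows "krid c = ridx x \<and> klid c = ridx y \<and> ridx y = ridx x"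
proof -
  obtain l m r s j l' m' r' s' j' where x: "x = (l, m, r, s, j)" and y: "y = (l', m', r', s', j')"
    by (metis prod_cases5)
  obtain b where b: "act b (m, r, j) = Some ((klid b, r', j'), c)"
    using left_target[OF assms(2)] by (auto simp: x y)
  show ?thesis using act_typed[OF b] by (simp add: x y)
qed

lemma pinj_left:
  assumes "pinj f"
  shows "pinj (left f)"
  unfolding pinj_def
proof (intro allI impI)
  fix x x' y c c' assume *: "left f x = Some (y, c)" "left f x' = Some (y, c')"
  obtain b where b: "f (fst x, fst (snd x), fst (snd (snd (snd x)))) = Some ((fst y, fst (snd y), fst (snd (snd (snd y)))), b)"
    "act b (fst (snd x), fst (snd (snd x)), snd (snd (snd (snd x)))) =
       Some ((klid b, fst (snd (snd y)), snd (snd (snd (snd y)))), c)"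
    using *(1) by (rule left_target)
  obtain b' where b': "f (fst x', fst (snd x'), fst (snd (snd (snd x')))) = Some ((fst y, fst (snd y), fst (snd (snd (snd y)))), b')"
    "act b' (fst (snd x'), fst (snd (snd x')), snd (snd (snd (snd x')))) =
       Some ((klid b', fst (snd (snd y)), snd (snd (snd (snd y)))), c')"
    using *(2) by (rule left_target)
  have eq: "(fst x, fst (snd x), fst (snd (snd (snd x)))) = (fst x', fst (snd x'), fst (snd (snd (snd x'))))"
    using assms b(1) b'(1) unfolding pinj_def by blast
  with b(1) b'(1) have "b = b'" by simp
  with b(2) b'(2) have "(fst (snd x), fst (snd (snd x)), snd (snd (snd (snd x)))) =
      (fst (snd x'), fst (snd (snd x')), snd (snd (snd (snd x'))))"
    using pinj_act[of b] unfolding pinj_def by blast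
  with eq show "x = x'" by (simp add: prod_eq_iff)
qed

lemma pinj_right: "pinj f \<Longrightarrow> (\<And>x y b. f x = Some (y, b) \<Longrightarrow> fst y = fst x) \<Longrightarrow> pinj (right f)"
  unfolding pinj_def by (clarsimp, metis fst_conv)

lemma pinj_dsigma: "pinj dsigma" and pinj_dtau: "pinj dtau"
  unfolding pinj_def by (auto elim!: dsigma.elims dtau.elims)

lemma dsigma_fst: "dsigma x = Some (y, b) \<Longrightarrow> fst y = fst x"
  and dtau_fst: "dtau x = Some (y, b) \<Longrightarrow> fst y = fst x"
  by (auto elim!: dsigma.elims dtau.elims)

text \<open>\<open>unif_act\<close> used for both factors: the second factor fixes how small an
  emitted coefficient must be, the first factor how small the input must be for this.\<close>

lemma unif_left_act: "unif_op (\<lambda>a. op_of (left (act a)))"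
  unfolding unif_op_def
proof (intro allI)
  fix y :: xgen and n
  obtain l m r s j where y: "y = (l, m, r, s, j)" by (metis prod_cases5)
  obtain k where k: "\<And>b x c. b \<in> kideal k \<Longrightarrow> act b x = Some ((m, r, j), c) \<Longrightarrow> c \<in> kideal n"
    using unif_act by metis
  obtain N where N: "\<And>a x b. a \<in> kideal N \<Longrightarrow> act a x = Some ((l, m, s), b) \<Longrightarrow> b \<in> kideal k"
    using unif_act by metis
  have "c \<in> kideal n" if "a \<in> kideal N" "left (act a) x = Some (y, c)" for a x c
  proof (rule left_target[OF that(2)], goal_cases)
    case (1 b)
    have "klid b = m" using act_typed[OF 1(1)] by (simp add: y)
    with 1 N[OF that(1)] k show ?case by (fastforce simp: y)
  qed
  then show "\<exists>N. \<forall>a\<in>kideal N. \<forall>x b. op_of (left (act a)) x (y, b) \<noteq> 0 \<longrightarrow> b \<in> kideal n"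
    by (intro exI[of _ N]) simp
qed

section \<open>The model of the box product as a differential module with action\<close>

definition mX :: "kmon \<Rightarrow> (xgen, xgen) op" where "mX a = op_of (left (act a))"
definition d1X :: "(xgen, xgen) op" where "d1X = op_of (left dsigma) + op_of (left dtau)"
definition d2X :: "(xgen, xgen) op" where "d2X = op_of (right dsigma) + op_of (right dtau)"

lemma cont_X [simp]: "cont_op (op_of (left (act a)))" "cont_op (op_of (left dsigma))" "cont_op (op_of (left dtau))"
  "cont_op (op_of (right dsigma))" "cont_op (op_of (right dtau))"
  by (intro cont_op_of pinj_left pinj_act pinj_right pinj_dsigma pinj_dtau dsigma_fst dtau_fst; assumption)+

lemma cont_X' [simp]: "cont_op (mX a)" "cont_op d1X" "cont_op d2X"
  by (simp_all add: mX_def d1X_def d2X_def cont_op_add)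

lemma mX_supp:
  assumes "mX a x (y, b) \<noteq> 0"
  shows "midx y = midx x" "ridx y = ridx x" "krid b = ridx x" "klid b = ridx y" "krid a = lidx x" "klid a = lidx y"
proof -
  have *: "left (act a) x = Some (y, b)" using assms by (simp add: mX_def)
  obtain l m r s j l' m' r' s' j' where x: "x = (l, m, r, s, j)" and y: "y = (l', m', r', s', j')"
    by (metis prod_cases5)
  obtain c where c: "act a (l, m, s) = Some ((l', m', s'), c)"
    using left_target[OF *] by (auto simp: x y)
  show "midx y = midx x" "krid a = lidx x" "klid a = lidx y"
    using act_typed[OF c] by (simp_all add: x y)
  show "ridx y = ridx x" "krid b = ridx x" "klid b = ridx y"
    using left_typed[OF typed_act *] by simp_all
qed

lemma d1X_supp:
  assumes "d1X x (y, b) \<noteq> 0"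
  shows "midx x = I0" "midx y = I1" "ridx y = ridx x" "krid b = ridx x" "klid b = ridx y" "lidx y = lidx x"
proof -
  have "left dsigma x = Some (y, b) \<or> left dtau x = Some (y, b)" using assms by (auto simp: d1X_def)
  then have "midx x = I0 \<and> midx y = I1 \<and> lidx y = lidx x"
    by (cases x rule: midx.cases) (auto split: bind_splits elim!: dsigma.elims dtau.elims)
  moreover have "krid b = ridx x \<and> klid b = ridx y \<and> ridx y = ridx x"
    using \<open>_ \<or> _\<close> left_typed typed_dsigma typed_dtau by blast
  ultimately show "midx x = I0" "midx y = I1" "ridx y = ridx x" "krid b = ridx x" "klid b = ridx y" "lidx y = lidx x"
    by simp_all
qed

lemma d2X_supp:
  assumes "d2X x (y, b) \<noteq> 0"
  shows "ridx x = I0" "ridx y = I1" "midx y = midx x" "krid b = ridx x" "klid b = ridx y" "lidx y = lidx x"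
proof -
  have "right dsigma x = Some (y, b) \<or> right dtau x = Some (y, b)" using assms by (auto simp: d2X_def)
  then show "ridx x = I0" "ridx y = I1" "midx y = midx x" "krid b = ridx x" "klid b = ridx y" "lidx y = lidx x"
    by (cases x rule: midx.cases; auto elim!: dsigma.elims dtau.elims)+
qed

lemma mX_mult: "mX a \<odot> mX b = (case kmul a b of None \<Rightarrow> 0 | Some c \<Rightarrow> mX c)"
proof -
  have "mX a \<odot> mX b = op_of (left (\<lambda>x. Option.bind (kmul a b) (\<lambda>c. act c x)))"
    unfolding mX_def cmp_op_of left_left[OF typed_act typed_act, abs_def] act_mult[abs_def] ..
  also have "\<dots> = (case kmul a b of None \<Rightarrow> 0 | Some c \<Rightarrow> mX c)"
    by (auto simp: mX_def op_of_def fun_eq_iff split: option.split)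
  finally show ?thesis .
qed

lemma mX_d1X: "mX a \<odot> d1X = d1X \<odot> mX a"
proof -
  have "pcomp (act a) dsigma = pcomp dsigma (act a)" "pcomp (act a) dtau = pcomp dtau (act a)"
    by (simp_all add: fun_eq_iff dsigma_act dtau_act)
  then show ?thesis
    by (simp add: mX_def d1X_def cmp_add_left cmp_add_right cmp_op_of
        left_left[OF typed_act typed_dsigma, abs_def] left_left[OF typed_act typed_dtau, abs_def]
        left_left[OF typed_dsigma typed_act, abs_def] left_left[OF typed_dtau typed_act, abs_def])
qed

lemma right_left_comm:
  assumes "typed f"
  shows "pcomp (right dsigma) (left f) = pcomp (left f) (right dsigma)"
    "pcomp (right dtau) (left f) = pcomp (left f) (right dtau)"
  using right_left[OF assms dsigma_act dsigma_fst] right_left[OF assms dtau_act dtau_fst]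
  by (auto simp: fun_eq_iff)

lemma mX_d2X: "mX a \<odot> d2X = d2X \<odot> mX a"
  by (simp add: mX_def d2X_def cmp_add_left cmp_add_right cmp_op_of right_left_comm[OF typed_act])

lemma d1X_d2X: "d1X \<odot> d2X = d2X \<odot> d1X"
  by (simp add: d1X_def d2X_def cmp_add_left cmp_add_right cmp_op_of cont_op_add
      right_left_comm[OF typed_dsigma] right_left_comm[OF typed_dtau] add_ac)

lemma d1X_d1X: "d1X \<odot> d1X = 0" and d2X_d2X: "d2X \<odot> d2X = 0"
  by (rule cmp_eq_zeroI, metis d1X_supp(1,2) idem.distinct(1))
     (rule cmp_eq_zeroI, metis d2X_supp(1,2) idem.distinct(1))

lemma strict_bimodule_X: "strict_bimodule UNIV lidx ridx (d1X + d2X) mX"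
proof -
  have hom: "khom UNIV ridx UNIV ridx (d1X + d2X)" "khom UNIV ridx UNIV ridx (mX a)" for a
    using d1X_supp(4,5) d2X_supp(4,5) mX_supp(3,4)
    by (intro khom_add khomI; simp del: bit_not_zero_iff)+
  have "op_map UNIV lidx ridx UNIV lidx ridx (d1X + d2X) mX"
    unfolding op_map_def
  proof (intro conjI allI impI hom)
    show "unif_op mX" using unif_left_act by (simp add: mX_def[abs_def])
    show "lidx y = lidx x" if "(d1X + d2X) x (y, b) \<noteq> 0" for x y b
    proof -
      from that have "d1X x (y, b) \<noteq> 0 \<or> d2X x (y, b) \<noteq> 0" by auto
      then show ?thesis using d1X_supp(6) d2X_supp(6) by blast
    qed
  qed (erule mX_supp(5), erule mX_supp(6))
  moreover have "(d1X + d2X) \<odot> (d1X + d2X) = 0"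
    by (simp add: cmp_add_left cmp_add_right cont_op_add d1X_d1X d2X_d2X d1X_d2X)
  moreover have "mX a \<odot> (d1X + d2X) = (d1X + d2X) \<odot> mX a" for a
    by (simp add: cmp_add_left cmp_add_right cont_op_add mX_d1X mX_d2X)
  moreover have "mX (kone e) x t = of_bool (x \<in> UNIV \<and> lidx x = e \<and> t = (x, kone (ridx x)))" for e x t
    by (cases x rule: midx.cases) (auto simp: mX_def op_of_def act_kone)
  ultimately show ?thesis
    using mX_mult unfolding strict_bimodule_def by blast
qed

section \<open>The matching\<close>

text \<open>
  The first summand \<open>d1X\<close> of the differential and its contraction are homogeneous for a grading of the
  generators, so their compositions reduce to products of matrices over \<open>bit\<close>.
\<close>

type_synonym grading = "idem \<times> int \<times> int"

fun wt :: "grading \<Rightarrow> grading \<Rightarrow> kmon" where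
  "wt (r, a, b) (r', a', b') = wmon r (a - a') (b - b')"

fun ge :: "grading \<Rightarrow> grading \<Rightarrow> bool" where
  "ge (r, a, b) (r', a', b') \<longleftrightarrow> r = r' \<and> okexp r (a - a') (b - b')"

definition graded :: "('x \<Rightarrow> grading) \<Rightarrow> ('y \<Rightarrow> grading) \<Rightarrow> ('x \<Rightarrow> 'y \<Rightarrow> bit) \<Rightarrow> ('x, 'y) op" where
  "graded f g A x = (\<lambda>(y, b). A x y * of_bool (b = wt (f x) (g y)))"

definition mat_ge :: "('x \<Rightarrow> grading) \<Rightarrow> ('y \<Rightarrow> grading) \<Rightarrow> ('x \<Rightarrow> 'y \<Rightarrow> bit) \<Rightarrow> bool" where
  "mat_ge f g A \<longleftrightarrow> (\<forall>x y. A x y \<noteq> 0 \<longrightarrow> ge (f x) (g y))"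

lemma kmul_wt: "ge x y \<Longrightarrow> ge y z \<Longrightarrow> kmul (wt y z) (wt x y) = Some (wt x z)"
  by (cases x; cases y; cases z) (auto simp del: wmon.simps simp: kmul_wmon)

text \<open>The weights telescope by \<open>kmul_wt\<close>, so all paths from \<open>x\<close> to
  \<open>z\<close> carry the same monomial and only their number modulo 2 matters.\<close>

lemma cmp_graded:
  assumes A: "mat_ge f g A" and A': "mat_ge g k A'"
  shows "graded g k A' \<odot> graded f g A = graded f k (\<lambda>x z. Sum_any (\<lambda>y. A x y * A' y z))"
proof (rule ext, rule ext, clarify)
  fix x z c
  have kmul: "kmul (wt (g y) (k z)) (wt (f x) (g y)) = Some (wt (f x) (k z))"
    if "A x y \<noteq> 0" "A' y z \<noteq> 0" for y
    using that A A' kmul_wt unfolding mat_ge_def by blast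
  have "(graded g k A' \<odot> graded f g A) x (z, c) =
      Sum_any (\<lambda>y. A x y * A' y z * of_bool (c = wt (f x) (k z)))"
    unfolding cmp_apply
  proof (rule Sum_any_bij_witness[where i = fst and j = "\<lambda>y. (y, wt (f x) (g y), wt (g y) (k z))"])
    fix t assume "(case t of (y, b, d) \<Rightarrow> graded f g A x (y, b) * graded g k A' y (z, d) *
        of_bool (kmul d b = Some c)) \<noteq> 0"
    then show "(fst t, wt (f x) (g (fst t)), wt (g (fst t)) (k z)) = t \<and>
       A x (fst t) * A' (fst t) z * of_bool (c = wt (f x) (k z)) =
       (case t of (y, b, d) \<Rightarrow> graded f g A x (y, b) * graded g k A' y (z, d) * of_bool (kmul d b = Some c))"
      using kmul[of "fst t"] by (cases t) (auto simp: graded_def split: if_splits)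
  next
    fix y assume "A x y * A' y z * of_bool (c = wt (f x) (k z)) \<noteq> 0"
    then show "fst (y, wt (f x) (g y), wt (g y) (k z)) = y \<and>
       (case (y, wt (f x) (g y), wt (g y) (k z)) of (y, b, d) \<Rightarrow>
          graded f g A x (y, b) * graded g k A' y (z, d) * of_bool (kmul d b = Some c)) =
       A x y * A' y z * of_bool (c = wt (f x) (k z))"
      using kmul[of y] by (auto simp: graded_def split: if_splits)
  qed
  then show "(graded g k A' \<odot> graded f g A) x (z, c) =
      graded f k (\<lambda>x z. Sum_any (\<lambda>y. A x y * A' y z)) x (z, c)"
    by (cases "c = wt (f x) (k z)") (simp_all add: graded_def)
qed

lemma graded_add: "graded f g A + graded f g A' = graded f g (\<lambda>x y. A x y + A' x y)"
  by (rule ext, rule ext, clarify) (simp only: graded_def plus_fun_apply prod.case distrib_right)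

lemma graded_id: "graded f f (\<lambda>x y. of_bool (x = y)) = id_op UNIV (fst \<circ> f)"
  by (rule ext, rule ext, clarify, rename_tac x y b, case_tac "f x") (auto simp: graded_def id_op_def)

lemma graded_typed:
  assumes "graded f g A x (y, b) \<noteq> 0" "mat_ge f g A"
  shows "A x y \<noteq> 0" "b = wt (f x) (g y)" "krid b = fst (f x)" "klid b = fst (g y)" "fst (g y) = fst (f x)"
proof -
  show *: "A x y \<noteq> 0" "b = wt (f x) (g y)"
    using assms(1) by (auto simp: graded_def split: if_splits)
  then have "ge (f x) (g y)" using assms(2) unfolding mat_ge_def by blast
  then show "krid b = fst (f x)" "klid b = fst (g y)" "fst (g y) = fst (f x)"
    by (cases "f x"; cases "g y"; simp add: *(2))+
qed

text \<open>\<open>th\<close> records the factor T of \<delta> on the W generators, which moves the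
  second factor by one position. \<open>Th\<close> is its summation function: Th(s + 1) - Th(s) =
  th(s).\<close>

definition th :: "idem \<Rightarrow> int \<Rightarrow> int" where "th l s = of_bool (l = I0 \<and> s \<ge> 0)"
definition Th :: "idem \<Rightarrow> int \<Rightarrow> int" where "Th l s = (if l = I0 then max 0 s else 0)"

text \<open>
  Generators with middle idempotent 0 and 1 are the edges and nodes of zigzags, one for each \<open>row\<close>:
  \<open>d1X\<close> maps the edge at position \<open>s\<close> to the nodes at \<open>s\<close> and \<open>s + 1\<close>, with coefficients of which at
  least one is a unit. The grading \<open>gr\<close> is found by summing the exponents of the coefficients along a row.
\<close>

fun row :: "xgen \<Rightarrow> int" where
  "row (l, m, r, s, j) = (if m = I0 then j - th l s else j)"

fun gr :: "xgen \<Rightarrow> grading" where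
  "gr (l, m, r, s, j) = (let u = row (l, m, r, s, j) in
     (r, Th l s + s * u + (if m = I0 then max 0 j else 0),
      (if r = I0 then Th l s + s * u + s + (if m = I0 then max 0 (j + 1) else 0) else s)))"

definition Md :: "xgen \<Rightarrow> xgen \<Rightarrow> bit" where
  "Md = (\<lambda>(l, m, r, s, j) (l', m', r', s', j'). of_bool (m = I0 \<and> m' = I1 \<and> l' = l \<and> r' = r \<and>
     j' = j - th l s \<and> (s' = s \<or> s' = s + 1)))"

text \<open>
  A node at \<open>s\<close> is matched, along a unit coefficient, with the edge at \<open>s\<close> if \<open>fwd\<close> and with the edge at
  \<open>s - 1\<close> if \<open>bwd\<close>; \<open>hrel\<close> describes the gradient paths. Unmatched are the node \<open>0\<close> of the row with \<open>l = r = 0\<close>, \<open>u = - 1\<close> and the edge \<open>0\<close> of the row with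
  \<open>l = r = 1\<close>, \<open>u = 0\<close>.
\<close>

definition fwd :: "idem \<Rightarrow> idem \<Rightarrow> int \<Rightarrow> int \<Rightarrow> bool" where
  "fwd l r u s \<longleftrightarrow> u < - 1 \<or> u = - 1 \<and> \<not> (l = I0 \<and> r = I0 \<and> s \<ge> 0) \<or> u = 0 \<and> l = I1 \<and> r = I1 \<and> s \<ge> 1"

definition bwd :: "idem \<Rightarrow> idem \<Rightarrow> int \<Rightarrow> int \<Rightarrow> bool" where
  "bwd l r u s \<longleftrightarrow> u > 0 \<or> u = 0 \<and> \<not> (l = I1 \<and> r = I1 \<and> s \<ge> 1) \<or> u = - 1 \<and> l = I0 \<and> r = I0 \<and> s > 0"

definition hrel :: "idem \<Rightarrow> idem \<Rightarrow> int \<Rightarrow> int \<Rightarrow> int \<Rightarrow> bool" where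
  "hrel l r u s q \<longleftrightarrow> fwd l r u s \<and> s \<le> q \<and> (l = I0 \<and> r = I0 \<and> u = - 1 \<longrightarrow> q < 0) \<or>
     bwd l r u s \<and> q < s \<and> (l = I0 \<and> r = I0 \<and> u = - 1 \<longrightarrow> 0 \<le> q)"

definition Mh :: "xgen \<Rightarrow> xgen \<Rightarrow> bit" where
  "Mh = (\<lambda>(l, m, r, s, j) (l', m', r', s', j'). of_bool (m = I1 \<and> m' = I0 \<and> l' = l \<and> r' = r \<and>
     j' = j + th l s' \<and> hrel l r j s s'))"

text \<open>Every node in the row of the critical node flows to it, so the projection sees the whole
  row and the inclusion one node. For the critical edge the roles are exchanged: the cycle through
  it consists of all edges of its row.\<close>

definition Mp :: "xgen \<Rightarrow> idem \<Rightarrow> bit" where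
  "Mp = (\<lambda>(l, m, r, s, j) e. of_bool (l = e \<and> r = e \<and> (if e = I0 then m = I1 \<and> j = - 1 else m = I0 \<and> s = 0 \<and> j = 0)))"

definition Mi :: "idem \<Rightarrow> xgen \<Rightarrow> bit" where
  "Mi = (\<lambda>e (l, m, r, s, j). of_bool (l = e \<and> r = e \<and> (if e = I0 then m = I1 \<and> s = 0 \<and> j = - 1 else m = I0 \<and> j = 0)))"

definition grY :: "idem \<Rightarrow> grading" where "grY e = (e, 0, 0)"

lemma idem_neq [simp]: "e \<noteq> I0 \<longleftrightarrow> e = I1" "e \<noteq> I1 \<longleftrightarrow> e = I0"
  by (cases e; simp)+

lemma Md_ge: "mat_ge gr gr Md"
  unfolding mat_ge_def
proof (intro allI impI)
  fix x y assume nz: "Md x y \<noteq> 0"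
  obtain l m r s j where x: "x = (l, m, r, s, j)" by (metis prod_cases5)
  obtain l' m' r' q j' where y: "y = (l', m', r', q, j')" by (metis prod_cases5)
  have eq: "m = I0" "m' = I1" "l' = l" "r' = r" "j' = j - th l s" and q: "q = s \<or> q = s + 1"
    using nz by (auto simp: x y Md_def)
  have "Th l (s + 1) = Th l s + th l s" by (auto simp: Th_def th_def)
  with q show "ge (gr x) (gr y)"
    by (cases r) (auto simp: x y eq Let_def algebra_simps)
qed

lemma Mp_ge: "mat_ge gr grY Mp" and Mi_ge: "mat_ge grY gr Mi"
  unfolding mat_ge_def Mp_def Mi_def grY_def
  by (auto simp: Let_def th_def Th_def split: if_splits prod.splits)

text \<open>A gradient path divides by units and multiplies by the other coefficients, so its total
  weight is an honest monomial; the inequalities confirm this for the differences of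
  \<open>gr\<close>.\<close>

lemma Mh_ge: "mat_ge gr gr Mh"
  unfolding mat_ge_def
proof (intro allI impI)
  fix x y assume nz: "Mh x y \<noteq> 0"
  obtain l m r s j where x: "x = (l, m, r, s, j)" by (metis prod_cases5)
  obtain l' m' r' q j' where y: "y = (l', m', r', q, j')" by (metis prod_cases5)
  have eq: "m = I1" "m' = I0" "l' = l" "r' = r" "j' = j + th l q" and hrel: "hrel l r j s q"
    using nz by (auto simp: x y Mh_def)
  from hrel consider (fwd) "fwd l r j s" "s \<le> q" "l = I0 \<and> r = I0 \<and> j = - 1 \<longrightarrow> q < 0"
    | (bwd) "bwd l r j s" "q < s" "l = I0 \<and> r = I0 \<and> j = - 1 \<longrightarrow> 0 \<le> q"
    unfolding hrel_def by blast
  then show "ge (gr x) (gr y)"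
  proof cases
    case fwd
    consider "j < - 1" | "j = - 1" | "j = 0" using fwd by (force simp: fwd_def)
    then show ?thesis
    proof cases
      case 1
      \<comment> \<open>The slope is at least 2 per position: one unit pays for the growth of
        \<open>Th\<close>, the other for the extra summand \<open>s\<close> of the second
        exponent.\<close>
      have "(q - s) * (- j - 2) \<ge> 0" using 1 fwd by (intro mult_nonneg_nonneg) auto
      then have "s * j - q * j \<ge> 2 * (q - s)" by (simp add: algebra_simps)
      then show ?thesis using 1 fwd
        by (cases r; cases l) (auto simp: x y eq Let_def th_def Th_def)
    next
      case 2
      then show ?thesis using fwd
        by (cases r; cases l) (auto simp: x y eq Let_def th_def Th_def fwd_def)
    next
      case 3
      then show ?thesis using fwd
        by (cases r; cases l) (auto simp: x y eq Let_def th_def Th_def fwd_def)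
    qed
  next
    case bwd
    consider "j \<ge> 0" | "j = - 1" using bwd by (force simp: bwd_def)
    then show ?thesis
    proof cases
      case 1
      \<comment> \<open>One of the s - q steps is reserved for the weight of the edge
        \<open>q\<close> itself, whose position j + th(q) also uses up an increase of
        \<open>Th\<close>.\<close>
      have "(s - q - 1) * j \<ge> 0" using 1 bwd by (intro mult_nonneg_nonneg) auto
      then have "s * j - q * j \<ge> j" by (simp add: algebra_simps)
      then show ?thesis using 1 bwd
        by (cases r; cases l) (auto simp: x y eq Let_def th_def Th_def)
    next
      case 2
      then show ?thesis using bwd
        by (cases r; cases l) (auto simp: x y eq Let_def th_def Th_def bwd_def)
    qed
  qed
qed

section \<open>The contraction of the first differential\<close>

definition hX :: "(xgen, xgen) op" where "hX = graded gr gr Mh"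
definition pX :: "(xgen, idem) op" where "pX = graded gr grY Mp"
definition iX :: "(idem, xgen) op" where "iX = graded grY gr Mi"

lemma Sum_any_two:
  assumes "y1 \<noteq> y2" "\<And>y. g y \<noteq> 0 \<Longrightarrow> y = y1 \<or> y = y2"
  shows "Sum_any g = g y1 + (g y2 :: 'c :: comm_monoid_add)"
proof -
  have "Sum_any g = sum g {y1, y2}"
    using assms(2) by (intro Sum_any.expand_superset) auto
  then show ?thesis using assms(1) by simp
qed

lemma Sum_any_one:
  assumes "\<And>y. g y \<noteq> 0 \<Longrightarrow> y = y1"
  shows "Sum_any g = (g y1 :: 'c :: comm_monoid_add)"
proof -
  have "Sum_any g = sum g {y1}"
    using assms by (intro Sum_any.expand_superset) auto
  then show ?thesis by simp
qed

lemma Md_sum_right: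
  "Sum_any (\<lambda>y. Md (l, m, r, s, j) y * g y) =
     (if m = I0 then g (l, I1, r, s, j - th l s) + g (l, I1, r, s + 1, j - th l s) else 0)"
proof (cases "m = I0")
  case True
  have "Sum_any (\<lambda>y. Md (l, m, r, s, j) y * g y) =
      Md (l, m, r, s, j) (l, I1, r, s, j - th l s) * g (l, I1, r, s, j - th l s) +
      Md (l, m, r, s, j) (l, I1, r, s + 1, j - th l s) * g (l, I1, r, s + 1, j - th l s)"
    by (rule Sum_any_two) (auto simp: Md_def split: if_splits)
  then show ?thesis using True by (simp only: Md_def) simp
next
  case False
  then have "(\<lambda>y. Md (l, m, r, s, j) y * g y) = (\<lambda>y. 0)" by (auto simp: Md_def)
  then show ?thesis using False by (simp only: Sum_any.neutral if_False)
qed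

lemma Md_sum_left:
  "Sum_any (\<lambda>y. g y * Md y (l, m, r, s, j)) =
     (if m = I1 then g (l, I0, r, s, j + th l s) + g (l, I0, r, s - 1, j + th l (s - 1)) else 0)"
proof (cases "m = I1")
  case True
  have "Sum_any (\<lambda>y. g y * Md y (l, m, r, s, j)) =
      g (l, I0, r, s, j + th l s) * Md (l, I0, r, s, j + th l s) (l, m, r, s, j) +
      g (l, I0, r, s - 1, j + th l (s - 1)) * Md (l, I0, r, s - 1, j + th l (s - 1)) (l, m, r, s, j)"
    by (rule Sum_any_two) (auto simp: Md_def split: if_splits)
  then show ?thesis using True by (simp only: Md_def) simp
next
  case False
  then have "(\<lambda>y. g y * Md y (l, m, r, s, j)) = (\<lambda>y. 0)" by (auto simp: Md_def)
  then show ?thesis using False by (simp only: Sum_any.neutral if_False)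
qed

lemma Mi_Mp_sum: "Sum_any (\<lambda>e. Mp x e * Mi e z) = Mp x (lidx x) * Mi (lidx x) z"
  by (rule Sum_any_one) (auto simp: Mp_def split: prod.splits if_splits)

lemma bit_eq_of_bool: "(of_bool P + of_bool Q = (of_bool P' + of_bool Q' :: bit)) \<longleftrightarrow> ((P \<noteq> Q) \<longleftrightarrow> (P' \<noteq> Q'))"
  by (cases P; cases Q; cases P'; cases Q') simp_all

text \<open>This is where the choice of \<open>gr\<close> is justified: the exponents computed from
  \<open>wA\<close> and \<open>wB\<close> are the differences of gradings towards both ends of an
  edge.\<close>

lemma d1X_graded: "d1X = graded gr gr Md"
proof (rule ext, rule ext, clarify)
  fix x y :: xgen and b
  obtain l m r s j where x: "x = (l, m, r, s, j)" by (metis prod_cases5)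
  obtain l' m' r' q j' where y: "y = (l', m', r', q, j')" by (metis prod_cases5)
  show "d1X x (y, b) = graded gr gr Md x (y, b)"
  proof (cases m)
    case I1
    then show ?thesis by (simp add: d1X_def x graded_def Md_def op_of_def split: bind_splits)
  next
    case I0
    have 1: "wt (gr x) (gr (l, I1, r, s, j - th l s)) = wmon r (max 0 j) (if r = I0 then max 0 (j + 1) else 0)"
      by (simp add: x I0 Let_def th_def Th_def)
    have 2: "wt (gr x) (gr (l, I1, r, s + 1, j - th l s)) = wmon r (max 0 (- j)) (if r = I0 then max 0 (- j - 1) else - 1)"
      by (cases r) (auto simp: x I0 Let_def th_def Th_def algebra_simps max_def)
    have "left dsigma x = Some ((l, I1, r, s, j - th l s), wmon r (max 0 j) (if r = I0 then max 0 (j + 1) else 0))"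
      by (cases r) (auto simp: x I0 th_def wA_def wB_def max_def)
    moreover have "left dtau x = Some ((l, I1, r, s + 1, j - th l s), wmon r (max 0 (- j)) (if r = I0 then max 0 (- j - 1) else - 1))"
      by (cases r) (auto simp: x I0 th_def wA_def wB_def)
    ultimately show ?thesis
      unfolding d1X_def plus_fun_apply op_of_def graded_def 1[symmetric] 2[symmetric]
      by (auto simp: x y I0 Md_def simp del: gr.simps wt.simps)
  qed
qed

text \<open>This is h d on edges. The paths from the two ends of an edge reach the same edges except
  the edge itself; at the critical edge they run away in both directions and together cover all
  other edges.\<close>

lemma hrel_edge: "(hrel l r u s q \<noteq> hrel l r u (s + 1) q) \<longleftrightarrow> ((s = q) \<noteq> (l = I1 \<and> r = I1 \<and> u = 0 \<and> s = 0))"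
proof -
  consider "u < - 1" | "u = - 1" | "u = 0" | "u > 0" by linarith
  then show ?thesis
    by cases (cases l; cases r; simp add: hrel_def fwd_def bwd_def; linarith?; auto)+
qed

text \<open>This is d h on nodes. A path covers an interval of edges, so inner nodes cancel. Besides
  the start \<open>s\<close> an end survives only at the critical node, where paths stop; all other
  nonempty paths are infinite.\<close>

lemma hrel_node: "(hrel l r u s q \<noteq> hrel l r u s (q - 1)) \<longleftrightarrow> ((s = q) \<noteq> (l = I0 \<and> r = I0 \<and> u = - 1 \<and> q = 0))"
proof -
  consider "u < - 1" | "u = - 1" | "u = 0" | "u > 0" by linarith
  then show ?thesis
    by cases (cases l; cases r; simp add: hrel_def fwd_def bwd_def; linarith?; auto)+
qed

text \<open>\<open>hX\<close> kills edges and \<open>d1X\<close> kills nodes, so each diagonal case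
  involves one composite and comes down to \<open>hrel_edge\<close> or \<open>hrel_node\<close>,
  whose exceptional clause is the i p term.\<close>

lemma homotopy_X: "hX \<odot> d1X + d1X \<odot> hX = id_op UNIV ridx + iX \<odot> pX"
proof -
  have id: "id_op UNIV ridx = graded gr gr (\<lambda>x y. of_bool (x = y))"
  proof -
    have "fst \<circ> gr = ridx" by (rule ext, rename_tac x, case_tac x rule: ridx.cases) (simp add: Let_def)
    then show ?thesis by (simp only: graded_id)
  qed
  have "Sum_any (\<lambda>y. Md x y * Mh y z) + Sum_any (\<lambda>y. Mh x y * Md y z) =
      of_bool (x = z) + Sum_any (\<lambda>e. Mp x e * Mi e z)" for x z
  proof -
    obtain l m r s j where x: "x = (l, m, r, s, j)" by (metis prod_cases5)
    obtain l' m' r' q j' where z: "z = (l', m', r', q, j')" by (metis prod_cases5)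
    consider (edges) "m = I0" "m' = I0" | (nodes) "m = I1" "m' = I1" | "m = I0" "m' = I1" | "m = I1" "m' = I0"
      by (cases m; cases m') auto
    then show ?thesis
    proof cases
      case edges
      show ?thesis
      proof (cases "l' = l \<and> r' = r \<and> j' = j - th l s + th l q")
        case True
        have "Mp x (lidx x) * Mi (lidx x) z = of_bool (l = I1 \<and> r = I1 \<and> j - th l s = 0 \<and> s = 0)"
          using True edges by (cases l; cases r) (auto simp: x z Mp_def Mi_def th_def)
        moreover have "of_bool (x = z) = (of_bool (s = q) :: bit)"
          using True edges by (auto simp: x z)
        moreover have "Mh (l, I1, r, t, j - th l s) z = of_bool (hrel l r (j - th l s) t q)" for t
          using True edges by (simp add: z Mh_def)
        ultimately show ?thesis
          using hrel_edge[of l r "j - th l s" s q] edges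
          unfolding Mi_Mp_sum unfolding x Md_sum_right unfolding z Md_sum_left by (simp add: bit_eq_of_bool)
      next
        case False
        then show ?thesis unfolding Mi_Mp_sum unfolding x z Md_sum_right Md_sum_left using edges
          by (cases l) (auto simp: Mh_def Mp_def Mi_def th_def)
      qed
    next
      case nodes
      show ?thesis
      proof (cases "l' = l \<and> r' = r \<and> j' = j")
        case True
        have "Mp x (lidx x) * Mi (lidx x) z = of_bool (l = I0 \<and> r = I0 \<and> j = - 1 \<and> q = 0)"
          using True nodes by (cases l; cases r) (auto simp: x z Mp_def Mi_def)
        moreover have "of_bool (x = z) = (of_bool (s = q) :: bit)"
          using True nodes by (auto simp: x z)
        moreover have "Mh x (l', I0, r', t, j' + th l' t) = of_bool (hrel l r j s t)" for t
          using True nodes by (simp add: x Mh_def)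
        ultimately show ?thesis
          using hrel_node[of l r j s q] nodes
          unfolding Mi_Mp_sum unfolding z Md_sum_left unfolding x Md_sum_right by (simp add: bit_eq_of_bool)
      next
        case False
        then show ?thesis unfolding Mi_Mp_sum unfolding x z Md_sum_right Md_sum_left using nodes
          by (auto simp: Mh_def Mp_def Mi_def)
      qed
    next
      case 3
      then show ?thesis unfolding Mi_Mp_sum unfolding x z Md_sum_right Md_sum_left
        by (cases l) (auto simp: Mh_def Mp_def Mi_def)
    next
      case 4
      then show ?thesis unfolding Mi_Mp_sum unfolding x z Md_sum_right Md_sum_left
        by (cases l) (auto simp: Mh_def Mp_def Mi_def)
    qed
  qed
  then show ?thesis
    unfolding id hX_def d1X_graded iX_def pX_def
    by (simp only: cmp_graded Md_ge Mh_ge Mi_ge Mp_ge graded_add)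
qed

lemma fst_gr: "fst (gr x) = ridx x"
  by (cases x rule: ridx.cases) (simp add: Let_def)

lemma fst_grY: "fst (grY e) = e"
  by (simp add: grY_def)

lemma hX_supp:
  assumes "hX x (y, b) \<noteq> 0"
  shows "midx x = I1" "midx y = I0" "ridx y = ridx x" "lidx y = lidx x" "krid b = ridx x" "klid b = ridx y"
proof -
  note * = graded_typed[OF assms[unfolded hX_def] Mh_ge, unfolded fst_gr]
  show "ridx y = ridx x" "krid b = ridx x" "klid b = ridx y" using * by simp_all
  show "midx x = I1" "midx y = I0" "lidx y = lidx x"
    using *(1) by (auto simp: Mh_def split: prod.splits)
qed

lemma pX_supp:
  assumes "pX x (e, b) \<noteq> 0"
  shows "lidx x = e" "krid b = ridx x" "klid b = e" "midx x \<noteq> ridx x"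
proof -
  note * = graded_typed[OF assms[unfolded pX_def] Mp_ge, unfolded fst_gr fst_grY]
  show "krid b = ridx x" "klid b = e" using * by simp_all
  show "lidx x = e" "midx x \<noteq> ridx x"
    using *(1) by (auto simp: Mp_def split: prod.splits if_splits)
qed

lemma iX_supp:
  assumes "iX e (y, b) \<noteq> 0"
  shows "lidx y = e" "krid b = e" "klid b = ridx y" "midx y \<noteq> ridx y"
proof -
  note * = graded_typed[OF assms[unfolded iX_def] Mi_ge, unfolded fst_gr fst_grY]
  show "krid b = e" "klid b = ridx y" using * by simp_all
  show "lidx y = e" "midx y \<noteq> ridx y"
    using *(1) by (auto simp: Mi_def split: prod.splits if_splits)
qed

section \<open>Continuity of the contraction, the projection and the inclusion\<close>

lemma nonneg_bound: "0 \<le> (a::int) \<Longrightarrow> 1 \<le> c \<Longrightarrow> a \<le> a * c"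
  using mult_left_mono[of 1 c a] by simp

text \<open>An edge \<open>q\<close> could be reached from infinitely many nodes only with s tending
  to minus infinity (\<open>fwd\<close>) or to plus infinity (\<open>bwd\<close>). There an exponent
  of the weight grows with |s|: through s u, through \<open>Th\<close> if l = 0, or in the second
  exponent if r = 0. The row l = r = 1, u = 0 has no such growth, but its paths run outward from
  edge 0, so finitely many sources reach \<open>q\<close>.\<close>

lemma cont_hX: "cont_op hX"
  unfolding cont_op_def
proof (intro allI)
  fix y :: xgen and n
  obtain l m r q j where y: "y = (l, m, r, q, j)" by (metis prod_cases5)
  obtain r0 c1 c2 where c: "gr y = (r0, c1, c2)" by (metis prod_cases3)
  have r0: "r0 = r" using c by (simp add: y Let_def)
  define u where "u = j - th l q"
  \<comment> \<open>Collects \<open>n\<close> and the grading of the target, for the estimates by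
    weights, and |q|, for the sources between 0 and \<open>q\<close>.\<close>
  define K where "K = int n + \<bar>c1\<bar> + \<bar>c2\<bar> + \<bar>q\<bar> + 1"
  let ?x = "\<lambda>s. (l, I1, r, s, u)"
  have "{(x, b). hX x (y, b) \<noteq> 0 \<and> b \<notin> kideal n} \<subseteq>
      (\<lambda>s. (?x s, wt (gr (?x s)) (gr y))) ` {- K..K}"
  proof clarify
    fix x b assume nz: "hX x (y, b) \<noteq> 0" and b: "b \<notin> kideal n"
    have M: "Mh x y \<noteq> 0" and bw: "b = wt (gr x) (gr y)"
      using graded_typed[OF nz[unfolded hX_def] Mh_ge] by auto
    obtain l' m' r' s j' where x': "x = (l', m', r', s, j')" by (metis prod_cases5)
    have x: "x = ?x s" and hrel: "hrel l r u s q"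
      using M by (auto simp: x' y Mh_def u_def)
    have gx: "gr x = (r, Th l s + s * u, if r = I0 then Th l s + s * u + s else s)"
      by (simp add: x)
    have bb: "b = wmon r (Th l s + s * u - c1) ((if r = I0 then Th l s + s * u + s else s) - c2)"
      by (simp add: bw gx c)
    have A: "Th l s + s * u - c1 < int n"
      using b wmon_in_kideal unfolding bb by (meson not_less)
    have B: "Th l s + s * u + s - c2 < int n" if "r = I0"
      using b unfolding bb that by (simp add: kideal_def split: if_splits)
    have Th: "0 \<le> Th l s" by (simp add: Th_def)
    from hrel consider (fwd) "fwd l r u s" "s \<le> q" | (bwd) "bwd l r u s" "q < s"
      unfolding hrel_def by blast
    then have "\<bar>s\<bar> \<le> K"
    proof cases
      case fwd
      then consider "s \<ge> 0" | "u \<le> - 1" "s < 0" by (force simp: fwd_def)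
      then show ?thesis
      proof cases
        case 2
        then have "- s \<le> s * u" using nonneg_bound[of "- s" "- u"] by simp
        then show ?thesis using A Th fwd 2 unfolding K_def by linarith
      qed (use fwd in \<open>simp add: K_def\<close>)
    next
      case bwd
      consider "s \<le> 0" | "u \<ge> 1" "s > 0" | "u \<le> 0" "s > 0" by linarith
      then show ?thesis
      proof cases
        case 2
        then have "s \<le> s * u" using nonneg_bound[of s u] by simp
        then show ?thesis using A Th bwd 2 unfolding K_def by linarith
      next
        case 3
        with bwd(1) have "u = 0 \<and> (l = I0 \<or> r = I0) \<or> u = - 1 \<and> l = I0 \<and> r = I0"
          by (auto simp: bwd_def)
        then show ?thesis using A B 3 Th by (cases l) (auto simp: K_def Th_def)
      qed (use bwd in \<open>simp add: K_def\<close>)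
    qed
    then show "(x, b) \<in> (\<lambda>s. (?x s, wt (gr (?x s)) (gr y))) ` {- K..K}"
      by (intro image_eqI[of _ _ s]) (auto simp: x bw)
  qed
  then show "finite {(x, b). hX x (y, b) \<noteq> 0 \<and> b \<notin> kideal n}"
    by (rule finite_subset) simp
qed

fun proj_crit :: "xgen \<Rightarrow> (idem \<times> kmon) option" where
  "proj_crit (l, m, r, s, j) =
     (if l = I0 \<and> m = I1 \<and> r = I0 \<and> j = - 1 then Some (I0, WZ (nat (- s)) (nat s))
      else if l = I1 \<and> m = I0 \<and> r = I1 \<and> s = 0 \<and> j = 0 then Some (I1, UT 0 0) else None)"

lemma pX_eq: "pX = op_of proj_crit"
proof (rule ext, rule ext, clarify)
  fix x :: xgen and e b
  obtain l m r s j where x: "x = (l, m, r, s, j)" by (metis prod_cases5)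
  show "pX x (e, b) = op_of proj_crit x (e, b)"
    by (cases e) (auto simp: pX_def graded_def op_of_def Mp_def x grY_def Let_def Th_def th_def max_def)
qed

text \<open>A whole row maps to the generator of idempotent 0, with coefficients W^(-s) and Z^s that
  lie in J_n once |s| >= n.\<close>

lemma cont_pX: "cont_op pX"
  unfolding cont_op_def
proof (intro allI)
  fix e n
  have "{(x, b). pX x (e, b) \<noteq> 0 \<and> b \<notin> kideal n} \<subseteq>
      insert ((I1, I0, I1, 0, 0), UT 0 0)
        ((\<lambda>s. ((I0, I1, I0, s, - 1), WZ (nat (- s)) (nat s))) ` {- int n..int n})"
  proof clarify
    fix x b assume nz: "pX x (e, b) \<noteq> 0" and b: "b \<notin> kideal n"
      and neq: "(x, b) \<notin> (\<lambda>s. ((I0, I1, I0, s, - 1), WZ (nat (- s)) (nat s))) ` {- int n..int n}"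
    obtain l m r s j where x: "x = (l, m, r, s, j)" by (metis prod_cases5)
    show "x = (I1, I0, I1, 0, 0) \<and> b = UT 0 0"
    proof (rule ccontr)
      assume "\<not> (x = (I1, I0, I1, 0, 0) \<and> b = UT 0 0)"
      then have "x = (I0, I1, I0, s, - 1)" "b = WZ (nat (- s)) (nat s)"
        using nz by (auto simp: pX_eq x split: if_splits)
      moreover from this have "s \<in> {- int n..int n}" using b by (auto simp: kideal_def split: if_splits)
      ultimately show False using neq by blast
    qed
  qed
  then show "finite {(x, b). pX x (e, b) \<noteq> 0 \<and> b \<notin> kideal n}"
    by (rule finite_subset) simp
qed

lemma iX_I0: "iX I0 (y, b) \<noteq> 0 \<longleftrightarrow> y = (I0, I1, I0, 0, - 1) \<and> b = WZ 0 0"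
  by (cases y rule: ridx.cases) (auto simp: iX_def graded_def Mi_def grY_def Let_def Th_def)

lemma iX_I1: "iX I1 (y, b) \<noteq> 0 \<longleftrightarrow> (\<exists>s. y = (I1, I0, I1, s, 0) \<and> b = UT 0 (- s))"
  by (cases y rule: ridx.cases) (auto simp: iX_def graded_def Mi_def grY_def Let_def Th_def th_def)

text \<open>The coefficients T^(-s) are units and do not tend to 0; continuity holds because the
  summands lie at different targets, each with one source.\<close>

lemma cont_iX: "cont_op iX"
  unfolding cont_op_def
proof (intro allI finite_if_unique)
  fix y n p p' assume "p \<in> {(x, b). iX x (y, b) \<noteq> 0 \<and> b \<notin> kideal n}"
    "p' \<in> {(x, b). iX x (y, b) \<noteq> 0 \<and> b \<notin> kideal n}"
  then obtain e b e' b' where p: "p = (e, b)" "p' = (e', b')" and nz: "iX e (y, b) \<noteq> 0" "iX e' (y, b') \<noteq> 0"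
    by blast
  have "e = e'" using iX_supp(1)[OF nz(1)] iX_supp(1)[OF nz(2)] by simp
  moreover have "b = b'"
    using graded_typed(2)[OF nz(1)[unfolded iX_def] Mi_ge] graded_typed(2)[OF nz(2)[unfolded iX_def] Mi_ge]
      \<open>e = e'\<close> by simp
  ultimately show "p = p'" by (simp add: p)
qed

lemmas contX [simp] = cont_hX cont_pX cont_iX

section \<open>Side conditions from idempotents and from the matching\<close>

lemma hX_cmp_hX: "hX \<odot> G \<odot> hX = 0"
  if "\<And>x y b. G x (y, b) \<noteq> 0 \<Longrightarrow> midx y = midx x"
  by (rule cmp_eq_zeroI) (erule cmp_nonzeroE, metis that hX_supp(1,2) idem.distinct(1))

lemma d1iX: "d1X \<odot> iX = 0"
proof -
  have "Sum_any (\<lambda>y. Mi e y * Md y z) = 0" for e z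
  proof -
    obtain l m r s j where z: "z = (l, m, r, s, j)" by (metis prod_cases5)
    show ?thesis unfolding z Md_sum_left by (auto simp: Mi_def th_def)
  qed
  then have "graded grY gr (\<lambda>x z. Sum_any (\<lambda>y. Mi x y * Md y z)) = 0"
    by (simp add: graded_def fun_eq_iff)
  then show ?thesis by (simp only: d1X_graded iX_def cmp_graded[OF Mi_ge Md_ge])
qed

lemma pd1X: "pX \<odot> d1X = 0"
proof -
  have "Sum_any (\<lambda>y. Md x y * Mp y e) = 0" for x e
  proof -
    obtain l m r s j where x: "x = (l, m, r, s, j)" by (metis prod_cases5)
    show ?thesis unfolding x Md_sum_right by (auto simp: Mp_def)
  qed
  then have "graded gr grY (\<lambda>x z. Sum_any (\<lambda>y. Md x y * Mp y z)) = 0"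
    by (simp add: graded_def fun_eq_iff)
  then show ?thesis by (simp only: d1X_graded pX_def cmp_graded[OF Md_ge Mp_ge])
qed

lemma piX: "pX \<odot> iX = id_op UNIV (\<lambda>e. e)"
proof -
  have "Sum_any (\<lambda>y. Mi e y * Mp y e') = of_bool (e = e')" for e e'
  proof -
    define y0 :: xgen where "y0 = (if e = I0 then (I0, I1, I0, 0, - 1) else (I1, I0, I1, 0, 0))"
    have "Sum_any (\<lambda>y. Mi e y * Mp y e') = Mi e y0 * Mp y0 e'"
      by (rule Sum_any_one) (auto simp: Mi_def Mp_def y0_def split: if_splits prod.splits)
    then show ?thesis by (cases e; cases e') (auto simp: Mi_def Mp_def y0_def)
  qed
  then have "(\<lambda>x z. Sum_any (\<lambda>y. Mi x y * Mp y z)) = (\<lambda>e e'. of_bool (e = e'))"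
    by (simp add: fun_eq_iff)
  moreover have "fst \<circ> grY = (\<lambda>e. e)" by (simp add: fun_eq_iff fst_grY)
  ultimately show ?thesis
    by (simp only: pX_def iX_def cmp_graded[OF Mi_ge Mp_ge] graded_id)
qed

lemma hiX: "hX \<odot> iX = 0" and phX: "pX \<odot> hX = 0"
proof -
  have "Sum_any (\<lambda>y. Mi e y * Mh y z) = 0" for e z
  proof -
    have "(\<lambda>y. Mi e y * Mh y z) = (\<lambda>y. 0)"
      by (auto simp: fun_eq_iff Mi_def Mh_def hrel_def fwd_def bwd_def split: prod.splits if_splits)
    then show ?thesis by (simp only: Sum_any.neutral)
  qed
  then have "graded grY gr (\<lambda>x z. Sum_any (\<lambda>y. Mi x y * Mh y z)) = 0"
    by (simp add: graded_def fun_eq_iff)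
  then show "hX \<odot> iX = 0" by (simp only: hX_def iX_def cmp_graded[OF Mi_ge Mh_ge])
  have "Sum_any (\<lambda>y. Mh x y * Mp y e) = 0" for x e
  proof -
    have "(\<lambda>y. Mh x y * Mp y e) = (\<lambda>y. 0)"
      by (auto simp: fun_eq_iff Mp_def Mh_def hrel_def fwd_def bwd_def th_def split: prod.splits if_splits)
    then show ?thesis by (simp only: Sum_any.neutral)
  qed
  then have "graded gr grY (\<lambda>x z. Sum_any (\<lambda>y. Mh x y * Mp y z)) = 0"
    by (simp add: graded_def fun_eq_iff)
  then show "pX \<odot> hX = 0" by (simp only: hX_def pX_def cmp_graded[OF Mh_ge Mp_ge])
qed

lemma d2hd2X: "d2X \<odot> hX \<odot> d2X = 0"
  by (rule cmp_eq_zeroI) (erule cmp_nonzeroE, metis d2X_supp(1,2) hX_supp(3) idem.distinct(1))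

text \<open>Both critical cells have middle idempotent different from the right one, and
  \<open>d2X\<close> changes the right one while keeping the middle one.\<close>

lemma pd2iX: "pX \<odot> d2X \<odot> iX = 0"
proof (rule cmp_eq_zeroI)
  fix x y z b d assume "pX y (z, d) \<noteq> 0" "(d2X \<odot> iX) x (y, b) \<noteq> 0"
  then show False
    by - (erule cmp_nonzeroE, drule pX_supp(4), frule iX_supp(4), frule d2X_supp(1), frule d2X_supp(2),
        drule d2X_supp(3), metis idem.exhaust)
qed

text \<open>The same count of idempotents: \<open>hX\<close> changes the middle one and keeps the
  right one, \<open>mX\<close> keeps both.\<close>

lemma pmhmiX: "pX \<odot> mX a \<odot> hX \<odot> mX b \<odot> iX = 0"
proof (rule cmp_eq_zeroI)
  fix x y z b' d assume p: "pX y (z, d) \<noteq> 0" and nz: "(mX a \<odot> hX \<odot> mX b \<odot> iX) x (y, b') \<noteq> 0"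
  from nz obtain y1 b1 d1 where 1: "(hX \<odot> mX b \<odot> iX) x (y1, b1) \<noteq> 0" "mX a y1 (y, d1) \<noteq> 0"
    by (rule cmp_nonzeroE)
  from 1(1) obtain y2 b2 d2 where 2: "(mX b \<odot> iX) x (y2, b2) \<noteq> 0" "hX y2 (y1, d2) \<noteq> 0"
    by (rule cmp_nonzeroE)
  from 2(1) obtain y3 b3 d3 where 3: "iX x (y3, b3) \<noteq> 0" "mX b y3 (y2, d3) \<noteq> 0"
    by (rule cmp_nonzeroE)
  show False
    using pX_supp(4)[OF p] mX_supp(1,2)[OF 1(2)] hX_supp(1-3)[OF 2(2)] mX_supp(1,2)[OF 3(2)] iX_supp(4)[OF 3(1)]
    by (cases "ridx y3") auto
qed

section \<open>Computation of the transferred action\<close>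

lemma cmp_op_of_single:
  assumes "\<And>y b. G x (y, b) \<noteq> 0 \<Longrightarrow> F y \<noteq> None \<Longrightarrow> y = y0 \<and> b = b0"
  shows "(op_of F \<odot> G) x (z, c) = G x (y0, b0) * of_bool (\<exists>d. F y0 = Some (z, d) \<and> kmul d b0 = Some c)"
proof (cases "\<exists>d. F y0 = Some (z, d)")
  case True
  then obtain d0 where d0: "F y0 = Some (z, d0)" by blast
  have "(op_of F \<odot> G) x (z, c) = G x (y0, b0) * op_of F y0 (z, d0) * of_bool (kmul d0 b0 = Some c)"
    by (rule cmp_single) (use assms d0 in auto)
  then show ?thesis using d0 by simp
next
  case False
  have "(op_of F \<odot> G) x (z, c) = 0"
  proof (rule ccontr)
    assume "(op_of F \<odot> G) x (z, c) \<noteq> 0"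
    then obtain y b d where "G x (y, b) \<noteq> 0" "op_of F y (z, d) \<noteq> 0" by (rule cmp_nonzeroE)
    then show False using assms[of y b] False by auto
  qed
  then show ?thesis using False by simp
qed

lemma pd2X_nz: "(pX \<odot> d2X) x (e, c) \<noteq> 0 \<longleftrightarrow>
    e = I1 \<and> (x = (I1, I0, I0, 0, 0) \<and> c = UTsigma 0 1 \<or> x = (I1, I0, I0, 0, - 1) \<and> c = UTtau 0 0)"
proof -
  obtain l m r s j where x: "x = (l, m, r, s, j)" by (metis prod_cases5)
  have "pX \<odot> d2X = op_of (pcomp proj_crit (right dsigma)) + op_of (pcomp proj_crit (right dtau))"
    by (simp add: d2X_def cmp_add_right pX_eq[symmetric]) (simp add: pX_eq cmp_op_of)
  moreover have "pcomp proj_crit (right dsigma) x = (if x = (I1, I0, I0, 0, 0) then Some (I1, UTsigma 0 1) else None)"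
    by (cases r) (auto simp: x pcomp_def)
  moreover have "pcomp proj_crit (right dtau) x = (if x = (I1, I0, I0, 0, - 1) then Some (I1, UTtau 0 0) else None)"
    by (cases r) (auto simp: x pcomp_def)
  ultimately show ?thesis by (simp only: plus_fun_apply op_of_def) (auto split: if_splits)
qed

text \<open>A node flows to the edge at 0 of its row, which \<open>d2X\<close> sends to the critical
  edge. The coefficients multiply to T \<sigma> Z^(s - 1) = T^s \<sigma> and \<tau> W^(-s) = T^s
  \<tau>.\<close>

fun proj_crit_pert :: "xgen \<Rightarrow> (idem \<times> kmon) option" where
  "proj_crit_pert (l, m, r, s, j) =
     (if l = I1 \<and> m = I1 \<and> r = I0 \<and> j = 0 \<and> s \<ge> 1 then Some (I1, UTsigma 0 s)
      else if l = I1 \<and> m = I1 \<and> r = I0 \<and> j = - 1 \<and> s \<le> 0 then Some (I1, UTtau 0 s) else None)"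

lemma hX_nz: "hX x (y, b) \<noteq> 0 \<longleftrightarrow> Mh x y \<noteq> 0 \<and> b = wt (gr x) (gr y)"
  by (auto simp: hX_def graded_def)

lemma pd2hX: "pX \<odot> d2X \<odot> hX = op_of proj_crit_pert"
proof -
  have "(pX \<odot> d2X) \<odot> hX = op_of proj_crit_pert"
  proof (rule op_eqI)
    fix x :: xgen and e c
    obtain l m r s j where x: "x = (l, m, r, s, j)" by (metis prod_cases5)
    let ?y1 = "(I1, I0, I0, 0, 0) :: xgen" and ?y2 = "(I1, I0, I0, 0, - 1) :: xgen"
    have M1: "Mh x ?y1 \<noteq> 0 \<longleftrightarrow> l = I1 \<and> m = I1 \<and> r = I0 \<and> j = 0 \<and> s \<ge> 1"
      by (auto simp: x Mh_def th_def hrel_def fwd_def bwd_def)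
    have M2: "Mh x ?y2 \<noteq> 0 \<longleftrightarrow> l = I1 \<and> m = I1 \<and> r = I0 \<and> j = - 1 \<and> s \<le> 0"
      by (auto simp: x Mh_def th_def hrel_def fwd_def bwd_def)
    have w1: "wt (gr x) (gr ?y1) = WZ 0 (nat (s - 1))" if "l = I1 \<and> m = I1 \<and> r = I0 \<and> j = 0 \<and> s \<ge> 1"
      using that by (simp add: x Let_def Th_def th_def)
    have w2: "wt (gr x) (gr ?y2) = WZ (nat (- s)) 0" if "l = I1 \<and> m = I1 \<and> r = I0 \<and> j = - 1 \<and> s \<le> 0"
      using that by (simp add: x Let_def Th_def th_def)
    show "((pX \<odot> d2X) \<odot> hX) x (e, c) \<noteq> 0 \<longleftrightarrow> op_of proj_crit_pert x (e, c) \<noteq> 0"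
    proof
      assume "((pX \<odot> d2X) \<odot> hX) x (e, c) \<noteq> 0"
      then obtain y b d where y: "hX x (y, b) \<noteq> 0" "(pX \<odot> d2X) y (e, d) \<noteq> 0" "kmul d b = Some c"
        by (rule cmp_nonzeroE)
      from y(2) consider "e = I1" "y = ?y1" "d = UTsigma 0 1" | "e = I1" "y = ?y2" "d = UTtau 0 0"
        unfolding pd2X_nz by blast
      then show "op_of proj_crit_pert x (e, c) \<noteq> 0"
      proof cases
        case 1
        then show ?thesis using y(1,3) M1 w1 unfolding hX_nz by (auto simp: x)
      next
        case 2
        then show ?thesis using y(1,3) M2 w2 unfolding hX_nz by (auto simp: x)
      qed
    next
      assume q: "op_of proj_crit_pert x (e, c) \<noteq> 0"
      \<comment> \<open>The only path from \<open>x\<close>: the value of \<open>j\<close> tells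
        which of the two edges it passes through.\<close>
      define y0 b0 d0 where "y0 = (if j = 0 then ?y1 else ?y2)"
        and "b0 = (if j = 0 then WZ 0 (nat (s - 1)) else WZ (nat (- s)) 0)"
        and "d0 = (if j = 0 then UTsigma 0 1 else UTtau 0 0)"
      have "((pX \<odot> d2X) \<odot> hX) x (e, c) = hX x (y0, b0) * (pX \<odot> d2X) y0 (e, d0) * of_bool (kmul d0 b0 = Some c)"
      proof (rule cmp_single)
        fix y b d assume "hX x (y, b) \<noteq> 0" "(pX \<odot> d2X) y (e, d) \<noteq> 0"
        then show "y = y0 \<and> b = b0 \<and> d = d0"
          unfolding pd2X_nz hX_nz using M1 M2 w1 w2 by (auto simp: y0_def b0_def d0_def)
      qed
      moreover have "(pX \<odot> d2X) y0 (e, d0) \<noteq> 0" unfolding pd2X_nz using q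
        by (auto simp: x y0_def d0_def split: if_splits)
      moreover have "hX x (y0, b0) \<noteq> 0"
        unfolding hX_nz using M1 M2 w1 w2 q by (auto simp: y0_def b0_def x split: if_splits)
      moreover have "kmul d0 b0 = Some c" using q by (auto simp: x d0_def b0_def split: if_splits)
      ultimately show "((pX \<odot> d2X) \<odot> hX) x (e, c) \<noteq> 0" by simp
    qed
  qed
  then show ?thesis by (simp add: cmp_assoc)
qed

lemma d2iX_nz: "(d2X \<odot> iX) e (y, c) \<noteq> 0 \<longleftrightarrow>
    e = I0 \<and> (y = (I0, I1, I1, 0, - 1) \<and> c = UTsigma 0 0 \<or> y = (I0, I1, I1, 0, 0) \<and> c = UTtau 0 0)"
proof -
  let ?y0 = "(I0, I1, I0, 0, - 1) :: xgen"
  have split: "(d2X \<odot> iX) e (y, c) = (op_of (right dsigma) \<odot> iX) e (y, c) + (op_of (right dtau) \<odot> iX) e (y, c)"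
    by (simp add: d2X_def cmp_add_left del: bit_add_self)
  show ?thesis
  proof (cases e)
    case I0
    have "(op_of (right dsigma) \<odot> iX) e (y, c) = iX e (?y0, WZ 0 0) *
        of_bool (\<exists>d. right dsigma ?y0 = Some (y, d) \<and> kmul d (WZ 0 0) = Some c)"
      by (rule cmp_op_of_single) (auto simp: I0 iX_I0 simp del: bit_not_zero_iff)
    moreover have "(op_of (right dtau) \<odot> iX) e (y, c) = iX e (?y0, WZ 0 0) *
        of_bool (\<exists>d. right dtau ?y0 = Some (y, d) \<and> kmul d (WZ 0 0) = Some c)"
      by (rule cmp_op_of_single) (auto simp: I0 iX_I0 simp del: bit_not_zero_iff)
    moreover have "iX e (?y0, WZ 0 0) = 1" using iX_I0 by (simp add: I0)
    ultimately show ?thesis unfolding split by (auto simp: I0)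
  next
    case I1
    have "\<not> (d2X \<odot> iX) I1 (y, c) \<noteq> 0"
    proof
      assume "(d2X \<odot> iX) I1 (y, c) \<noteq> 0"
      then obtain y1 b d where "iX I1 (y1, b) \<noteq> 0" "d2X y1 (y, d) \<noteq> 0" by (rule cmp_nonzeroE)
      then show False using d2X_supp(1) unfolding iX_I1 by fastforce
    qed
    then show ?thesis by (simp add: I1)
  qed
qed

text \<open>The correction to the inclusion of the critical node. \<open>d2X\<close> sends it to
  node 0 of two adjacent rows, whose paths run right over s >= 0 and left over s < 0, so each
  \<open>s\<close> occurs exactly once.\<close>

lemma hd2iX_nz: "(hX \<odot> d2X \<odot> iX) e (z, c) \<noteq> 0 \<longleftrightarrow>
    e = I0 \<and> (\<exists>s. z = (I0, I0, I1, s, 0) \<and> c = (if s \<ge> 0 then UTsigma 0 (- s) else UTtau 0 (- s)))"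
proof -
  obtain l m r s j where z: "z = (l, m, r, s, j)" by (metis prod_cases5)
  let ?y1 = "(I0, I1, I1, 0, - 1) :: xgen" and ?y2 = "(I0, I1, I1, 0, 0) :: xgen"
  have M1: "Mh ?y1 z \<noteq> 0 \<longleftrightarrow> l = I0 \<and> m = I0 \<and> r = I1 \<and> j = 0 \<and> s \<ge> 0"
    by (auto simp: z Mh_def th_def hrel_def fwd_def bwd_def)
  have M2: "Mh ?y2 z \<noteq> 0 \<longleftrightarrow> l = I0 \<and> m = I0 \<and> r = I1 \<and> j = 0 \<and> s < 0"
    by (auto simp: z Mh_def th_def hrel_def fwd_def bwd_def)
  have w1: "wt (gr ?y1) (gr z) = UT 0 (- s)" if "l = I0 \<and> m = I0 \<and> r = I1 \<and> j = 0 \<and> s \<ge> 0"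
    using that by (simp add: z Let_def Th_def th_def algebra_simps)
  have w2: "wt (gr ?y2) (gr z) = UT 0 (- s)" if "l = I0 \<and> m = I0 \<and> r = I1 \<and> j = 0 \<and> s < 0"
    using that by (simp add: z Let_def Th_def th_def algebra_simps)
  show ?thesis
  proof
    assume "(hX \<odot> d2X \<odot> iX) e (z, c) \<noteq> 0"
    then obtain y b d where y: "(d2X \<odot> iX) e (y, b) \<noteq> 0" "hX y (z, d) \<noteq> 0" "kmul d b = Some c"
      by (rule cmp_nonzeroE)
    from y(1) consider "e = I0" "y = ?y1" "b = UTsigma 0 0" | "e = I0" "y = ?y2" "b = UTtau 0 0"
      unfolding d2iX_nz by blast
    then show "e = I0 \<and> (\<exists>s. z = (I0, I0, I1, s, 0) \<and> c = (if s \<ge> 0 then UTsigma 0 (- s) else UTtau 0 (- s)))"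
    proof cases
      case 1
      then show ?thesis using y(2,3) M1 w1 unfolding hX_nz by (auto simp: z)
    next
      case 2
      then show ?thesis using y(2,3) M2 w2 unfolding hX_nz by (auto simp: z)
    qed
  next
    assume *: "e = I0 \<and> (\<exists>s. z = (I0, I0, I1, s, 0) \<and> c = (if s \<ge> 0 then UTsigma 0 (- s) else UTtau 0 (- s)))"
    define y0 b0 where "y0 = (if s \<ge> 0 then ?y1 else ?y2)" and "b0 = (if s \<ge> 0 then UTsigma 0 0 else UTtau 0 0)"
    have "(hX \<odot> d2X \<odot> iX) e (z, c) = (d2X \<odot> iX) e (y0, b0) * hX y0 (z, UT 0 (- s)) *
        of_bool (kmul (UT 0 (- s)) b0 = Some c)"
    proof (rule cmp_single)
      fix y b d assume "(d2X \<odot> iX) e (y, b) \<noteq> 0" "hX y (z, d) \<noteq> 0"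
      then show "y = y0 \<and> b = b0 \<and> d = UT 0 (- s)"
        unfolding d2iX_nz hX_nz using M1 M2 w1 w2 by (auto simp: y0_def b0_def)
    qed
    moreover have "(d2X \<odot> iX) e (y0, b0) \<noteq> 0" unfolding d2iX_nz using * by (simp add: y0_def b0_def)
    moreover have "hX y0 (z, UT 0 (- s)) \<noteq> 0"
      unfolding hX_nz using M1 M2 w1 w2 * by (auto simp: y0_def z)
    moreover have "kmul (UT 0 (- s)) b0 = Some c" using * by (auto simp: z b0_def)
    ultimately show "(hX \<odot> d2X \<odot> iX) e (z, c) \<noteq> 0" by simp
  qed
qed


lemma w_simps: "s < 0 \<Longrightarrow> wA s = - s" "s < 0 \<Longrightarrow> wB s = - s - 1" "0 \<le> s \<Longrightarrow> wA s = 0" "0 \<le> s \<Longrightarrow> wB s = 0"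
  by (simp_all add: wA_def wB_def)

lemma proj_act_eval:
  "pcomp proj_crit (left (act a)) (I0, I1, I0, 0, - 1) = (case a of WZ p q \<Rightarrow> Some (I0, WZ q p) | _ \<Rightarrow> None)"
  "pcomp proj_crit (left (act a)) (I1, I0, I1, s, 0) =
     (case a of UT p k \<Rightarrow> if s = k then Some (I1, UT p 0) else None | _ \<Rightarrow> None)"
  "pcomp proj_crit (left (act a)) (I0, I0, I1, s, 0) =
     (case a of UTsigma p k \<Rightarrow> if s = k \<and> s < 0 then Some (I1, UT p 0) else None
      | UTtau p k \<Rightarrow> if s = k \<and> s \<ge> 0 then Some (I1, UT p 0) else None | _ \<Rightarrow> None)"
proof -
  show "pcomp proj_crit (left (act a)) (I0, I1, I0, 0, - 1) = (case a of WZ p q \<Rightarrow> Some (I0, WZ q p) | _ \<Rightarrow> None)"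
    by (cases a) (auto simp: pcomp_def wA_def)
  show "pcomp proj_crit (left (act a)) (I1, I0, I1, s, 0) =
     (case a of UT p k \<Rightarrow> if s = k then Some (I1, UT p 0) else None | _ \<Rightarrow> None)"
    by (cases a) (auto simp: pcomp_def w_simps)
  show "pcomp proj_crit (left (act a)) (I0, I0, I1, s, 0) =
     (case a of UTsigma p k \<Rightarrow> if s = k \<and> s < 0 then Some (I1, UT p 0) else None
      | UTtau p k \<Rightarrow> if s = k \<and> s \<ge> 0 then Some (I1, UT p 0) else None | _ \<Rightarrow> None)"
    by (cases a; cases "s < 0") (auto simp: pcomp_def w_simps)
qed

lemma proj_pert_act_eval:
  "pcomp proj_crit_pert (left (act a)) (I0, I1, I0, 0, - 1) =
     (case a of UTsigma p k \<Rightarrow> if k \<ge> 0 then Some (I1, UTtau p (- k)) else None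
      | UTtau p k \<Rightarrow> if k < 0 then Some (I1, UTsigma p (- k)) else None | _ \<Rightarrow> None)"
  "pcomp proj_crit_pert (left (act a)) (I1, I0, I1, s, 0) = None"
  by (cases a; auto simp: pcomp_def wA_def wB_def)+

definition muE :: "kmon \<Rightarrow> (idem, idem) op" where
  "muE a = op_of (\<lambda>e. if krid a = e then Some (klid a, E_mon a) else None)"

text \<open>The term p m i gives E on the two polynomial parts of the algebra. For U^p T^k \<sigma>
  the corrected inclusion contributes if k < 0 and the corrected projection if k >= 0; for U^p T^k
  \<tau> it is the other way round.\<close>

lemma pmiX: "pX \<odot> mX a \<odot> iX + pX \<odot> mX a \<odot> hX \<odot> d2X \<odot> iX + (pX \<odot> d2X \<odot> hX) \<odot> mX a \<odot> iX = muE a"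
proof -
  let ?P = "pcomp proj_crit (left (act a))" and ?Q = "pcomp proj_crit_pert (left (act a))"
  let ?y0 = "(I0, I1, I0, 0, - 1) :: xgen" and ?y1 = "\<lambda>k. (I1, I0, I1, k, 0) :: xgen"
    and ?y2 = "\<lambda>k. (I0, I0, I1, k, 0) :: xgen"
  have P: "pX \<odot> mX a = op_of ?P" by (simp add: pX_eq mX_def cmp_op_of)
  have Q: "(pX \<odot> d2X \<odot> hX) \<odot> mX a = op_of ?Q" by (simp add: pd2hX mX_def cmp_op_of)
  have cQ: "cont_op (pX \<odot> d2X \<odot> hX)" by (intro cont_op_cmp contX cont_X')
  have sum: "pX \<odot> mX a \<odot> iX + pX \<odot> mX a \<odot> hX \<odot> d2X \<odot> iX + (pX \<odot> d2X \<odot> hX) \<odot> mX a \<odot> iX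
      = op_of ?P \<odot> iX + op_of ?P \<odot> (hX \<odot> d2X \<odot> iX) + op_of ?Q \<odot> iX"
    unfolding P[symmetric] Q[symmetric] using cQ by (simp add: cmp_assoc cont_op_cmp)
  have i0: "iX I0 (?y0, WZ 0 0) = 1" using iX_I0 by simp
  have i1: "iX I1 (?y1 k, UT 0 (- k)) = 1" for k using iX_I1 by simp
  have w: "(hX \<odot> d2X \<odot> iX) I0 (?y2 k, if k \<ge> 0 then UTsigma 0 (- k) else UTtau 0 (- k)) = 1" for k
    using hd2iX_nz by auto
  \<comment> \<open>An input with T exponent \<open>k\<close> moves the generator at position
    \<open>k\<close> to position 0, where the critical edge sits. This selects one summand from the
    infinite sums.\<close>
  define k where "k = (case a of UT p k \<Rightarrow> k | UTsigma p k \<Rightarrow> k | UTtau p k \<Rightarrow> k | _ \<Rightarrow> 0)"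
  have T1: "(op_of ?P \<odot> iX) I0 (z, c) = iX I0 (?y0, WZ 0 0) *
      of_bool (\<exists>d. ?P ?y0 = Some (z, d) \<and> kmul d (WZ 0 0) = Some c)" for z c
    by (rule cmp_op_of_single) (unfold iX_I0, blast)
  have T1': "(op_of ?P \<odot> iX) I1 (z, c) = iX I1 (?y1 k, UT 0 (- k)) *
      of_bool (\<exists>d. ?P (?y1 k) = Some (z, d) \<and> kmul d (UT 0 (- k)) = Some c)" for z c
    by (rule cmp_op_of_single, unfold iX_I1) (auto simp: proj_act_eval k_def split: kmon.splits if_splits)
  have T3: "(op_of ?Q \<odot> iX) I0 (z, c) = iX I0 (?y0, WZ 0 0) *
      of_bool (\<exists>d. ?Q ?y0 = Some (z, d) \<and> kmul d (WZ 0 0) = Some c)" for z c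
    by (rule cmp_op_of_single) (unfold iX_I0, blast)
  have T3': "(op_of ?Q \<odot> iX) I1 (z, c) = iX I1 (?y1 k, UT 0 (- k)) *
      of_bool (\<exists>d. ?Q (?y1 k) = Some (z, d) \<and> kmul d (UT 0 (- k)) = Some c)" for z c
    by (rule cmp_op_of_single, unfold iX_I1) (auto simp: proj_pert_act_eval)
  have T2: "(op_of ?P \<odot> (hX \<odot> d2X \<odot> iX)) e (z, c) =
      (hX \<odot> d2X \<odot> iX) e (?y2 k, if k \<ge> 0 then UTsigma 0 (- k) else UTtau 0 (- k)) *
      of_bool (\<exists>d. ?P (?y2 k) = Some (z, d) \<and> kmul d (if k \<ge> 0 then UTsigma 0 (- k) else UTtau 0 (- k)) = Some c)"
    for e z c
    by (rule cmp_op_of_single, unfold hd2iX_nz) (auto simp: proj_act_eval k_def split: kmon.splits if_splits)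
  have w': "(hX \<odot> d2X \<odot> iX) I1 t = 0" for t
    using hd2iX_nz[of I1] by (cases t) auto
  have "(op_of ?P \<odot> iX + op_of ?P \<odot> (hX \<odot> d2X \<odot> iX) + op_of ?Q \<odot> iX) e (z, c) = muE a e (z, c)" for e z c
  proof (cases e)
    case I0
    show ?thesis unfolding I0 plus_fun_apply T1 T2 T3 i0 w
      by (cases a) (auto simp: proj_act_eval proj_pert_act_eval k_def muE_def op_of_def)
  next
    case I1
    show ?thesis unfolding I1 plus_fun_apply T1' T2 T3' i1 w'
      by (cases a) (auto simp: proj_act_eval proj_pert_act_eval k_def muE_def op_of_def)
  qed
  then show ?thesis unfolding sum by (intro ext) (metis prod.collapse)
qed

lemma strict_bimodule_E: "strict_bimodule UNIV (\<lambda>e. e) (\<lambda>e. e) 0 muE"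
proof -
  have E_idem: "krid (E_mon a) = krid a" "klid (E_mon a) = klid a" for a by (cases a; simp)+
  have E_ideal: "a \<in> kideal n \<Longrightarrow> E_mon a \<in> kideal n" for a n by (cases a) (auto simp: kideal_def)
  have nz: "muE a e (e', c) \<noteq> 0 \<longleftrightarrow> krid a = e \<and> klid a = e' \<and> c = E_mon a" for a e e' c
    by (auto simp: muE_def)
  have "cont_op (muE a)" for a unfolding muE_def by (rule cont_op_of) (simp add: pinj_def)
  then have hom: "khom UNIV (\<lambda>e. e) UNIV (\<lambda>e. e) (muE a)" for a
    by (rule khomI) (auto simp: nz E_idem simp del: bit_not_zero_iff)
  have "unif_op muE" unfolding unif_op_def nz using E_ideal by blast
  with hom have "op_map UNIV (\<lambda>e. e) (\<lambda>e. e) UNIV (\<lambda>e. e) (\<lambda>e. e) 0 muE"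
    unfolding op_map_def nz by simp
  moreover have "muE a \<odot> muE b = (case kmul a b of None \<Rightarrow> 0 | Some c \<Rightarrow> muE c)" for a b
  proof -
    have "pcomp (\<lambda>e. if krid a = e then Some (klid a, E_mon a) else None)
        (\<lambda>e. if krid b = e then Some (klid b, E_mon b) else None) e =
        (case kmul a b of None \<Rightarrow> None | Some c \<Rightarrow> if krid c = e then Some (klid c, E_mon c) else None)" for e
    proof (cases "kmul a b")
      case None
      then have "krid a \<noteq> klid b" by (simp add: kmul_eq_None_iff)
      then show ?thesis by (simp add: pcomp_def None)
    next
      case (Some c)
      then show ?thesis using kmul_Some_idem[OF Some] by (simp add: pcomp_def E_mon_kmul)
    qed
    then show ?thesis unfolding muE_def cmp_op_of by (auto simp: op_of_def fun_eq_iff split: option.split)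
  qed
  moreover have "muE (kone e) x t = of_bool (x \<in> UNIV \<and> x = e \<and> t = (x, kone x))" for e x t
    by (cases e) (auto simp: muE_def op_of_def)
  ultimately show ?thesis unfolding strict_bimodule_def by (intro conjI allI) simp_all
qed

interpretation model: perturbation UNIV lidx ridx d1X d2X mX UNIV "\<lambda>e. e" "\<lambda>e. e" muE iX pX hX
proof
  show "khom UNIV ridx UNIV ridx d1X" "khom UNIV ridx UNIV ridx d2X"
    using d1X_supp(4,5) d2X_supp(4,5) by (intro khomI cont_X'; simp del: bit_not_zero_iff)+
  show "khom UNIV (\<lambda>e. e) UNIV ridx iX"
    using iX_supp(2,3) by (intro khomI contX) blast
  show "khom UNIV ridx UNIV (\<lambda>e. e) pX"
    using pX_supp(2,3) by (intro khomI contX) blast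
  show "khom UNIV ridx UNIV ridx hX"
    using hX_supp(5,6) by (intro khomI contX) blast
  show "lpres lidx lidx d2X" "lpres (\<lambda>e. e) lidx iX" "lpres lidx (\<lambda>e. e) pX" "lpres lidx lidx hX"
    unfolding lpres_def using d2X_supp(6) iX_supp(1) pX_supp(1) hX_supp(4) by blast+
  show "hX \<odot> hX = 0"
    by (rule cmp_eq_zeroI) (metis hX_supp(1,2) idem.distinct(1))
  show "hX \<odot> d2X \<odot> hX = 0" by (rule hX_cmp_hX) (rule d2X_supp(3))
  show "hX \<odot> mX a \<odot> hX = 0" for a by (rule hX_cmp_hX) (rule mX_supp(1))
  show "hX \<odot> d1X + d1X \<odot> hX = id_op UNIV ridx + iX \<odot> pX" by (rule homotopy_X)
  show "pX \<odot> mX a \<odot> iX + pX \<odot> mX a \<odot> hX \<odot> d2X \<odot> iX + (pX \<odot> d2X \<odot> hX) \<odot> mX a \<odot> iX = muE a" for a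
    by (rule pmiX)
qed (rule strict_bimodule_X strict_bimodule_E d1X_d2X d2X_d2X d1iX pd1X piX hiX phX d2hd2X pd2iX pmhmiX)+

section \<open>Transport of retractions\<close>

text \<open>\<open>B\<close> confines the matrix to actual generators, as the coordinates
  \<open>k\<close> are functions on a whole type; \<open>t\<close> twists the outputs, as a box
  product with [E] on the right does.\<close>

definition pullback :: "'x set \<Rightarrow> ('x \<Rightarrow> 'u) \<Rightarrow> 'y set \<Rightarrow> ('y \<Rightarrow> 'v) \<Rightarrow> (kmon \<Rightarrow> kmon) \<Rightarrow> ('u, 'v) op \<Rightarrow> ('x, 'y) op" where
  "pullback B k B' k' t F x = (\<lambda>(y, b). if x \<in> B \<and> y \<in> B' then F (k x) (k' y, t b) else 0)"

lemma pullback_add: "pullback B k B' k' t (F + G) = pullback B k B' k' t F + pullback B k B' k' t G"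
  by (rule ext, rule ext, clarify) (simp add: pullback_def)

lemma pullback_zero [simp]: "pullback B k B' k' t 0 = 0"
  by (rule ext, rule ext, clarify) (simp add: pullback_def)

lemma pullback_nonzero: "pullback B k B' k' t F x (y, b) \<noteq> 0 \<longleftrightarrow> x \<in> B \<and> y \<in> B' \<and> F (k x) (k' y, t b) \<noteq> 0"
  by (auto simp: pullback_def)

locale monomial_involution =
  fixes t :: "kmon \<Rightarrow> kmon"
  assumes invol [simp]: "t (t b) = b"
    and t_kmul: "kmul (t a) (t b) = map_option t (kmul a b)"
    and t_ideal: "b \<in> kideal n \<Longrightarrow> t b \<in> kideal n"
    and t_idem [simp]: "krid (t b) = krid b" "klid (t b) = klid b"
    and t_kone [simp]: "t (kone e) = kone e"
begin

lemma t_eq_iff: "t a = b \<longleftrightarrow> a = t b" by (metis invol)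

text \<open>The intermediate sum of the model runs over a whole type and is reindexed by the inverse
  of k'; \<open>t\<close> carries products to products.\<close>

lemma pullback_cmp:
  assumes bij: "bij_betw k' B' UNIV"
  shows "pullback B k B'' k'' t (G \<odot> F) = pullback B' k' B'' k'' t G \<odot> pullback B k B' k' t F"
proof (rule ext, rule ext, clarify)
  fix x z c
  show "pullback B k B'' k'' t (G \<odot> F) x (z, c) = (pullback B' k' B'' k'' t G \<odot> pullback B k B' k' t F) x (z, c)"
  proof (cases "x \<in> B \<and> z \<in> B''")
    case True
    let ?i = "inv_into B' k'"
    have i: "?i y \<in> B'" "k' (?i y) = y" for y
      using bij by (metis UNIV_I bij_betw_imp_surj_on inv_into_into f_inv_into_f)+
    have i': "y \<in> B' \<Longrightarrow> ?i (k' y) = y" for y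
      using bij by (simp add: bij_betw_inv_into_left)
    have kmul: "kmul (t d) (t b) = Some c \<longleftrightarrow> kmul d b = Some (t c)" for d b
      by (cases "kmul d b") (auto simp: t_kmul t_eq_iff)
    have "(G \<odot> F) (k x) (k'' z, t c) =
      Sum_any (\<lambda>(y, b, d). pullback B k B' k' t F x (y, b) * pullback B' k' B'' k'' t G y (z, d) * of_bool (kmul d b = Some c))"
      unfolding cmp_apply
    proof (rule Sum_any_bij_witness[where i = "\<lambda>(y, b, d). (?i y, t b, t d)" and j = "\<lambda>(y, b, d). (k' y, t b, t d)"])
      fix a assume "(case a of (y, b, d) \<Rightarrow> F (k x) (y, b) * G y (k'' z, d) * of_bool (kmul d b = Some (t c))) \<noteq> 0"
      then show "(case case a of (y, b, d) \<Rightarrow> (?i y, t b, t d) of (y, b, d) \<Rightarrow> (k' y, t b, t d)) = a \<and>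
         (case case a of (y, b, d) \<Rightarrow> (?i y, t b, t d) of (y, b, d) \<Rightarrow>
           pullback B k B' k' t F x (y, b) * pullback B' k' B'' k'' t G y (z, d) * of_bool (kmul d b = Some c)) =
         (case a of (y, b, d) \<Rightarrow> F (k x) (y, b) * G y (k'' z, d) * of_bool (kmul d b = Some (t c)))"
        using True by (cases a) (auto simp: pullback_def i kmul)
    next
      fix a assume "(case a of (y, b, d) \<Rightarrow> pullback B k B' k' t F x (y, b) * pullback B' k' B'' k'' t G y (z, d) *
          of_bool (kmul d b = Some c)) \<noteq> 0"
      then show "(case case a of (y, b, d) \<Rightarrow> (k' y, t b, t d) of (y, b, d) \<Rightarrow> (?i y, t b, t d)) = a \<and>
         (case case a of (y, b, d) \<Rightarrow> (k' y, t b, t d) of (y, b, d) \<Rightarrow>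
           F (k x) (y, b) * G y (k'' z, d) * of_bool (kmul d b = Some (t c))) =
         (case a of (y, b, d) \<Rightarrow> pullback B k B' k' t F x (y, b) * pullback B' k' B'' k'' t G y (z, d) * of_bool (kmul d b = Some c))"
        using True kmul by (cases a) (auto simp: pullback_def i' t_kmul t_eq_iff split: if_splits)
    qed
    then show ?thesis using True by (simp add: pullback_def cmp_apply)
  next
    case False
    have "(pullback B' k' B'' k'' t G \<odot> pullback B k B' k' t F) x (z, c) = 0"
    proof (rule ccontr)
      assume "(pullback B' k' B'' k'' t G \<odot> pullback B k B' k' t F) x (z, c) \<noteq> 0"
      then show False by (rule cmp_nonzeroE) (use False in \<open>auto simp: pullback_nonzero simp del: bit_not_zero_iff\<close>)
    qed
    then show ?thesis using False by (auto simp: pullback_def)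
  qed
qed

lemma pullback_id:
  assumes "inj_on k B" "\<And>x. x \<in> B \<Longrightarrow> r0 x = r (k x)"
  shows "pullback B k B k t (id_op UNIV r) = id_op B r0"
  by (rule ext, rule ext, clarify) (use assms in \<open>auto simp: pullback_def id_op_def t_eq_iff dest: inj_onD\<close>)

lemma cont_pullback:
  assumes "cont_op F" "inj_on k B"
  shows "cont_op (pullback B k B' k' t F)"
  unfolding cont_op_def
proof (intro allI)
  fix y n
  let ?S = "{(x, b). pullback B k B' k' t F x (y, b) \<noteq> 0 \<and> b \<notin> kideal n}"
  have "inj_on (\<lambda>(x, b). (k x, t b)) ?S"
    using assms(2) by (auto simp: inj_on_def pullback_nonzero simp del: bit_not_zero_iff) (metis invol)
  moreover have "(\<lambda>(x, b). (k x, t b)) ` ?S \<subseteq> {(x, b). F x (k' y, b) \<noteq> 0 \<and> b \<notin> kideal n}"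
    using t_ideal by (fastforce simp: pullback_nonzero simp del: bit_not_zero_iff)
  ultimately show "finite ?S"
    by (rule inj_on_finite) (rule cont_opD[OF assms(1)])
qed

lemma khom_pullback:
  assumes F: "khom UNIV r UNIV r' F" and "inj_on k B"
    and r: "\<And>x. x \<in> B \<Longrightarrow> r0 x = r (k x)" "\<And>y. y \<in> B' \<Longrightarrow> r0' y = r' (k' y)"
  shows "khom B r0 B' r0' (pullback B k B' k' t F)"
proof (rule khomI)
  show "cont_op (pullback B k B' k' t F)" by (rule cont_pullback[OF khom_cont[OF F] assms(2)])
  fix x y b assume "pullback B k B' k' t F x (y, b) \<noteq> 0"
  then show "x \<in> B \<and> y \<in> B' \<and> krid b = r0 x \<and> klid b = r0' y"
    using khomD[OF F, of "k x" "k' y" "t b"] r by (auto simp: pullback_nonzero simp del: bit_not_zero_iff)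
qed

lemma lpres_pullback:
  assumes "lpres l l' F" "\<And>x. x \<in> B \<Longrightarrow> l0 x = l (k x)" "\<And>y. y \<in> B' \<Longrightarrow> l0' y = l' (k' y)"
  shows "lpres l0 l0' (pullback B k B' k' t F)"
  using assms unfolding lpres_def pullback_nonzero by metis

lemma unif_pullback:
  assumes "unif_op F"
  shows "unif_op (\<lambda>a. pullback B k B' k' t (F a))"
  unfolding unif_op_def pullback_nonzero
proof (intro allI)
  fix y n
  obtain N where "\<And>a x b. a \<in> kideal N \<Longrightarrow> F a x (k' y, b) \<noteq> 0 \<Longrightarrow> b \<in> kideal n"
    using assms unfolding unif_op_def by metis
  then show "\<exists>N. \<forall>a\<in>kideal N. \<forall>x b. x \<in> B \<and> y \<in> B' \<and> F a (k x) (k' y, t b) \<noteq> 0 \<longrightarrow> b \<in> kideal n"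
    using t_ideal by (metis invol)
qed

lemma strict_bimodule_pullback:
  assumes sb: "strict_bimodule UNIV l r d m" and bij: "bij_betw k B UNIV"
    and l: "\<And>x. x \<in> B \<Longrightarrow> l0 x = l (k x)" and r: "\<And>x. x \<in> B \<Longrightarrow> r0 x = r (k x)"
  shows "strict_bimodule B l0 r0 (pullback B k B k t d) (\<lambda>a. pullback B k B k t (m a))"
proof -
  have inj: "inj_on k B" using bij by (simp add: bij_betw_def)
  have op: "op_map UNIV l r UNIV l r d m" and dd: "d \<odot> d = 0"
    and md: "\<And>a. m a \<odot> d = d \<odot> m a"
    and mult: "\<And>a b. m a \<odot> m b = (case kmul a b of None \<Rightarrow> 0 | Some c \<Rightarrow> m c)"
    and one: "\<And>e x s. m (kone e) x s = of_bool (x \<in> UNIV \<and> l x = e \<and> s = (x, kone (r x)))"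
    using sb unfolding strict_bimodule_def by blast+
  have "op_map B l0 r0 B l0 r0 (pullback B k B k t d) (\<lambda>a. pullback B k B k t (m a))"
    unfolding op_map_def
  proof (intro conjI allI impI)
    show "khom B r0 B r0 (pullback B k B k t d)" "khom B r0 B r0 (pullback B k B k t (m a))" for a
      using op r by (auto simp: op_map_def intro!: khom_pullback[OF _ inj])
    show "unif_op (\<lambda>a. pullback B k B k t (m a))" using op by (intro unif_pullback) (simp add: op_map_def)
    show "l0 y = l0 x" if "pullback B k B k t d x (y, b) \<noteq> 0" for x y b
      using that op l unfolding pullback_nonzero op_map_def by metis
    show "krid a = l0 x" "klid a = l0 y" if "pullback B k B k t (m a) x (y, b) \<noteq> 0" for a x y b
      using that op l unfolding pullback_nonzero op_map_def by metis+
  qed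
  moreover have "pullback B k B k t (m a) \<odot> pullback B k B k t (m b) = (case kmul a b of None \<Rightarrow> 0 | Some c \<Rightarrow> pullback B k B k t (m c))" for a b
    unfolding pullback_cmp[OF bij, symmetric] mult by (simp split: option.split)
  moreover have "pullback B k B k t (m (kone e)) x s = of_bool (x \<in> B \<and> l0 x = e \<and> s = (x, kone (r0 x)))" for e x s
    using inj by (cases s) (auto simp: pullback_def one l r t_eq_iff dest: inj_onD)
  ultimately show ?thesis
    unfolding strict_bimodule_def by (auto simp: dd md simp flip: pullback_cmp[OF bij])
qed

text \<open>The equations of a retraction involve composition, sum, zero and identity, all of which
  \<open>pullback\<close> respects.\<close>

lemma retraction_pullback:
  assumes ret: "retraction UNIV l r d m UNIV l' r' \<mu> i p h"
    and k: "bij_betw k B UNIV" and k': "bij_betw k' B' UNIV"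
    and l: "\<And>x. x \<in> B \<Longrightarrow> l0 x = l (k x)" and r: "\<And>x. x \<in> B \<Longrightarrow> r0 x = r (k x)"
    and l': "\<And>x. x \<in> B' \<Longrightarrow> l0' x = l' (k' x)" and r': "\<And>x. x \<in> B' \<Longrightarrow> r0' x = r' (k' x)"
  shows "retraction B l0 r0 (pullback B k B k t d) (\<lambda>a. pullback B k B k t (m a)) B' l0' r0' (\<lambda>a. pullback B' k' B' k' t (\<mu> a))
     (pullback B' k' B k t i) (pullback B k B' k' t p) (pullback B k B k t h)"
proof -
  interpret retraction UNIV l r d m UNIV l' r' \<mu> i p h by (rule ret)
  have inj: "inj_on k B" "inj_on k' B'" using k k' by (simp_all add: bij_betw_def)
  note pullback = pullback_cmp[OF k, symmetric] pullback_cmp[OF k', symmetric]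
  show ?thesis
  proof
    show "strict_bimodule B l0 r0 (pullback B k B k t d) (\<lambda>a. pullback B k B k t (m a))"
      by (rule strict_bimodule_pullback[OF X k l r])
    show "strict_bimodule B' l0' r0' 0 (\<lambda>a. pullback B' k' B' k' t (\<mu> a))"
      using strict_bimodule_pullback[OF Y k' l' r'] by simp
    show "khom B' r0' B r0 (pullback B' k' B k t i)" by (rule khom_pullback[OF i(1) inj(2) r' r])
    show "khom B r0 B' r0' (pullback B k B' k' t p)" by (rule khom_pullback[OF p(1) inj(1) r r'])
    show "khom B r0 B r0 (pullback B k B k t h)" by (rule khom_pullback[OF h(1) inj(1) r r])
    show "lpres l0' l0 (pullback B' k' B k t i)" by (rule lpres_pullback[OF i(2) l' l])
    show "lpres l0 l0' (pullback B k B' k' t p)" by (rule lpres_pullback[OF p(2) l l'])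
    show "lpres l0 l0 (pullback B k B k t h)" by (rule lpres_pullback[OF h(2) l l])
    have id: "id_op B r0 = pullback B k B k t (id_op UNIV r)" "id_op B' r0' = pullback B' k' B' k' t (id_op UNIV r')"
      using pullback_id[where r = r and ?r0.0 = r0, OF inj(1) r] pullback_id[where r = r' and ?r0.0 = r0', OF inj(2) r'] by simp_all
    show "pullback B k B' k' t p \<odot> pullback B' k' B k t i = id_op B' r0'" by (simp add: pullback pi id)
    show "pullback B k B k t h \<odot> pullback B k B k t d + pullback B k B k t d \<odot> pullback B k B k t h =
        id_op B r0 + pullback B' k' B k t i \<odot> pullback B k B' k' t p"
      unfolding pullback pullback_add[symmetric] homotopy id ..
  qed (simp_all add: pullback di pd hh hi ph hmh pmi pmhmi)
qed

end

lemma involution_id: "monomial_involution (\<lambda>b. b)"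
  by standard (simp_all add: option.map_ident)

lemma involution_E: "monomial_involution E_mon"
proof
  fix a b :: kmon and n e
  show "E_mon (E_mon b) = b" by (cases b) auto
  show "kmul (E_mon a) (E_mon b) = map_option E_mon (kmul a b)" by (rule E_mon_kmul)
  show "b \<in> kideal n \<Longrightarrow> E_mon b \<in> kideal n" by (cases b) (auto simp: kideal_def)
  show "krid (E_mon b) = krid b" "klid (E_mon b) = klid b" by (cases b; simp)+
  show "E_mon (kone e) = kone e" by (cases e) auto
qed

section \<open>Coordinates on the Hopf link bimodule\<close>

text \<open>The offset 1 for \<open>Z00\<close> but not for \<open>Z01\<close> reflects that Z^0_00
  and W^0_00 are distinct, while Z^0_01 = W^0_01.\<close>

fun kap :: "hgen \<Rightarrow> hgen'" where
  "kap (W00 i) = (I0, I0, int i)"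
| "kap (Z00 i) = (I0, I0, - 1 - int i)"
| "kap (W01 i) = (I0, I1, int i)"
| "kap (Z01 i) = (I0, I1, - int i)"
| "kap (T10 i) = (I1, I0, - i)"
| "kap (T11 i) = (I1, I1, - i)"

lemma kap_bij: "bij_betw kap hgens UNIV"
proof (rule bij_betwI')
  fix x y assume "x \<in> hgens" "y \<in> hgens"
  then show "kap x = kap y \<longleftrightarrow> x = y"
    by (cases x; cases y) (auto simp: hgens_def)
next
  fix v :: hgen'
  obtain l r s where v: "v = (l, r, s)" by (metis prod_cases3)
  define x where "x = (if l = I0 then if r = I0 then if s \<ge> 0 then W00 (nat s) else Z00 (nat (- 1 - s))
      else if s \<ge> 0 then W01 (nat s) else Z01 (nat (- s)) else if r = I0 then T10 (- s) else T11 (- s))"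
  have "x \<in> hgens" "v = kap x" by (auto simp: v x_def hgens_def)
  then show "\<exists>x\<in>hgens. v = kap x" by blast
qed simp

lemma kap_inj: "x \<in> hgens \<Longrightarrow> y \<in> hgens \<Longrightarrow> kap x = kap y \<longleftrightarrow> x = y"
  using kap_bij by (auto simp: bij_betw_def inj_on_def)

lemma hlid_kap: "hlid x = fst (kap x)" and hrid_kap: "hrid x = fst (snd (kap x))"
  by (cases x; simp)+

section \<open>Agreement of the action by words with the closed formula\<close>

fun kgmon :: "kgen \<Rightarrow> kmon" where
  "kgmon gW = WZ 1 0"
| "kgmon gZ = WZ 0 1"
| "kgmon gsigma = UTsigma 0 0"
| "kgmon gtau = UTtau 0 0"
| "kgmon gU = UT 1 0"
| "kgmon gT = UT 0 1"
| "kgmon gTinv = UT 0 (- 1)"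

text \<open>Besides the values it carries the information that results stay inside
  \<open>hgens\<close>, where \<open>kap\<close> is injective; this is what makes the induction
  along a word go through.\<close>

definition coords :: "(hgen \<times> kmon) option \<Rightarrow> (hgen' \<times> kmon) option \<Rightarrow> bool" where
  "coords s v \<longleftrightarrow> map_option (map_prod kap id) s = v \<and> (\<forall>y b. s = Some (y, b) \<longrightarrow> y \<in> hgens)"

lemma coords_h_act: "x \<in> hgens \<Longrightarrow> coords (h_act g x) (act (kgmon g) (kap x))"
  by (cases g; cases x) (auto simp: coords_def hgens_def z01_def wA_def wB_def nat_diff_distrib)

lemma coords_h_step:
  assumes "coords s v"
  shows "coords (Option.bind s (h_step g)) (Option.bind v (\<lambda>(y, b).
     Option.bind (act (kgmon g) y) (\<lambda>(z, d). map_option (Pair z) (kmul d b))))"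
proof (cases s)
  case None
  then show ?thesis using assms by (auto simp: coords_def)
next
  case (Some yb)
  then obtain y b where s: "s = Some (y, b)" by (cases yb) auto
  then have y: "y \<in> hgens" and v: "v = Some (kap y, b)" using assms by (auto simp: coords_def)
  show ?thesis
  proof (cases "h_act g y")
    case None
    then have "act (kgmon g) (kap y) = None" using coords_h_act[OF y, of g] by (simp add: coords_def)
    then show ?thesis using None by (simp add: s v coords_def h_step_def)
  next
    case (Some zd)
    then obtain z d where h: "h_act g y = Some (z, d)" by (cases zd) auto
    then have "z \<in> hgens" "act (kgmon g) (kap y) = Some (kap z, d)"
      using coords_h_act[OF y, of g] by (auto simp: coords_def)
    with h show ?thesis by (cases "kmul d b") (auto simp: s v coords_def h_step_def)
  qed
qed

text \<open>\<open>act\<close> is multiplicative on all monomials, so following a word letter by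
  letter amounts to acting by its product, and agreement on algebra generators is enough.\<close>

lemma coords_word:
  assumes "coords s (act c v)"
  shows "coords (foldr (\<lambda>g s. Option.bind s (h_step g)) gs s)
     (Option.bind (foldr (\<lambda>g o'. Option.bind o' (kmul (kgmon g))) gs (Some c)) (\<lambda>a. act a v))"
proof (induction gs)
  case Nil
  then show ?case using assms by simp
next
  case (Cons g gs)
  show ?case
  proof (cases "foldr (\<lambda>g o'. Option.bind o' (kmul (kgmon g))) gs (Some c)")
    case None
    with Cons show ?thesis by (simp add: coords_def)
  next
    case (Some a)
    with Cons have "coords (foldr (\<lambda>g s. Option.bind s (h_step g)) gs s) (act a v)" by simp
    from coords_h_step[OF this, of g] show ?thesis
      using act_mult[of "kgmon g" a v] by (simp add: Some pcomp_def)
  qed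
qed

abbreviation word_prod :: "kgen list \<Rightarrow> kmon \<Rightarrow> kmon option" where
  "word_prod gs c \<equiv> foldr (\<lambda>g o'. Option.bind o' (kmul (kgmon g))) gs (Some c)"

lemma word_prod_replicate:
  "word_prod (replicate n gW) (WZ a b) = Some (WZ (n + a) b)"
  "word_prod (replicate n gZ) (WZ a b) = Some (WZ a (n + b))"
  "word_prod (replicate n gU) (UT a k) = Some (UT (n + a) k)"
  "word_prod (replicate n gT) (UT a k) = Some (UT a (int n + k))"
  "word_prod (replicate n gTinv) (UT a k) = Some (UT a (- int n + k))"
  "word_prod (replicate n gU) (UTsigma a k) = Some (UTsigma (n + a) k)"
  "word_prod (replicate n gT) (UTsigma a k) = Some (UTsigma a (int n + k))"
  "word_prod (replicate n gTinv) (UTsigma a k) = Some (UTsigma a (- int n + k))"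
  "word_prod (replicate n gU) (UTtau a k) = Some (UTtau (n + a) k)"
  "word_prod (replicate n gT) (UTtau a k) = Some (UTtau a (int n + k))"
  "word_prod (replicate n gTinv) (UTtau a k) = Some (UTtau a (- int n + k))"
  by (induction n; simp)+

lemma word_prod_gen_word: "word_prod (gen_word a) (kone (krid a)) = Some a"
  by (cases a) (auto simp: ut_word_def word_prod_replicate simp del: foldr_replicate)

lemma coords_h_delta2:
  assumes x: "x \<in> hgens"
  shows "coords (h_delta2 a x) (act a (kap x))"
proof (cases "krid a = hlid x")
  case True
  have "coords (Some (x, kone (hrid x))) (act (kone (hlid x)) (kap x))"
    using x by (simp add: act_kone coords_def hlid_kap hrid_kap)
  from coords_word[OF this, of "gen_word a"] show ?thesis
    using True word_prod_gen_word[of a] by (simp add: h_delta2_def)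
next
  case False
  then show ?thesis using act_None[of a "kap x"] by (simp add: h_delta2_def coords_def hlid_kap)
qed

lemma h_delta2_iff:
  assumes "x \<in> hgens"
  shows "h_delta2 a x = Some (y, b) \<longleftrightarrow> y \<in> hgens \<and> act a (kap x) = Some (kap y, b)"
proof
  assume "h_delta2 a x = Some (y, b)"
  then show "y \<in> hgens \<and> act a (kap x) = Some (kap y, b)"
    using coords_h_delta2[OF assms, of a] by (auto simp: coords_def)
next
  assume *: "y \<in> hgens \<and> act a (kap x) = Some (kap y, b)"
  then obtain y' where "h_delta2 a x = Some (y', b)" "kap y' = kap y" "y' \<in> hgens"
    using coords_h_delta2[OF assms, of a] by (auto simp: coords_def)
  with * kap_inj show "h_delta2 a x = Some (y, b)" by simp
qed

lemma h_delta1_iff: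
  assumes "x \<in> hgens"
  shows "(y, b) \<in> h_delta1 x \<longleftrightarrow>
     y \<in> hgens \<and> (dsigma (kap x) = Some (kap y, b) \<or> dtau (kap x) = Some (kap y, b))"
proof (cases "y \<in> hgens")
  case True
  with assms show ?thesis by (cases x; cases y) (auto simp: hgens_def z01_def split: if_splits)
next
  case False
  then have "y = Z01 0" by (simp add: hgens_def)
  then show ?thesis using False by (cases x) (auto simp: z01_def split: if_splits)
qed

definition dH :: "(hgen', hgen') op" where "dH = op_of dsigma + op_of dtau"

text \<open>The two terms differ, so they do not cancel modulo 2, and the set of terms in the
  bimodule becomes a sum of operators.\<close>

lemma dH_apply: "dH x t = of_bool (dsigma x = Some t \<or> dtau x = Some t)"
proof -
  have "\<not> (dsigma x = Some t \<and> dtau x = Some t)"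
    by (cases x rule: dsigma.cases) auto
  then show ?thesis by (auto simp: dH_def op_of_def)
qed

lemma delta_H_minus:
  "delta H_minus = maps (pullback hgens kap hgens kap (\<lambda>b. b) dH) (\<lambda>a. pullback hgens kap hgens kap (\<lambda>b. b) (op_of (act a)))"
proof (rule ext, rule ext, rule ext, clarify)
  fix as x y b
  show "delta H_minus as x (y, b) =
    maps (pullback hgens kap hgens kap (\<lambda>b. b) dH) (\<lambda>a. pullback hgens kap hgens kap (\<lambda>b. b) (op_of (act a))) as x (y, b)"
    by (cases as rule: input_cases)
       (auto simp: H_minus_def pullback_def h_delta1_iff h_delta2_iff dH_apply op_of_def)
qed

section \<open>Box products with the Hopf link bimodule\<close>

lemma delta_iter_single: "delta_iter X [b] as x x' = delta X as x (x', b)"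
proof -
  have "Sum_any (\<lambda>y. delta_iter X [] (drop i as) x y * delta X (take i as) y (x', b)) =
      (if i = length as then delta X as x (x', b) else 0)" if "i \<le> length as" for i
  proof -
    have "Sum_any (\<lambda>y. delta_iter X [] (drop i as) x y * delta X (take i as) y (x', b)) =
        delta_iter X [] (drop i as) x x * delta X (take i as) x (x', b)"
      by (rule Sum_any_one) (auto split: if_splits)
    then show ?thesis using that by auto
  qed
  then have "delta_iter X [b] as x x' = (\<Sum>i\<le>length as. if i = length as then delta X as x (x', b) else 0)"
    by simp
  then show ?thesis by simp
qed

lemma Sum_any_words:
  fixes g :: "kmon list \<Rightarrow> bit"
  assumes long: "\<And>bs. length bs \<ge> 2 \<Longrightarrow> g bs = 0" and fin: "finite {b. g [b] \<noteq> 0}"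
  shows "Sum_any g = g [] + Sum_any (\<lambda>b. g [b])"
proof -
  let ?S = "(\<lambda>b. [b]) ` {b. g [b] \<noteq> 0}"
  have "Sum_any g = sum g (insert [] ?S)"
  proof (rule Sum_any.expand_superset)
    show "{bs. g bs \<noteq> 0} \<subseteq> insert [] ?S"
    proof
      fix bs assume "bs \<in> {bs. g bs \<noteq> 0}"
      then have nz: "g bs \<noteq> 0" by simp
      show "bs \<in> insert [] ?S"
        using nz long[of bs] by (cases bs rule: input_cases) auto
    qed
  qed (use fin in simp)
  also have "\<dots> = g [] + sum g ?S"
    using fin by (subst sum.insert) auto
  also have "sum g ?S = Sum_any (\<lambda>b. g [b])"
    unfolding Sum_any.expand_set by (subst sum.reindex) (auto simp: inj_on_def)
  finally show ?thesis .
qed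

lemma finite_delta_H_minus: "finite {b. delta H_minus as x (y, b) \<noteq> 0}"
proof (cases as rule: input_cases)
  case 1
  have "finite (h_delta1 x)" by (cases x) auto
  then have "finite (snd ` h_delta1 x)" by simp
  then show ?thesis
    by (rule rev_finite_subset) (force simp: 1 H_minus_def split: if_splits)
next
  case (2 a)
  have "{b. delta H_minus as x (y, b) \<noteq> 0} \<subseteq> set_option (map_option snd (h_delta2 a x))"
    by (auto simp: 2 H_minus_def split: if_splits)
  then show ?thesis by (rule finite_subset) simp
qed (simp_all add: H_minus_def)

text \<open>\<open>Y\<close> takes at most one input, so longer words of outputs contribute nothing:
  the empty word leaves the differential of \<open>Y\<close>, and one-letter words feed an output of
  the Hopf link bimodule to \<open>Y\<close>.\<close>

lemma delta_box_H_minus: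
  assumes Y: "delta Y = maps d m" and xy: "(x, y) \<in> Basis (chiral hrid (lid Y) (cofinite_space hgens) (da_space Y))"
  shows "delta (H_minus \<boxtimes> Y) as (x, y) ((x', y'), c) = of_bool (as = [] \<and> x' = x) * d y (y', c) +
     Sum_any (\<lambda>b. delta H_minus as x (x', b) * m b y (y', c))"
proof -
  let ?g = "\<lambda>bs. delta_iter H_minus bs as x x' * delta Y bs y (y', c)"
  have "(x, y) \<in> Basis (chiral (rid H_minus) (lid Y) (da_space H_minus) (da_space Y))"
    using xy by (simp add: H_minus_def)
  then have "delta (H_minus \<boxtimes> Y) as (x, y) ((x', y'), c) = Sum_any ?g"
    by (simp add: box_def Let_def)
  also have "\<dots> = ?g [] + Sum_any (\<lambda>b. ?g [b])"
  proof (rule Sum_any_words)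
    show "?g bs = 0" if "2 \<le> length bs" for bs using maps_long[OF that, of d m] by (simp add: Y)
    show "finite {b. ?g [b] \<noteq> 0}"
      by (rule finite_subset[OF _ finite_delta_H_minus[of as x x']]) (auto simp: delta_iter_single simp del: delta_iter.simps)
  qed
  finally show ?thesis
    by (simp add: delta_iter_single Y del: delta_iter.simps(2))
qed

section \<open>Identification of the box products with the model\<close>

fun join :: "hgen' \<times> hgen' \<Rightarrow> xgen" where
  "join ((l, m, s), (m', r, j)) = (l, m, r, s, j)"

lemma left_join:
  assumes "typed f" "fst (snd u) = fst v" "fst (snd u') = fst v'"
  shows "left f (join (u, v)) = Some (join (u', v'), c) \<longleftrightarrow> (\<exists>b. f u = Some (u', b) \<and> act b v = Some (v', c))"
proof -
  obtain l m s where u: "u = (l, m, s)" by (metis prod_cases3)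
  obtain r j where v: "v = (m, r, j)" using assms(2) by (cases v) (auto simp: u)
  obtain l' m' s' where u': "u' = (l', m', s')" by (metis prod_cases3)
  obtain r' j' where v': "v' = (m', r', j')" using assms(3) by (cases v') (auto simp: u')
  show ?thesis
  proof
    assume "left f (join (u, v)) = Some (join (u', v'), c)"
    then obtain b m'' where *: "f (l, m, s) = Some ((l', m', s'), b)" "act b (m, r, j) = Some ((m'', r', j'), c)"
      by (auto simp: u v u' v' split: bind_splits)
    have "klid b = m'" using assms(1) *(1) unfolding typed_def by fastforce
    then have "m'' = m'" using act_typed(2)[OF *(2)] by simp
    then show "\<exists>b. f u = Some (u', b) \<and> act b v = Some (v', c)" using * by (auto simp: u v u' v')
  next
    assume "\<exists>b. f u = Some (u', b) \<and> act b v = Some (v', c)"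
    then show "left f (join (u, v)) = Some (join (u', v'), c)" by (auto simp: u v u' v')
  qed
qed

lemma right_join:
  assumes "fst (snd u) = fst v" "fst (snd u') = fst v'" "\<And>x y b. f x = Some (y, b) \<Longrightarrow> fst y = fst x"
  shows "right f (join (u, v)) = Some (join (u', v'), c) \<longleftrightarrow> u = u' \<and> f v = Some (v', c)"
proof -
  obtain l m s where u: "u = (l, m, s)" by (metis prod_cases3)
  obtain r j where v: "v = (m, r, j)" using assms(1) by (cases v) (auto simp: u)
  obtain l' m' s' where u': "u' = (l', m', s')" by (metis prod_cases3)
  obtain r' j' where v': "v' = (m', r', j')" using assms(2) by (cases v') (auto simp: u')
  show ?thesis using assms(3)[of v] by (auto simp: u v u' v')
qed

text \<open>\<open>f\<close> is single-valued, so at most one \<open>b\<close> contributes, and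
  typing makes the idempotents of the target pair match.\<close>

lemma sum_left:
  fixes k :: "'y \<Rightarrow> hgen'" and t :: "kmon \<Rightarrow> kmon"
  assumes f: "typed f" and P: "P = {(x, y). x \<in> hgens \<and> y \<in> B \<and> hrid x = fst (k y)}"
    and xy: "(x, y) \<in> P"
  shows "Sum_any (\<lambda>b. pullback hgens kap hgens kap (\<lambda>b. b) (op_of f) x (x', b) * pullback B k B k t (op_of (act b)) y (y', c)) =
     pullback P (\<lambda>(x, y). join (kap x, k y)) P (\<lambda>(x, y). join (kap x, k y)) t (op_of (left f)) (x, y) ((x', y'), c)"
    (is "Sum_any ?g = ?R")
proof -
  have x: "x \<in> hgens" "y \<in> B" "fst (snd (kap x)) = fst (k y)" using xy by (auto simp: P hrid_kap)
  have nz: "?g b \<noteq> 0 \<longleftrightarrow> x' \<in> hgens \<and> y' \<in> B \<and> f (kap x) = Some (kap x', b) \<and> act b (k y) = Some (k y', t c)" for b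
    using x by (auto simp: pullback_def)
  have R: "?R \<noteq> 0 \<longleftrightarrow> (\<exists>b. ?g b \<noteq> 0)"
  proof (cases "(x', y') \<in> P")
    case True
    then have "fst (snd (kap x')) = fst (k y')" by (auto simp: P hrid_kap)
    from left_join[OF f x(3) this, of "t c"] show ?thesis unfolding nz using True xy by (auto simp: pullback_def P)
  next
    case False
    have "\<not> ?g b \<noteq> 0" for b
    proof
      assume "?g b \<noteq> 0"
      then have *: "x' \<in> hgens" "y' \<in> B" "f (kap x) = Some (kap x', b)" "act b (k y) = Some (k y', t c)"
        unfolding nz by auto
      have "klid b = fst (snd (kap x'))" using f *(3) unfolding typed_def by blast
      moreover have "klid b = fst (k y')" using act_typed(2)[OF *(4)] .
      ultimately show False using False * by (simp add: P hrid_kap)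
    qed
    then show ?thesis using False by (simp add: pullback_def)
  qed
  show ?thesis
  proof (cases "\<exists>b. ?g b \<noteq> 0")
    case True
    then obtain b where b: "?g b \<noteq> 0" by blast
    have "Sum_any ?g = ?g b"
    proof (rule Sum_any_one)
      fix b' assume "?g b' \<noteq> 0"
      then show "b' = b" using b unfolding nz by simp
    qed
    moreover have "?g b = 1" using b unfolding bit_not_zero_iff .
    moreover have "?R = 1" using True R unfolding bit_not_zero_iff by blast
    ultimately show ?thesis by (simp only:)
  next
    case False
    then have "?g = (\<lambda>b. 0)" by (auto simp del: bit_not_zero_iff)
    moreover have "?R = 0" using False R by blast
    ultimately show ?thesis by (simp only: Sum_any.neutral)
  qed
qed

text \<open>\<open>Y\<close> is any copy of the Hopf link bimodule with coordinates \<open>k\<close>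
  and outputs twisted by \<open>t\<close>, so one computation serves both cylinders.\<close>

lemma delta_box:
  fixes Y :: "'y DA" and k :: "'y \<Rightarrow> hgen'" and t :: "kmon \<Rightarrow> kmon"
  assumes Y: "da_space Y = cofinite_space B" "delta Y = maps (pullback B k B k t dH) (\<lambda>a. pullback B k B k t (op_of (act a)))"
    and lid: "\<And>y. y \<in> B \<Longrightarrow> lid Y y = fst (k y)"
    and P: "P = {(x, y). x \<in> hgens \<and> y \<in> B \<and> hrid x = fst (k y)}"
    and J: "J = (\<lambda>(x, y). join (kap x, k y))"
    and t: "\<And>b. t (t b) = b" and inj: "inj_on k B"
  shows "da_space (H_minus \<boxtimes> Y) = cofinite_space P"
    "delta (H_minus \<boxtimes> Y) = maps (pullback P J P J t (d1X + d2X)) (\<lambda>a. pullback P J P J t (mX a))"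
proof -
  have P': "{(x, y). x \<in> hgens \<and> y \<in> B \<and> hrid x = lid Y y} = P" using lid by (auto simp: P)
  then have chiral: "chiral hrid (lid Y) (cofinite_space hgens) (da_space Y) = cofinite_space P"
    unfolding Y(1) chiral_cofinite by simp
  then show "da_space (H_minus \<boxtimes> Y) = cofinite_space P"
    by (simp add: box_def Let_def H_minus_def)
  let ?m = "\<lambda>a. pullback P J P J t (mX a)"
  note sum = sum_left[where t = t, OF _ P, folded J]
  show "delta (H_minus \<boxtimes> Y) = maps (pullback P J P J t (d1X + d2X)) ?m"
  proof (rule ext, rule ext, rule ext, clarify)
    fix as x y x' y' c
    show "delta (H_minus \<boxtimes> Y) as (x, y) ((x', y'), c) =
        maps (pullback P J P J t (d1X + d2X)) ?m as (x, y) ((x', y'), c)"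
    proof (cases "(x, y) \<in> P")
      case False
      then have "delta (H_minus \<boxtimes> Y) as (x, y) ((x', y'), c) = 0"
        using chiral by (simp add: box_def Let_def H_minus_def)
      moreover have "maps (pullback P J P J t (d1X + d2X)) ?m as (x, y) ((x', y'), c) = 0"
        using False by (cases as rule: input_cases) (simp_all add: pullback_def)
      ultimately show ?thesis by simp
    next
      case True
      then have xy: "x \<in> hgens" "y \<in> B" "fst (snd (kap x)) = fst (k y)" by (auto simp: P hrid_kap)
      have box: "delta (H_minus \<boxtimes> Y) as (x, y) ((x', y'), c) = of_bool (as = [] \<and> x' = x) * pullback B k B k t dH y (y', c) +
         Sum_any (\<lambda>b. delta H_minus as x (x', b) * pullback B k B k t (op_of (act b)) y (y', c))"
        using True chiral by (intro delta_box_H_minus[OF Y(2)]) simp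
      show ?thesis
      proof (cases as rule: input_cases)
        case 1
        let ?T = "\<lambda>f b. pullback hgens kap hgens kap (\<lambda>b. b) (op_of f) x (x', b) * pullback B k B k t (op_of (act b)) y (y', c)"
        have fin: "finite {b. ?T f b \<noteq> 0}" for f
          by (rule finite_subset[of _ "set_option (map_option snd (f (kap x)))"]) (auto simp: pullback_def split: if_splits)
        \<comment> \<open>Separating the \<sigma> and \<tau> terms leaves single-valued maps, to
          which \<open>sum_left\<close> applies.\<close>
        have "Sum_any (\<lambda>b. delta H_minus [] x (x', b) * pullback B k B k t (op_of (act b)) y (y', c)) =
            Sum_any (\<lambda>b. ?T dsigma b + ?T dtau b)"
          unfolding delta_H_minus maps_simps dH_def pullback_add plus_fun_apply distrib_right ..
        also have "\<dots> = Sum_any (?T dsigma) + Sum_any (?T dtau)"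
          by (rule Sum_any.distrib[OF fin fin])
        also have "\<dots> = pullback P J P J t d1X (x, y) ((x', y'), c)"
          unfolding sum[OF typed_dsigma True] sum[OF typed_dtau True] d1X_def pullback_add plus_fun_apply ..
        finally have d1: "Sum_any (\<lambda>b. delta H_minus [] x (x', b) * pullback B k B k t (op_of (act b)) y (y', c)) =
            pullback P J P J t d1X (x, y) ((x', y'), c)" .
        have d2: "of_bool (x' = x) * pullback B k B k t (op_of f) y (y', c) = pullback P J P J t (op_of (right f)) (x, y) ((x', y'), c)"
          if f: "\<And>x y b. f x = Some (y, b) \<Longrightarrow> fst y = fst x" for f
        proof (cases "(x', y') \<in> P")
          case True
          then have "x' \<in> hgens" "y' \<in> B" "fst (snd (kap x')) = fst (k y')" by (auto simp: P hrid_kap)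
          with right_join[where c = "t c", OF xy(3) this(3) f] kap_inj[OF xy(1), of x'] show ?thesis
            using True \<open>(x, y) \<in> P\<close> xy by (auto simp: pullback_def J op_of_def)
        next
          case False
          have "\<not> (x' = x \<and> y' \<in> B \<and> f (k y) = Some (k y', t c))"
          proof
            assume *: "x' = x \<and> y' \<in> B \<and> f (k y) = Some (k y', t c)"
            then have "fst (k y') = fst (k y)" using f by blast
            then show False using False xy * by (simp add: P hrid_kap)
          qed
          then show ?thesis using False by (auto simp: pullback_def)
        qed
        show ?thesis
          unfolding box unfolding 1 d1 maps_simps
          using d2[of dsigma, OF dsigma_fst] d2[of dtau, OF dtau_fst]
          by (simp only: dH_def d2X_def pullback_add plus_fun_apply distrib_left add_ac simp_thms)
      next
        case (2 a)
        have "delta H_minus [a] = pullback hgens kap hgens kap (\<lambda>b. b) (op_of (act a))"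
          by (simp add: delta_H_minus)
        then show ?thesis
          unfolding box unfolding 2 maps_simps mX_def using sum[OF typed_act True] by simp
      qed (unfold box, simp_all add: delta_H_minus)
    qed
  qed
qed

lemma join_bij:
  fixes k :: "'y \<Rightarrow> hgen'"
  assumes k: "bij_betw k B UNIV"
  shows "bij_betw (\<lambda>(x, y). join (kap x, k y)) {(x, y). x \<in> hgens \<and> y \<in> B \<and> hrid x = fst (k y)} UNIV"
proof (rule bij_betwI')
  fix p q assume p: "p \<in> {(x, y). x \<in> hgens \<and> y \<in> B \<and> hrid x = fst (k y)}"
    and q: "q \<in> {(x, y). x \<in> hgens \<and> y \<in> B \<and> hrid x = fst (k y)}"
  obtain x y x' y' where pq: "p = (x, y)" "q = (x', y')" by (metis prod.exhaust)
  have mem: "x \<in> hgens" "y \<in> B" "fst (snd (kap x)) = fst (k y)" "x' \<in> hgens" "y' \<in> B" "fst (snd (kap x')) = fst (k y')"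
    using p q by (auto simp: pq hrid_kap)
  have "join (u, v) = join (u', v') \<longleftrightarrow> u = u' \<and> v = v'" if "fst (snd u) = fst v" "fst (snd u') = fst v'" for u v u' v'
    using that by (cases u; cases v; cases u'; cases v') auto
  from this[OF mem(3,6)] show "(case p of (x, y) \<Rightarrow> join (kap x, k y)) = (case q of (x, y) \<Rightarrow> join (kap x, k y)) \<longleftrightarrow> p = q"
    using kap_inj[OF mem(1,4)] k mem(2,5) by (auto simp: pq bij_betw_def inj_on_def)
next
  fix z :: xgen
  obtain l m r s j where z: "z = (l, m, r, s, j)" by (metis prod_cases5)
  obtain x y where "x \<in> hgens" "kap x = (l, m, s)" "y \<in> B" "k y = (m, r, j)"
    using kap_bij k by (metis UNIV_I bij_betw_imp_surj_on imageE)
  then show "\<exists>p\<in>{(x, y). x \<in> hgens \<and> y \<in> B \<and> hrid x = fst (k y)}. z = (case p of (x, y) \<Rightarrow> join (kap x, k y))"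
    by (intro bexI[of _ "(x, y)"]) (auto simp: z hrid_kap)
qed simp

lemma lidx_join: "lidx (join (u, v)) = fst u" and ridx_join: "ridx (join (u, v)) = fst (snd v)"
  by (cases u; cases v; simp)+

text \<open>The retraction of the model is carried back to generators by \<open>J\<close> and
  twisted by \<open>t\<close>, so the action on the small side becomes \<open>t\<close> composed
  with E.\<close>

lemma box_equivalent:
  fixes Y :: "'y DA" and k :: "'y \<Rightarrow> hgen'" and t :: "kmon \<Rightarrow> kmon"
  assumes Y: "da_space Y = cofinite_space B" "delta Y = maps (pullback B k B k t dH) (\<lambda>a. pullback B k B k t (op_of (act a)))"
    and lid: "\<And>y. y \<in> B \<Longrightarrow> lid Y y = fst (k y)" and rid: "\<And>y. y \<in> B \<Longrightarrow> rid Y y = fst (snd (k y))"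
    and k: "bij_betw k B UNIV" and t: "monomial_involution t"
    and Z: "da_space Z = cofinite_space UNIV" "Defs.lid Z = (\<lambda>e. e)" "Defs.rid Z = (\<lambda>e. e)"
      "delta Z = maps 0 (\<lambda>a. pullback UNIV (\<lambda>e. e) UNIV (\<lambda>e. e) t (muE a))"
  shows "DA_homotopy_equivalent (H_minus \<boxtimes> Y) Z"
proof -
  interpret monomial_involution t by (rule t)
  define P where "P = {(x, y). x \<in> hgens \<and> y \<in> B \<and> hrid x = fst (k y)}"
  define J where "J = (\<lambda>(x, y). join (kap x, k y))"
  have inj: "inj_on k B" using k by (simp add: bij_betw_def)
  have J: "bij_betw J P UNIV" unfolding J_def P_def by (rule join_bij[OF k])
  have l: "Defs.lid (H_minus \<boxtimes> Y) p = lidx (J p)" and r: "Defs.rid (H_minus \<boxtimes> Y) p = ridx (J p)"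
    if "p \<in> P" for p
    using that rid by (auto simp: P_def J_def box_def Let_def H_minus_def lidx_join ridx_join hlid_kap)
  have bij_id: "bij_betw (\<lambda>e. e) UNIV (UNIV :: idem set)" by (simp add: bij_betw_def inj_on_def)
  have "retraction P (Defs.lid (H_minus \<boxtimes> Y)) (Defs.rid (H_minus \<boxtimes> Y)) (pullback P J P J t (d1X + d2X))
      (\<lambda>a. pullback P J P J t (mX a)) UNIV (\<lambda>e. e) (\<lambda>e. e) (\<lambda>a. pullback UNIV (\<lambda>e. e) UNIV (\<lambda>e. e) t (muE a))
      (pullback UNIV (\<lambda>e. e) P J t model.i') (pullback P J UNIV (\<lambda>e. e) t model.p') (pullback P J P J t hX)"
    by (rule retraction_pullback[OF model.retraction J bij_id]) (simp_all add: l r)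
  then show ?thesis
    by (rule retraction.equivalent)
      (simp_all only: Z delta_box[OF Y lid P_def J_def invol inj])
qed

section \<open>The two mapping cylinders\<close>

lemma X_Cyl_E_equivalent: "DA_homotopy_equivalent X_Cyl_E (alg_bimodule E_alg)"
  unfolding X_Cyl_E_def
proof (rule box_equivalent[OF _ delta_H_minus _ _ kap_bij involution_id])
  show "delta (alg_bimodule E_alg) = maps 0 (\<lambda>a. pullback UNIV (\<lambda>e. e) UNIV (\<lambda>e. e) (\<lambda>b. b) (muE a))"
  proof (rule ext, rule ext, rule ext, clarify)
    fix as e e' c
    show "delta (alg_bimodule E_alg) as e (e', c) = maps 0 (\<lambda>a. pullback UNIV (\<lambda>e. e) UNIV (\<lambda>e. e) (\<lambda>b. b) (muE a)) as e (e', c)"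
      by (cases as rule: input_cases)
         (auto simp: alg_bimodule_def pullback_def muE_def op_of_def E_alg_def push_def lookup_single when_def)
  qed
qed (auto simp: H_minus_def hlid_kap hrid_kap alg_bimodule_def)

lemma H_plus_space: "da_space H_plus = cofinite_space {(x, e). x \<in> hgens \<and> hrid x = e}"
  by (simp add: H_plus_def box_def Let_def H_minus_def alg_bimodule_def chiral_cofinite)

lemma delta_alg: "delta (alg_bimodule E_alg) = maps 0 (\<lambda>a e (e', c). of_bool (krid a = e \<and> klid a = e' \<and> c = E_mon a))"
proof (rule ext, rule ext, rule ext, clarify)
  fix as e e' c
  show "delta (alg_bimodule E_alg) as e (e', c) =
      maps 0 (\<lambda>a e (e', c). of_bool (krid a = e \<and> klid a = e' \<and> c = E_mon a)) as e (e', c)"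
    by (cases as rule: input_cases)
       (auto simp: alg_bimodule_def E_alg_def push_def lookup_single when_def)
qed

text \<open>The second component of a generator is forced by its right idempotent, so the factor [E]
  only replaces an output b by E(b); the sum over b keeps the single term b = E(c).\<close>

lemma delta_H_plus:
  assumes B: "B = {(x, e). x \<in> hgens \<and> hrid x = e}"
  shows "delta H_plus = maps (pullback B (kap \<circ> fst) B (kap \<circ> fst) E_mon dH) (\<lambda>a. pullback B (kap \<circ> fst) B (kap \<circ> fst) E_mon (op_of (act a)))"
proof (rule ext, rule ext, rule ext, clarify)
  interpret monomial_involution E_mon by (rule involution_E)
  fix as x e x' e' c
  let ?R = "maps (pullback B (kap \<circ> fst) B (kap \<circ> fst) E_mon dH) (\<lambda>a. pullback B (kap \<circ> fst) B (kap \<circ> fst) E_mon (op_of (act a)))"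
  have chiral: "chiral hrid (Defs.lid (alg_bimodule E_alg)) (cofinite_space hgens) (da_space (alg_bimodule E_alg)) = cofinite_space B"
    by (simp add: alg_bimodule_def chiral_cofinite B)
  show "delta H_plus as (x, e) ((x', e'), c) = ?R as (x, e) ((x', e'), c)"
  proof (cases "(x, e) \<in> B")
    case False
    then have "delta H_plus as (x, e) ((x', e'), c) = 0"
      using chiral by (simp add: H_plus_def box_def Let_def H_minus_def)
    moreover have "?R as (x, e) ((x', e'), c) = 0"
      using False by (cases as rule: input_cases) (simp_all add: pullback_def)
    ultimately show ?thesis by simp
  next
    case True
    let ?g = "\<lambda>b. delta H_minus as x (x', b) * of_bool (krid b = e \<and> klid b = e' \<and> c = E_mon b)"
    have "delta H_plus as (x, e) ((x', e'), c) = Sum_any ?g"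
      unfolding H_plus_def using delta_box_H_minus[OF delta_alg, of x e as x' e' c] True chiral by simp
    also have "\<dots> = ?g (E_mon c)"
      by (rule Sum_any_one) (auto split: if_splits)
    also have "\<dots> = ?R as (x, e) ((x', e'), c)"
    proof -
      have idems: "krid b = hrid x \<and> klid b = hrid x'" if "delta H_minus as x (x', b) \<noteq> 0" for b
      proof (cases as rule: input_cases)
        case 1
        then have "dsigma (kap x) = Some (kap x', b) \<or> dtau (kap x) = Some (kap x', b)"
          using that by (auto simp: delta_H_minus pullback_def dH_apply split: if_splits)
        then show ?thesis using typed_dsigma typed_dtau unfolding typed_def hrid_kap by blast
      next
        case (2 a)
        then have "act a (kap x) = Some (kap x', b)"
          using that by (auto simp: delta_H_minus pullback_def split: if_splits)
        then show ?thesis using act_typed by (simp add: hrid_kap)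
      qed (use that in \<open>simp_all add: delta_H_minus\<close>)
      have e: "x \<in> hgens" "hrid x = e" using True by (auto simp: B)
      show ?thesis
      proof (cases "x' \<in> hgens \<and> hrid x' = e'")
        case True
        then have "?g (E_mon c) = delta H_minus as x (x', E_mon c)"
          using idems[of "E_mon c"] e by (cases "delta H_minus as x (x', E_mon c)") auto
        also have "\<dots> = ?R as (x, e) ((x', e'), c)"
          using True e by (cases as rule: input_cases) (simp_all add: delta_H_minus pullback_def B)
        finally show ?thesis .
      next
        case False
        have "?g (E_mon c) = 0"
        proof (cases "x' \<in> hgens")
          case True
          then show ?thesis using False idems[of "E_mon c"] by (cases "delta H_minus as x (x', E_mon c)") auto
        next
          case False
          then show ?thesis
            by (cases as rule: input_cases) (simp_all add: delta_H_minus pullback_def)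
        qed
        moreover have "?R as (x, e) ((x', e'), c) = 0"
          using False by (cases as rule: input_cases) (auto simp: pullback_def B)
        ultimately show ?thesis by simp
      qed
    qed
    finally show ?thesis .
  qed
qed

text \<open>The outputs are twisted by E once more, so the transferred action is E composed with E,
  the identity.\<close>

lemma X_Cyl_id_equivalent: "DA_homotopy_equivalent X_Cyl_id (alg_bimodule id)"
  unfolding X_Cyl_id_def
proof (rule box_equivalent[OF H_plus_space delta_H_plus[OF refl] _ _ _ involution_E])
  show "delta (alg_bimodule id) = maps 0 (\<lambda>a. pullback UNIV (\<lambda>e. e) UNIV (\<lambda>e. e) E_mon (muE a))"
  proof (rule ext, rule ext, rule ext, clarify)
    fix as e e' c
    have "E_mon a = E_mon c \<longleftrightarrow> a = c" for a
      using monomial_involution.invol[OF involution_E] by metis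
    then show "delta (alg_bimodule id) as e (e', c) = maps 0 (\<lambda>a. pullback UNIV (\<lambda>e. e) UNIV (\<lambda>e. e) E_mon (muE a)) as e (e', c)"
      by (cases as rule: input_cases)
         (auto simp: alg_bimodule_def pullback_def muE_def op_of_def lookup_single when_def)
  qed
  show "bij_betw (kap \<circ> fst) {(x, e). x \<in> hgens \<and> hrid x = e} UNIV"
  proof (rule bij_betw_trans[OF _ kap_bij])
    show "bij_betw fst {(x, e). x \<in> hgens \<and> hrid x = e} hgens"
      by (rule bij_betw_byWitness[where f' = "\<lambda>x. (x, hrid x)"]) auto
  qed
qed (auto simp: H_plus_def box_def Let_def H_minus_def alg_bimodule_def hlid_kap hrid_kap)

theorem theorem1p6:
  shows "DA_homotopy_equivalent X_Cyl_id (alg_bimodule id) \<and>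
         DA_homotopy_equivalent X_Cyl_E (alg_bimodule E_alg)"
  by (rule conjI[OF X_Cyl_id_equivalent X_Cyl_E_equivalent])

end
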